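(* Let $T>0$, $\beta\in(0,1]$, let $H\colon[0,T]\times\mathbb{R}^d\times\mathbb{R}^d\to\mathbb{R}$, and let $\mathcal{L}$ be a Lévy operator with triplet $(A,0,\mu)$ and heat kernel $p_t$. Assume: (1) $p_t\in C_b^\infty(\mathbb{R}^d)$ and there exist $\alpha\in(1,2]$ and $c_0>0$ such that $\int_{\mathbb{R}^d}|Dp_t(y)|\,dy\le c_0t^{-1/\alpha}$ for all $t\in(0,T]$; moreover $\alpha+\beta\notin\mathbb{N}$; (2) $H$ is continuous, there is $H_0>0$ with $|H(t,x,0)|\le H_0$ for all $t\in(0,T)$, $x\in\mathbb{R}^d$, and for each $R>0$ there is $L_R>0$ such that $|H(t,x,p)-H(t,x,q)|\le L_R|p-q|$ for all $t\in(0,T)$, $x\in\mathbb{R}^d$, $p,q\in B(0,R)$; (3) for each $R>0$ there is $M_R>0$ such that $|H(t,x,p)-H(t,x',p)|\le M_R|x-x'|^\beta$ for all $t\in[0,T]$, $p\in B(0,R)$ and $x,x'\in\mathbb{R}^d$ with $|x-x'|<1$; (4) $u_0\colon\mathbb{R}^d\to\mathbb{R}$ is bounded and Lipschitz; (5) either $\alpha+\beta>2$, or $A=0$ and $\int_{\mathbb{R}^d}(1\wedge|z|^\sigma)\,d\mu(z)<\infty$ for some $\sigma\in(\alpha,\alpha+\beta)$. Let $u\in C_b((0,T];C_b^1(\mathbb{R}^d))$ be a mild solution of $$\partial_tu-\mathcal{L}u-H(t,x,Du)=0\ \text{ in }(0,T]\times\mathbb{R}^d,\qquad u(0,x)=u_0(x).$$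 Then $u$ is a classical solution: it satisfies the equation pointwise on $(0,T]\times\mathbb{R}^d$, and $u(t,x)\to u_0(x)$ as $t\to0$ for every $x\in\mathbb{R}^d$.
   Context: Lévy operator: $A$ is a nonnegative definite real symmetric $d\times d$ matrix, $\mu\ge 0$ is a Borel measure on $\mathbb{R}^d\setminus\{0\}$ with $\int(1\wedge|z|^2)\,d\mu(z)<\infty$, and $$\mathcal{L}\varphi(x)=\operatorname{div}(AD\varphi(x))+\int_{\mathbb{R}^d}\big[\varphi(x+z)-\varphi(x)-\mathbf{1}_{|z|<1}D\varphi(x)\cdot z\big]\,d\mu(z).$$ Heat kernel: $p_t$, $t>0$, are the probability measures with $\int e^{-i\xi\cdot x}p_t(dx)=e^{-t\psi(\xi)}$, where $\psi(\xi)=\xi\cdot A\xi+\int(1-e^{i\xi\cdot z}+i\xi\cdot z\mathbf{1}_{|z|<1})\,d\mu(z)$; they are assumed absolutely continuous with density again denoted $p_t$. Semigroup: $P_t\varphi=p_t*\varphi$. $C_b^1(\mathbb{R}^d)$: functions with bounded continuous derivatives up to order 1, with the usual norm; $C_b((0,T];X)$ denotes bounded continuous functions from $(0,T]$ to $X$; $D$ is the spatial gradient. Mild solution: $u\in C((0,T];C_b^1(\mathbb{R}^d))$ such that for all $t\in(0,T]$, $x\in\mathbb{R}^d$, $$u(t,x)=P_t[u_0](x)+\int_0^tP_{t-s}\big[H(s,\cdot,Du(s,\cdot))\big](x)\,ds.$$ *)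

theory Defs
  imports "HOL-Analysis.Analysis" "HOL-Probability.Probability_Measure"
begin

definition partial_deriv :: "'n \<Rightarrow> (real^'n \<Rightarrow> real) \<Rightarrow> real^'n \<Rightarrow> real" where
  "partial_deriv i f x = frechet_derivative f (at x) (axis i 1)"

definition gradient :: "(real^'n \<Rightarrow> real) \<Rightarrow> real^'n \<Rightarrow> real^'n" where
  "gradient f x = (\<chi> i. partial_deriv i f x)"

definition divergence :: "(real^'n \<Rightarrow> real^'n) \<Rightarrow> real^'n \<Rightarrow> real" where
  "divergence V x = (\<Sum>i\<in>UNIV. frechet_derivative V (at x) (axis i 1) $ i)"

text \<open>\<open>Cb k f\<close> says that \<open>f\<close> has bounded continuous derivatives up to order \<open>k\<close>.\<close>

primrec Cb :: "nat \<Rightarrow> (real^'n \<Rightarrow> real) \<Rightarrow> bool" where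
  "Cb 0 f \<longleftrightarrow> continuous_on UNIV f \<and> bounded (range f)"
| "Cb (Suc k) f \<longleftrightarrow> continuous_on UNIV f \<and> bounded (range f) \<and>
     (\<forall>x. f differentiable (at x)) \<and> (\<forall>i. Cb k (partial_deriv i f))"

definition Cb_infinity :: "(real^'n \<Rightarrow> real) \<Rightarrow> bool" where
  "Cb_infinity f \<longleftrightarrow> (\<forall>k. Cb k f)"

definition Cb1_norm :: "(real^'n \<Rightarrow> real) \<Rightarrow> real" where
  "Cb1_norm f = (SUP x. \<bar>f x\<bar>) + (SUP x. norm (gradient f x))"

text \<open>The spaces \<open>C((0,T]; C\<^sub>b\<^sup>1)\<close> and \<open>C\<^sub>b((0,T]; C\<^sub>b\<^sup>1)\<close>. The values of \<open>u\<close> outside \<open>(0,T]\<close> are irrelevant.\<close>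

definition cont_into_Cb1 :: "real \<Rightarrow> (real \<Rightarrow> real^'n \<Rightarrow> real) \<Rightarrow> bool" where
  "cont_into_Cb1 T u \<longleftrightarrow>
     (\<forall>t\<in>{0<..T}. Cb 1 (u t)) \<and>
     (\<forall>t\<in>{0<..T}. ((\<lambda>s. Cb1_norm (\<lambda>x. u s x - u t x)) \<longlongrightarrow> 0) (at t within {0<..T}))"

definition bounded_cont_into_Cb1 :: "real \<Rightarrow> (real \<Rightarrow> real^'n \<Rightarrow> real) \<Rightarrow> bool" where
  "bounded_cont_into_Cb1 T u \<longleftrightarrow>
     cont_into_Cb1 T u \<and> (\<exists>C. \<forall>t\<in>{0<..T}. Cb1_norm (u t) \<le> C)"

text \<open>A triplet \<open>(A,0,\<mu>)\<close>; a Borel measure on the space without the origin is encoded as a Borel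
  measure on the whole space that gives no mass to the origin.\<close>

definition levy_triplet :: "real^'n^'n \<Rightarrow> (real^'n) measure \<Rightarrow> bool" where
  "levy_triplet A \<mu> \<longleftrightarrow>
     transpose A = A \<and> (\<forall>x. 0 \<le> x \<bullet> (A *v x)) \<and>
     sets \<mu> = sets borel \<and> emeasure \<mu> {0} = 0 \<and>
     (\<integral>\<^sup>+z. ennreal (min 1 ((norm z)\<^sup>2)) \<partial>\<mu>) < \<infinity>"

definition levy_integrand :: "(real^'n \<Rightarrow> real) \<Rightarrow> real^'n \<Rightarrow> real^'n \<Rightarrow> real" where
  "levy_integrand \<phi> x z = \<phi> (x + z) - \<phi> x - indicator (ball 0 1) z * (gradient \<phi> x \<bullet> z)"

definition levy_operator ::
  "real^'n^'n \<Rightarrow> (real^'n) measure \<Rightarrow> (real^'n \<Rightarrow> real) \<Rightarrow> real^'n \<Rightarrow> real" where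
  "levy_operator A \<mu> \<phi> x =
     divergence (\<lambda>y. A *v gradient \<phi> y) x + (LINT z|\<mu>. levy_integrand \<phi> x z)"

text \<open>Derivatives and integrals are total functions in HOL, so a pointwise equation has to say
  separately that the terms of \<open>levy_operator A \<mu> \<phi> x\<close> exist. If \<open>A = 0\<close>, then no second
  derivatives of \<open>\<phi>\<close> are needed.\<close>

definition levy_operator_defined ::
  "real^'n^'n \<Rightarrow> (real^'n) measure \<Rightarrow> (real^'n \<Rightarrow> real) \<Rightarrow> real^'n \<Rightarrow> bool" where
  "levy_operator_defined A \<mu> \<phi> x \<longleftrightarrow>
     (\<forall>y. \<phi> differentiable (at y)) \<and>
     (\<lambda>y. A *v gradient \<phi> y) differentiable (at x) \<and>
     integrable \<mu> (levy_integrand \<phi> x)"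

definition levy_symbol :: "real^'n^'n \<Rightarrow> (real^'n) measure \<Rightarrow> real^'n \<Rightarrow> complex" where
  "levy_symbol A \<mu> \<xi> = complex_of_real (\<xi> \<bullet> (A *v \<xi>)) +
     (LINT z|\<mu>. 1 - exp (\<i> * complex_of_real (\<xi> \<bullet> z))
        + \<i> * complex_of_real (\<xi> \<bullet> z) * indicator (ball 0 1) z)"

text \<open>\<open>p t\<close> is the density of the heat kernel at time \<open>t > 0\<close>.\<close>

definition heat_kernel ::
  "real^'n^'n \<Rightarrow> (real^'n) measure \<Rightarrow> (real \<Rightarrow> real^'n \<Rightarrow> real) \<Rightarrow> bool" where
  "heat_kernel A \<mu> p \<longleftrightarrow> (\<forall>t>0.
     p t \<in> borel_measurable borel \<and> (\<forall>x. 0 \<le> p t x) \<and>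
     prob_space (density lborel (\<lambda>x. ennreal (p t x))) \<and>
     (\<forall>\<xi>. (LINT x|density lborel (\<lambda>x. ennreal (p t x)). exp (- (\<i> * complex_of_real (\<xi> \<bullet> x))))
            = exp (- (complex_of_real t * levy_symbol A \<mu> \<xi>))))"

definition heat_semigroup ::
  "(real \<Rightarrow> real^'n \<Rightarrow> real) \<Rightarrow> real \<Rightarrow> (real^'n \<Rightarrow> real) \<Rightarrow> real^'n \<Rightarrow> real" where
  "heat_semigroup p t \<phi> x = (LINT y|lborel. p t (x - y) * \<phi> y)"

definition mild_solution ::
  "(real \<Rightarrow> real^'n \<Rightarrow> real) \<Rightarrow> (real \<Rightarrow> real^'n \<Rightarrow> real^'n \<Rightarrow> real) \<Rightarrow> real \<Rightarrow>
   (real^'n \<Rightarrow> real) \<Rightarrow> (real \<Rightarrow> real^'n \<Rightarrow> real) \<Rightarrow> bool" where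
  "mild_solution p H T u0 u \<longleftrightarrow> cont_into_Cb1 T u \<and>
     (\<forall>t\<in>{0<..T}. \<forall>x. u t x = heat_semigroup p t u0 x +
        (LBINT s=0..t. heat_semigroup p (t - s) (\<lambda>y. H s y (gradient (u s) y)) x))"

text \<open>The time derivative is taken within \<open>(0,T]\<close>: it is two-sided for \<open>t < T\<close> and one-sided at \<open>T\<close>.\<close>

definition classical_solution ::
  "real^'n^'n \<Rightarrow> (real^'n) measure \<Rightarrow> (real \<Rightarrow> real^'n \<Rightarrow> real^'n \<Rightarrow> real) \<Rightarrow> real \<Rightarrow>
   (real^'n \<Rightarrow> real) \<Rightarrow> (real \<Rightarrow> real^'n \<Rightarrow> real) \<Rightarrow> bool" where
  "classical_solution A \<mu> H T u0 u \<longleftrightarrow>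
     (\<forall>t\<in>{0<..T}. \<forall>x. levy_operator_defined A \<mu> (u t) x \<and>
        (\<exists>u'. ((\<lambda>s. u s x) has_real_derivative u') (at t within {0<..T}) \<and>
              u' - levy_operator A \<mu> (u t) x - H t x (gradient (u t) x) = 0)) \<and>
     (\<forall>x. ((\<lambda>t. u t x) \<longlongrightarrow> u0 x) (at_right 0))"

end

theory Submission
  imports Defs "HOL-Probability.Probability"
begin

text \<open>The kernel acts on Fourier integrals as the multiplier \<open>exp (- t \<psi>)\<close>. Approximating general functions by Fourier
  integrals (truncate, then mollify with a Gaussian) gives the semigroup property and the Dynkin formula
  \<open>P h \<phi> - \<phi> = \<integral>\<^sub>0\<^sup>h P r (L \<phi>) dr\<close>. The \<open>L\<^sup>1\<close> bound on the gradient of the kernel, the semigroup property and real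
  interpolation bound the first two derivatives of \<open>P t \<phi>\<close> for \<open>\<gamma>\<close>-Holder \<open>\<phi>\<close> by \<open>t powr ((\<gamma> - 1) / \<alpha>)\<close> and
  \<open>t powr ((\<gamma> - 2) / \<alpha>)\<close>. Inserted into the Duhamel formula, this raises the Holder exponent of \<open>Du\<close> step by step,
  locally uniformly on \<open>(0,T]\<close>, until \<open>H(s, x, Du)\<close> is \<open>\<beta>\<close>-Holder in \<open>x\<close>; then \<open>u\<close> has bounded second derivatives if
  \<open>\<alpha> + \<beta> > 2\<close>, and a \<open>(\<sigma> - 1)\<close>-Holder gradient otherwise, which is what \<open>L u\<close> needs. Finally, in
  \<open>u t - u s = (P (t - s) (u s) - u s) + \<integral>\<^sub>s\<^sup>t P (t - r) (H(r, x, Du)) dr\<close> the first term is given by the Dynkin formula,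
  and the difference quotients converge because \<open>L u\<close> and \<open>H(s, x, Du)\<close> are jointly continuous and the kernel
  concentrates at the origin as time tends to \<open>0\<close>.\<close>

subsection \<open>Differentiation under the integral, real interpolation\<close>

text \<open>The only quantitative hypothesis on the kernel is the L1 bound of order t^(-1/\<alpha>)
  on its gradient; nothing is assumed about L p_t. So the Duhamel integral is not differentiated in
  time under the integral sign, and regularity has to come from space derivatives. Each derivative
  of P r costs r^(-1/\<alpha>), and Holder regularity of the source pays back: a g-Holder source
  contributes r^((g-1-\<theta>)/\<alpha>) to the \<theta>-Holder seminorm of Du, integrable at r = 0
  exactly if \<theta> < \<alpha> - 1 + g. As \<alpha> > 1, one round gains almost \<alpha> - 1, and
  finitely many rounds reach \<beta>, the ceiling set by the dependence of H on x. With g = \<beta>,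
  two derivatives give an integrable singularity exactly if \<alpha> + \<beta> > 2. Below that, what
  is left is \<theta> < \<alpha> + \<beta> - 1 for Du, which matches jump measures with a moment of
  order \<sigma> = 1 + \<theta> but yields no second derivatives, whence A = 0. In the approximation
  by Fourier integrals, L acts on those whose coefficients have a second moment: truncation makes
  the function integrable, the Gaussian supplies the moment.\<close>

lemma gderiv_bound:
  fixes f :: "'a::real_inner \<Rightarrow> real"
  assumes "\<And>x. GDERIV f x :> V x" "\<And>x. norm (V x) \<le> K"
  shows "\<bar>f x - f y\<bar> \<le> K * norm (x - y)"
proof -
  have K: "0 \<le> K" using assms(2) norm_ge_zero order_trans by blast
  have "norm (f x - f y) \<le> K * norm (x - y)"
  proof (rule differentiable_bound[of UNIV f "\<lambda>x h. h \<bullet> V x"])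
    show "(f has_derivative (\<lambda>h. h \<bullet> V x)) (at x within UNIV)" for x
      using assms(1)[of x] by (simp add: gderiv_def)
    show "onorm (\<lambda>h. h \<bullet> V x) \<le> K" for x
    proof (rule onorm_bound[OF K])
      fix h show "norm (h \<bullet> V x) \<le> K * norm h"
        using Cauchy_Schwarz_ineq2[of h "V x"] mult_left_mono[OF assms(2)[of x] norm_ge_zero[of h]]
        by (simp add: mult.commute)
    qed
  qed auto
  then show ?thesis by simp
qed

text \<open>Mean value inequality for \<open>f y - V x \<bullet> y\<close> on the ball of radius |z|
  about x, where its gradient \<open>V y - V x\<close> is at most C |z|^\<theta>.\<close>

lemma gderiv_taylor_holder:
  fixes f :: "'a::real_inner \<Rightarrow> real"
  assumes der: "\<And>x. GDERIV f x :> V x"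
    and hol: "\<And>x y. norm (V x - V y) \<le> C * norm (x - y) powr \<theta>"
    and "0 \<le> \<theta>" "0 \<le> C"
  shows "\<bar>f (x + z) - f x - V x \<bullet> z\<bar> \<le> C * norm z powr (1 + \<theta>)"
proof (cases "z = 0")
  case False
  have "norm ((f (x + z) - V x \<bullet> (x + z)) - (f x - V x \<bullet> x)) \<le> C * norm z powr \<theta> * norm (x + z - x)"
  proof (rule differentiable_bound[of "cball x (norm z)" "\<lambda>y. f y - V x \<bullet> y" "\<lambda>y h. h \<bullet> (V y - V x)"])
    show "((\<lambda>y. f y - V x \<bullet> y) has_derivative (\<lambda>h. h \<bullet> (V y - V x))) (at y within cball x (norm z))" for y
    proof -
      have "((\<lambda>y. f y - V x \<bullet> y) has_derivative (\<lambda>h. h \<bullet> V y - V x \<bullet> h)) (at y)"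
        using der[of y] unfolding gderiv_def by (auto intro!: derivative_intros)
      then show ?thesis
        by (auto intro: has_derivative_at_withinI simp: inner_diff_right inner_commute)
    qed
    show "onorm (\<lambda>h. h \<bullet> (V y - V x)) \<le> C * norm z powr \<theta>" if y: "y \<in> cball x (norm z)" for y
    proof (rule onorm_bound)
      show "0 \<le> C * norm z powr \<theta>" using assms(4) by simp
      fix h
      have "norm (y - x) powr \<theta> \<le> norm z powr \<theta>"
        using y assms(3) by (intro powr_mono2) (auto simp: dist_norm norm_minus_commute)
      then have "norm (V y - V x) \<le> C * norm z powr \<theta>"
        using hol[of y x] mult_left_mono[OF _ assms(4)] by (meson order_trans)
      then show "norm (h \<bullet> (V y - V x)) \<le> C * norm z powr \<theta> * norm h"
        using Cauchy_Schwarz_ineq2[of h "V y - V x"] mult_left_mono[OF _ norm_ge_zero[of h]]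
        by (smt (verit) mult.commute real_norm_def)
    qed
  qed (auto simp: dist_norm)
  then show ?thesis using False by (simp add: inner_add_right powr_add mult.commute mult.left_commute)
qed simp

lemma gderiv_continuous: "GDERIV f x :> v \<Longrightarrow> isCont f x"
  unfolding gderiv_def by (rule has_derivative_continuous)

lemma gderiv_unique:
  assumes "GDERIV f x :> u" "GDERIV f x :> v" shows "u = v"
proof -
  have "(\<lambda>h. h \<bullet> u) = (\<lambda>h. h \<bullet> v)"
    using assms unfolding gderiv_def by (rule has_derivative_unique)
  then have "(u - v) \<bullet> u = (u - v) \<bullet> v" by metis
  then have "(u - v) \<bullet> (u - v) = 0" by (simp add: inner_diff_right)
  then show ?thesis by simp
qed

text \<open>Directional derivatives as limits of a sequence: this form gives measurability in a
  parameter and lets bounds pass to the limit.\<close>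

lemma gderiv_scale_tendsto:
  assumes "GDERIV f x :> v"
  shows "(\<lambda>n. real (Suc n) * (f (x + (1 / real (Suc n)) *\<^sub>R b) - f x)) \<longlonglongrightarrow> b \<bullet> v"
proof -
  have "((\<lambda>s. f (x + s *\<^sub>R b)) has_derivative (\<lambda>s. (s *\<^sub>R b) \<bullet> v)) (at 0)"
    by (rule has_derivative_compose[where f = "\<lambda>s. x + s *\<^sub>R b" and g = f and x = 0 and s = UNIV])
      (use assms in \<open>auto simp: gderiv_def intro!: derivative_eq_intros\<close>)
  then have "((\<lambda>s. f (x + s *\<^sub>R b)) has_real_derivative (b \<bullet> v)) (at 0)"
    unfolding has_field_derivative_def by (simp add: mult_commute_abs)
  then have "((\<lambda>h. (f (x + h *\<^sub>R b) - f x) / h) \<longlongrightarrow> b \<bullet> v) (at 0)"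
    unfolding DERIV_def by simp
  moreover have "(\<lambda>n. 1 / real (Suc n)) \<longlonglongrightarrow> 0" using LIMSEQ_inverse_real_of_nat by (simp add: divide_inverse)
  then have "filterlim (\<lambda>n. 1 / real (Suc n)) (at 0) sequentially"
    by (auto simp: filterlim_at)
  ultimately have "(\<lambda>n. (f (x + (1 / real (Suc n)) *\<^sub>R b) - f x) / (1 / real (Suc n))) \<longlonglongrightarrow> b \<bullet> v"
    by (rule filterlim_compose)
  then show ?thesis by (simp add: mult.commute)
qed

text \<open>Dominated convergence for the Frechet remainder quotients. The mean value inequality and
  the bound on the gradient each contribute one \<open>k s\<close>, so \<open>2 * k\<close>
  dominates.\<close>

lemma gderiv_lebesgue_integral:
  fixes F :: "'s \<Rightarrow> 'a::euclidean_space \<Rightarrow> real"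
  assumes int: "\<And>x. integrable M (\<lambda>s. F s x)"
    and der: "\<And>s x. s \<in> space M \<Longrightarrow> GDERIV (F s) x :> V s x"
    and bd: "\<And>s x. s \<in> space M \<Longrightarrow> norm (V s x) \<le> k s"
    and k: "integrable M k"
  shows "integrable M (\<lambda>s. V s x)" and "GDERIV (\<lambda>x. \<integral>s. F s x \<partial>M) x :> (\<integral>s. V s x \<partial>M)"
proof -
  \<comment> \<open>Measurability of the gradient in the parameter is derived: each component is a
    pointwise limit of difference quotients of \<open>F\<close>.\<close>
  have "(\<lambda>s. V s x \<bullet> b) \<in> borel_measurable M" for b
  proof (rule borel_measurable_LIMSEQ_real)
    show "(\<lambda>n. real (Suc n) * (F s (x + (1 / real (Suc n)) *\<^sub>R b) - F s x)) \<longlonglongrightarrow> V s x \<bullet> b"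
      if "s \<in> space M" for s
      using gderiv_scale_tendsto[OF der[OF that]] by (simp add: inner_commute)
  qed (use int in \<open>auto intro!: borel_measurable_times borel_measurable_diff\<close>)
  then have "(\<lambda>s. V s x) \<in> borel_measurable M" by (subst borel_measurable_euclidean_space) auto
  then show Vint: "integrable M (\<lambda>s. V s x)"
    by (rule Bochner_Integration.integrable_bound[OF k]) (use bd[of _ x] in \<open>auto intro!: AE_I2 intro: order_trans[OF _ abs_ge_self]\<close>)
  show "GDERIV (\<lambda>x. \<integral>s. F s x \<partial>M) x :> (\<integral>s. V s x \<partial>M)"
    unfolding gderiv_def has_derivative_at
  proof
    show "bounded_linear (\<lambda>h. h \<bullet> (\<integral>s. V s x \<partial>M))" by (rule bounded_linear_inner_left)
    show "(\<lambda>h. norm ((\<integral>s. F s (x + h) \<partial>M) - (\<integral>s. F s x \<partial>M) - h \<bullet> (\<integral>s. V s x \<partial>M)) / norm h) \<midarrow>0\<rightarrow> 0"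
      unfolding tendsto_at_iff_sequentially comp_def
    proof (intro allI impI)
      fix X :: "nat \<Rightarrow> 'a" assume X: "\<forall>i. X i \<in> UNIV - {0}" "X \<longlonglongrightarrow> 0"
      define q where "q n s = (F s (x + X n) - F s x - X n \<bullet> V s x) / norm (X n)" for n s
      have q_int: "integrable M (q n)" for n
        unfolding q_def using int Vint by (intro integrable_divide Bochner_Integration.integrable_diff integrable_inner_right) auto
      have "(\<lambda>n. integral\<^sup>L M (q n)) \<longlonglongrightarrow> integral\<^sup>L M (\<lambda>s. 0)"
      proof (rule integral_dominated_convergence[where w = "\<lambda>s. 2 * k s"])
        show "AE s in M. (\<lambda>n. q n s) \<longlonglongrightarrow> 0"
        proof (rule AE_I2)
          fix s assume s: "s \<in> space M"
          have "(\<lambda>h. norm (F s (x + h) - F s x - h \<bullet> V s x) / norm h) \<midarrow>0\<rightarrow> 0"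
            using der[OF s, of x] unfolding gderiv_def has_derivative_at by auto
          then have "(\<lambda>n. norm (q n s)) \<longlonglongrightarrow> 0"
            using X unfolding tendsto_at_iff_sequentially comp_def q_def by simp
          then show "(\<lambda>n. q n s) \<longlonglongrightarrow> 0" by (rule tendsto_norm_zero_cancel)
        qed
        show "AE s in M. norm (q n s) \<le> 2 * k s" for n
        proof (rule AE_I2)
          fix s assume s: "s \<in> space M"
          have "\<bar>F s (x + X n) - F s x\<bar> \<le> k s * norm (x + X n - x)"
            by (rule gderiv_bound[OF der[OF s] bd[OF s]])
          moreover have "\<bar>X n \<bullet> V s x\<bar> \<le> k s * norm (X n)"
            using Cauchy_Schwarz_ineq2[of "X n" "V s x"] mult_left_mono[OF bd[OF s, of x] norm_ge_zero[of "X n"]]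
            by (simp add: mult.commute)
          moreover have "norm (X n) > 0" using X(1) by simp
          ultimately show "norm (q n s) \<le> 2 * k s"
            by (simp add: q_def field_simps) 
        qed
      qed (use q_int k in auto)
      then have "(\<lambda>n. norm (integral\<^sup>L M (q n))) \<longlonglongrightarrow> 0" using tendsto_norm by fastforce
      moreover have "integral\<^sup>L M (q n) = ((\<integral>s. F s (x + X n) \<partial>M) - (\<integral>s. F s x \<partial>M) - X n \<bullet> (\<integral>s. V s x \<partial>M)) / norm (X n)" for n
        unfolding q_def using int Vint by (simp add: integral_inner_right)
      ultimately show "(\<lambda>n. norm ((\<integral>s. F s (x + X n) \<partial>M) - (\<integral>s. F s x \<partial>M) - X n \<bullet> (\<integral>s. V s x \<partial>M)) / norm (X n)) \<longlonglongrightarrow> 0"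
        by simp
    qed
  qed
qed

lemma tendsto_lebesgue_integral_bounded:
  fixes f :: "nat \<Rightarrow> 'a \<Rightarrow> 'b::{banach,second_countable_topology}"
  assumes "finite_measure M" "\<And>n. f n \<in> borel_measurable M"
    and "\<And>x. x \<in> space M \<Longrightarrow> (\<lambda>n. f n x) \<longlonglongrightarrow> g x"
    and "\<And>n x. x \<in> space M \<Longrightarrow> norm (f n x) \<le> C"
  shows "(\<lambda>n. integral\<^sup>L M (f n)) \<longlonglongrightarrow> integral\<^sup>L M g" "integrable M g"
proof -
  interpret finite_measure M by fact
  have g: "g \<in> borel_measurable M" by (rule borel_measurable_LIMSEQ_metric[OF assms(2,3)])
  show "(\<lambda>n. integral\<^sup>L M (f n)) \<longlonglongrightarrow> integral\<^sup>L M g"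
    by (rule integral_dominated_convergence[where w = "\<lambda>_. C"]) (use assms g in auto)
  show "integrable M g"
    by (rule integrable_dominated_convergence[where w = "\<lambda>_. C" and s = f]) (use assms g in auto)
qed

text \<open>A non-integrable function has integral 0 by convention; \<open>0 \<le> C\<close> covers
  that case.\<close>

lemma norm_integral_le_prob:
  fixes f :: "'a \<Rightarrow> 'b::{banach,second_countable_topology}"
  assumes "prob_space M" "\<And>x. x \<in> space M \<Longrightarrow> norm (f x) \<le> C" "0 \<le> C"
  shows "norm (integral\<^sup>L M f) \<le> C"
proof (cases "integrable M f")
  case True
  interpret prob_space M by fact
  have "norm (integral\<^sup>L M f) \<le> (\<integral>x. norm (f x) \<partial>M)" by (rule integral_norm_bound)
  also have "\<dots> \<le> C" using integral_mono[of M "\<lambda>x. norm (f x)" "\<lambda>_. C"] True assms(2) by (simp add: prob_space)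
  finally show ?thesis .
qed (simp add: not_integrable_integral_eq assms)

text \<open>Inf-convolution with a multiple of the norm: an elementary substitute for mollification in real interpolation.\<close>

lemma holder_split:
  fixes f :: "'a::real_normed_vector \<Rightarrow> real"
  assumes bd: "\<And>x. \<bar>f x\<bar> \<le> C" and hol: "\<And>x y. \<bar>f x - f y\<bar> \<le> M * norm (x - y) powr \<gamma>"
    and "0 \<le> \<gamma>" "\<gamma> \<le> 1" "0 < \<delta>" "0 \<le> M"
  obtains g where "\<And>x. \<bar>f x - g x\<bar> \<le> M * \<delta> powr \<gamma>" 
    "\<And>x y. \<bar>g x - g y\<bar> \<le> M * \<delta> powr (\<gamma> - 1) * norm (x - y)"
proof -
  \<comment> \<open>The slope at which K r and M r^\<gamma> agree for r = \<delta>.\<close>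
  define K where "K = M * \<delta> powr (\<gamma> - 1)"
  have K: "0 \<le> K" using assms unfolding K_def by simp
  define g where "g x = (INF y. f y + K * norm (x - y))" for x
  have bb: "bdd_below (range (\<lambda>y. f y + K * norm (x - y)))" for x
  proof (rule bdd_belowI2)
    fix y show "- C \<le> f y + K * norm (x - y)" using bd[of y] K by (smt (verit) mult_nonneg_nonneg norm_ge_zero)
  qed
  \<comment> \<open>For r up to \<delta> the linear term is dropped; beyond \<delta> it wins over M
    r^\<gamma> because \<gamma> is at most 1.\<close>
  have key: "M * r powr \<gamma> - K * r \<le> M * \<delta> powr \<gamma>" if "0 \<le> r" for r
  proof (cases "r \<le> \<delta>")
    case True
    then have "M * r powr \<gamma> \<le> M * \<delta> powr \<gamma>" using assms that by (intro mult_left_mono powr_mono2) auto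
    then show ?thesis using K that by (smt (verit) mult_nonneg_nonneg)
  next
    case False
    then have "r powr (\<gamma> - 1) \<le> \<delta> powr (\<gamma> - 1)" using assms by (intro powr_mono2') auto
    then have "M * (r powr (\<gamma> - 1) * r) \<le> K * r" unfolding K_def using assms that
      by (simp add: mult.assoc mult_left_mono mult_right_mono)
    moreover have "r powr (\<gamma> - 1) * r = r powr \<gamma>" using False assms by (simp add: powr_diff)
    ultimately show ?thesis using assms by (smt (verit) mult_nonneg_nonneg powr_ge_zero)
  qed
  show ?thesis
  proof
    fix x
    have "g x \<le> f x" unfolding g_def using cINF_lower[OF bb[of x], of x] by simp
    moreover have "f x - M * \<delta> powr \<gamma> \<le> g x" unfolding g_def
    proof (rule cINF_greatest)
      fix y show "f x - M * \<delta> powr \<gamma> \<le> f y + K * norm (x - y)"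
        using hol[of x y] key[of "norm (x - y)"] by (smt (verit) norm_ge_zero)
    qed simp
    ultimately show "\<bar>f x - g x\<bar> \<le> M * \<delta> powr \<gamma>" by simp
  next
    have "g x \<le> g y + K * norm (x - y)" for x y
    proof -
      have "g x - K * norm (x - y) \<le> g y" unfolding g_def[of y]
      proof (rule cINF_greatest)
        fix w
        have "g x \<le> f w + K * norm (x - w)" unfolding g_def by (rule cINF_lower[OF bb]) simp
        moreover have "K * norm (x - w) \<le> K * norm (x - y) + K * norm (y - w)"
          using mult_left_mono[OF norm_triangle_ineq[of "x - y" "y - w"] K] by (simp add: algebra_simps)
        ultimately show "g x - K * norm (x - y) \<le> f w + K * norm (y - w)" by linarith
      qed simp
      then show ?thesis by simp
    qed
    then show "\<bar>g x - g y\<bar> \<le> M * \<delta> powr (\<gamma> - 1) * norm (x - y)" for x y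
      using K_def by (smt (verit) norm_minus_commute)
  qed
qed

section \<open>Product integrals and the standard Gaussian measure\<close>

lemma lborel_integral_prod:
  fixes f :: "'a::euclidean_space \<Rightarrow> real \<Rightarrow> 'c::{real_normed_field,banach,second_countable_topology}"
  assumes "\<And>b. b \<in> Basis \<Longrightarrow> integrable lborel (f b)"
  shows "integrable lborel (\<lambda>x. \<Prod>b\<in>Basis. f b (x \<bullet> b))"
    and "(\<integral>x. (\<Prod>b\<in>Basis. f b (x \<bullet> b)) \<partial>lborel) = (\<Prod>b\<in>Basis. \<integral>y. f b y \<partial>lborel)"
proof -
  interpret product_sigma_finite "\<lambda>_::'a. lborel :: real measure" by standard
  have eq: "(lborel :: 'a measure) = distr (Pi\<^sub>M Basis (\<lambda>b. lborel)) borel (\<lambda>f. \<Sum>b\<in>Basis. f b *\<^sub>R b)"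
    unfolding lborel_eq_real by (rule lborel_def)
  have m[measurable]: "(\<lambda>f. \<Sum>b\<in>Basis. f b *\<^sub>R b) \<in> Pi\<^sub>M Basis (\<lambda>b. lborel) \<rightarrow>\<^sub>M (borel :: 'a measure)"
    by measurable
  have [measurable]: "b \<in> Basis \<Longrightarrow> f b \<in> borel_measurable borel" for b using assms[of b] by simp
  have g[measurable]: "(\<lambda>x. \<Prod>b\<in>Basis. f b (x \<bullet> b)) \<in> borel_measurable borel"
    by (rule borel_measurable_prod) measurable
  have s: "(\<Prod>b\<in>Basis. f b ((\<Sum>b\<in>Basis. x b *\<^sub>R b) \<bullet> b)) = (\<Prod>b\<in>Basis. f b (x b))" for x
    by (intro prod.cong refl) (simp add: inner_sum_left inner_Basis if_distrib cong: if_cong)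
  show "integrable lborel (\<lambda>x. \<Prod>b\<in>Basis. f b (x \<bullet> b))"
    unfolding eq by (subst integrable_distr_eq[OF m g]) (use assms in \<open>simp add: s product_integrable_prod\<close>)
  show "(\<integral>x. (\<Prod>b\<in>Basis. f b (x \<bullet> b)) \<partial>lborel) = (\<Prod>b\<in>Basis. \<integral>y. f b y \<partial>lborel)"
    unfolding eq by (subst integral_distr[OF m g]) (use assms in \<open>simp add: s product_integral_prod\<close>)
qed

text \<open>Serves three times: as the characteristic function of \<open>gauss\<close>, as the
  profile of the cutoff \<open>cut\<close>, and as the test function that detects mass of the kernel
  away from the origin.\<close>

definition chi :: "'a::euclidean_space \<Rightarrow> real" where "chi x = exp (- (norm x)\<^sup>2 / 2)"

lemma cis_borel[measurable]: "cis \<in> borel_measurable borel"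
  unfolding cis_conv_exp by (intro borel_measurable_continuous_onI continuous_intros)

definition gauss :: "'a::euclidean_space measure" where
  "gauss = density lborel (\<lambda>x. ennreal (\<Prod>b\<in>Basis. std_normal_density (x \<bullet> b)))"

lemma cis_inner_prod: 
  fixes x \<xi> :: "'a::euclidean_space"
  shows "cis (x \<bullet> \<xi>) = (\<Prod>b\<in>Basis. cis ((x \<bullet> b) * (\<xi> \<bullet> b)))"
  by (subst euclidean_inner) (simp add: cis_conv_exp exp_sum sum_distrib_left)

lemma chi_prod: "chi x = (\<Prod>b\<in>Basis. exp (- (x \<bullet> b)\<^sup>2 / 2))"
  by (simp add: chi_def exp_sum[symmetric] power2_norm_eq_inner sum_negf sum_divide_distrib[symmetric])
     (subst euclidean_inner, simp add: power2_eq_square)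

lemma chi_borel[measurable]: "chi \<in> borel_measurable borel"
  unfolding chi_def by measurable

lemma continuous_on_chi: "continuous_on S chi"
  unfolding chi_def by (intro continuous_intros) auto

lemma chi_le1: "chi x \<le> 1" and chi_pos: "0 < chi x" and chi_0: "chi 0 = 1"
  by (auto simp: chi_def)

lemma prod_std_normal_density: 
  "(\<Prod>b\<in>Basis. std_normal_density (x \<bullet> b)) = (1 / sqrt (2 * pi)) ^ DIM('a) * chi (x::'a::euclidean_space)"
  by (simp add: chi_prod std_normal_density_def prod.distrib prod_dividef power_one_over)

lemma gauss_chi: "gauss = density lborel (\<lambda>x. ennreal ((1 / sqrt (2 * pi)) ^ DIM('a) * chi (x::'a::euclidean_space)))"
  unfolding gauss_def prod_std_normal_density ..

lemma sets_gauss[measurable_cong, simp]: "sets gauss = sets borel" and space_gauss[simp]: "space gauss = UNIV"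
  by (simp_all add: gauss_def)

lemma integrable_std_normal_density: "integrable lborel std_normal_density" and integral_std_normal_density: "integral\<^sup>L lborel std_normal_density = 1"
  using integrable_normal_moment[of 1 0 0] integral_normal_moment_even[of 1 0 0] by auto

lemma chi_integrable: "integrable lborel (chi :: 'a::euclidean_space \<Rightarrow> real)"
proof -
  have "integrable lborel (\<lambda>x::'a. (\<Prod>b\<in>Basis. std_normal_density (x \<bullet> b)))"
    by (rule lborel_integral_prod) (rule integrable_std_normal_density)
  then show ?thesis unfolding prod_std_normal_density by simp
qed

lemma prob_space_gauss: "prob_space (gauss :: 'a::euclidean_space measure)"
proof
  have i: "integrable lborel (\<lambda>x::'a. (\<Prod>b\<in>Basis. std_normal_density (x \<bullet> b)))"
    and e: "(\<integral>x. (\<Prod>b\<in>Basis. std_normal_density (x \<bullet> (b::'a))) \<partial>lborel) = (\<Prod>b\<in>(Basis::'a set). \<integral>y. std_normal_density y \<partial>lborel)"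
    using lborel_integral_prod[of "\<lambda>_. std_normal_density"] integrable_std_normal_density by auto
  show "emeasure gauss (space (gauss :: 'a measure)) = 1"
    using nn_integral_eq_integral[OF i] e
    by (simp add: gauss_def emeasure_density integral_std_normal_density prod_nonneg)
qed

text \<open>Factors over the coordinates into the characteristic function of the one-dimensional
  normal law.\<close>

lemma gauss_char: 
  "(\<integral>\<xi>. cis (x \<bullet> \<xi>) \<partial>gauss) = complex_of_real (chi (x::'a::euclidean_space))"
proof -
  have i: "integrable lborel (\<lambda>y. std_normal_density y *\<^sub>R cis (t * y))" for t
    by (rule Bochner_Integration.integrable_bound[OF integrable_std_normal_density]) auto
  have c: "(\<integral>y. std_normal_density y *\<^sub>R cis (t * y) \<partial>lborel) = complex_of_real (exp (- t\<^sup>2 / 2))" for t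
    using fun_cong[OF char_std_normal_distribution, of t]
    unfolding char_def by (simp add: integral_density cis_conv_exp)
  have "(\<integral>\<xi>. cis (x \<bullet> \<xi>) \<partial>gauss) = (\<integral>\<xi>. (\<Prod>b\<in>Basis. std_normal_density (\<xi> \<bullet> b)) *\<^sub>R cis (x \<bullet> \<xi>) \<partial>lborel)"
    unfolding gauss_def by (subst integral_density) (auto intro!: prod_nonneg)
  also have "\<dots> = (\<integral>\<xi>. (\<Prod>b\<in>Basis. std_normal_density (\<xi> \<bullet> b) *\<^sub>R cis ((x \<bullet> b) * (\<xi> \<bullet> b))) \<partial>lborel)"
    by (simp add: cis_inner_prod scaleR_conv_of_real prod.distrib)
  also have "\<dots> = (\<Prod>b\<in>Basis. complex_of_real (exp (- (x \<bullet> b)\<^sup>2 / 2)))"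
    by (subst lborel_integral_prod(2)[of "\<lambda>b y. std_normal_density y *\<^sub>R cis ((x \<bullet> b) * y)"]) (simp_all add: i c)
  also have "\<dots> = chi x" by (simp add: chi_prod)
  finally show ?thesis .
qed

lemma gauss_norm2: "integrable (gauss :: 'a::euclidean_space measure) (\<lambda>\<xi>. (norm \<xi>)\<^sup>2)"
proof -
  have "integrable (gauss :: 'a measure) (\<lambda>\<xi>. (\<xi> \<bullet> b)\<^sup>2)" if b: "b \<in> Basis" for b
  proof -
    have "integrable lborel (\<lambda>\<xi>::'a. \<Prod>c\<in>Basis. (\<lambda>y. std_normal_density y * (if c = b then y\<^sup>2 else 1)) (\<xi> \<bullet> c))"
    proof (rule lborel_integral_prod)
      show "integrable lborel (\<lambda>y. std_normal_density y * (if c = b then y\<^sup>2 else 1))" for c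
        using integrable_std_normal_moment[of 2] integrable_std_normal_density by (cases "c = b") auto
    qed
    then have "integrable lborel (\<lambda>\<xi>::'a. (\<Prod>c\<in>Basis. std_normal_density (\<xi> \<bullet> c)) * (\<xi> \<bullet> b)\<^sup>2)"
      using b unfolding prod.distrib by (simp add: prod.delta)
    then show ?thesis unfolding gauss_def
      by (subst integrable_density) (auto intro!: prod_nonneg)
  qed
  then have "integrable (gauss :: 'a measure) (\<lambda>\<xi>. \<Sum>b\<in>Basis. (\<xi> \<bullet> b)\<^sup>2)" by auto
  moreover have "(\<lambda>\<xi>::'a. \<Sum>b\<in>Basis. (\<xi> \<bullet> b)\<^sup>2) = (\<lambda>\<xi>. (norm \<xi>)\<^sup>2)"
    unfolding power2_norm_eq_inner using euclidean_inner[of \<xi> \<xi> for \<xi> :: 'a] by (simp add: power2_eq_square)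
  ultimately show ?thesis by simp
qed

lemma gderiv_chi: "GDERIV chi x :> - chi x *\<^sub>R x"
  unfolding gderiv_def chi_def power2_norm_eq_inner
  by (auto intro!: derivative_eq_intros simp: inner_commute)

text \<open>From 1 + y <= exp y at y = |x|^2/2, and at y = |x|^2/4 squared. These control the first
  and second derivatives of the cutoff.\<close>

lemma norm_mult_chi_le1: "norm x * chi x \<le> 1" "(norm x)\<^sup>2 * chi x \<le> 1"
proof -
  have 1: "1 + (norm x)\<^sup>2 / 2 \<le> exp ((norm x)\<^sup>2 / 2)" by (rule exp_ge_add_one_self)
  have 2: "1 + (norm x)\<^sup>2 / 4 \<le> exp ((norm x)\<^sup>2 / 4)" by (rule exp_ge_add_one_self)
  have e: "chi x * exp ((norm x)\<^sup>2 / 2) = 1" by (simp add: chi_def exp_minus field_simps)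
  have "norm x \<le> 1 + (norm x)\<^sup>2 / 2" using sum_squares_bound[of 1 "norm x"] by simp
  then have "norm x \<le> exp ((norm x)\<^sup>2 / 2)" using 1 by linarith
  then show "norm x * chi x \<le> 1" using e mult_left_mono[of "norm x" "exp ((norm x)\<^sup>2 / 2)" "chi x"] chi_pos[of x]
    by (simp add: mult.commute)
  have "(1 + (norm x)\<^sup>2 / 4)\<^sup>2 \<le> (exp ((norm x)\<^sup>2 / 4))\<^sup>2" using 2 by (intro power_mono) auto
  also have "\<dots> = exp ((norm x)\<^sup>2 / 2)" by (simp add: exp_double[symmetric])
  finally have "(1 + (norm x)\<^sup>2 / 4)\<^sup>2 \<le> exp ((norm x)\<^sup>2 / 2)" .
  moreover have "(norm x)\<^sup>2 \<le> (1 + (norm x)\<^sup>2 / 4)\<^sup>2" 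
    using zero_le_power2[of "1 - (norm x)\<^sup>2 / 4"] by (simp add: power2_eq_square algebra_simps)
  ultimately have "(norm x)\<^sup>2 \<le> exp ((norm x)\<^sup>2 / 2)" by linarith
  then show "(norm x)\<^sup>2 * chi x \<le> 1" using e mult_left_mono[of "(norm x)\<^sup>2" "exp ((norm x)\<^sup>2 / 2)" "chi x"] chi_pos[of x]
    by (simp add: mult.commute)
qed

lemma lborel_integral_affine:
  fixes f :: "'a::euclidean_space \<Rightarrow> 'b::{banach,second_countable_topology}"
  assumes "c \<noteq> 0" "f \<in> borel_measurable borel"
  shows "(\<integral>x. f x \<partial>lborel) = \<bar>c\<bar> ^ DIM('a) *\<^sub>R (\<integral>x. f (t + c *\<^sub>R x) \<partial>lborel)"
    and "integrable lborel (\<lambda>x. f (t + c *\<^sub>R x)) \<longleftrightarrow> integrable lborel f"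
proof -
  have m[measurable]: "f \<in> borel_measurable borel" by fact
  show "(\<integral>x. f x \<partial>lborel) = \<bar>c\<bar> ^ DIM('a) *\<^sub>R (\<integral>x. f (t + c *\<^sub>R x) \<partial>lborel)"
    by (subst lborel_affine[OF assms(1), of t]) (simp add: integral_density integral_distr)
  have sc: "integrable M (\<lambda>x. k *\<^sub>R g x) \<longleftrightarrow> integrable M g" if "k \<noteq> 0" for k :: real and M :: "'a measure" and g :: "'a \<Rightarrow> 'b"
    using integrable_scaleR_right[of k M g] integrable_scaleR_right[of "1 / k" M "\<lambda>x. k *\<^sub>R g x"] that by auto
  show "integrable lborel (\<lambda>x. f (t + c *\<^sub>R x)) \<longleftrightarrow> integrable lborel f"
    by (subst (2) lborel_affine[OF assms(1), of t])
      (use assms(1) in \<open>simp add: integrable_density integrable_distr_eq sc\<close>)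
qed

subsection \<open>Fourier integrals and the Levy operator\<close>

lemma borel_measurable_inner_right[measurable]: "(\<bullet>) (x::'a::real_inner) \<in> borel_measurable borel"
  by (intro borel_measurable_continuous_onI continuous_intros)

text \<open>Domination by a product fits Fourier integrals: one factor is integrable against the
  coefficients, the other against the kernel, the jump measure or time.\<close>

lemma fubini_dom:
  fixes f :: "'a \<Rightarrow> 'b \<Rightarrow> 'c::{banach,second_countable_topology}"
  assumes "sigma_finite_measure M1" "sigma_finite_measure M2"
    and m: "(\<lambda>(x, y). f x y) \<in> borel_measurable (M1 \<Otimes>\<^sub>M M2)"
    and a: "integrable M1 a" and b: "integrable M2 b"
    and bd: "\<And>x y. x \<in> space M1 \<Longrightarrow> y \<in> space M2 \<Longrightarrow> norm (f x y) \<le> a x * b y"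
  shows "integrable (M1 \<Otimes>\<^sub>M M2) (\<lambda>(x, y). f x y)"
    and "(\<integral>y. \<integral>x. f x y \<partial>M1 \<partial>M2) = (\<integral>x. \<integral>y. f x y \<partial>M2 \<partial>M1)"
    and "integrable M1 (\<lambda>x. \<integral>y. f x y \<partial>M2)"
    and "integrable M2 (\<lambda>y. \<integral>x. f x y \<partial>M1)"
proof -
  interpret M1: sigma_finite_measure M1 by fact
  interpret M2: sigma_finite_measure M2 by fact
  interpret pair_sigma_finite M1 M2 ..
  have y: "integrable M2 (f x)" if x: "x \<in> space M1" for x
  proof (rule Bochner_Integration.integrable_bound)
    show "integrable M2 (\<lambda>y. a x * b y)" using b by simp
    show "f x \<in> borel_measurable M2" using measurable_compose_Pair1[OF x m] by simp
    show "AE y in M2. norm (f x y) \<le> norm (a x * b y)" using bd[OF x] by (fastforce intro: AE_I2)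
  qed
  have "integrable (M1 \<Otimes>\<^sub>M M2) (case_prod f)"
  proof (rule Fubini_integrable[OF m])
    show "AE x in M1. integrable M2 (\<lambda>y. case (x, y) of (x, y) \<Rightarrow> f x y)" using y by (auto intro!: AE_I2)
    show "integrable M1 (\<lambda>x. \<integral>y. norm (case (x, y) of (x, y) \<Rightarrow> f x y) \<partial>M2)"
    proof (rule Bochner_Integration.integrable_bound)
      show "integrable M1 (\<lambda>x. a x * (\<integral>y. b y \<partial>M2))" using a by simp
      show "AE x in M1. norm (\<integral>y. norm (case (x, y) of (x, y) \<Rightarrow> f x y) \<partial>M2) \<le> norm (a x * (\<integral>y. b y \<partial>M2))"
      proof (rule AE_I2)
        fix x assume x: "x \<in> space M1"
        have "(\<integral>y. norm (f x y) \<partial>M2) \<le> (\<integral>y. a x * b y \<partial>M2)"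
          using y[OF x] b bd[OF x] by (intro integral_mono) auto
        moreover have "0 \<le> (\<integral>y. norm (f x y) \<partial>M2)" by simp
        ultimately show "norm (\<integral>y. norm (case (x, y) of (x, y) \<Rightarrow> f x y) \<partial>M2) \<le> norm (a x * (\<integral>y. b y \<partial>M2))"
          using b by simp
      qed
      show "(\<lambda>x. \<integral>y. norm (case (x, y) of (x, y) \<Rightarrow> f x y) \<partial>M2) \<in> borel_measurable M1"
        using m by measurable
    qed
  qed
  then show i: "integrable (M1 \<Otimes>\<^sub>M M2) (\<lambda>(x, y). f x y)" .
  show "(\<integral>y. \<integral>x. f x y \<partial>M1 \<partial>M2) = (\<integral>x. \<integral>y. f x y \<partial>M2 \<partial>M1)"
    by (rule Fubini_integral[OF i])
  show "integrable M1 (\<lambda>x. \<integral>y. f x y \<partial>M2)" using integrable_fst'[OF i] by simp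
  show "integrable M2 (\<lambda>y. \<integral>x. f x y \<partial>M1)" using integrable_snd[OF i] by simp
qed

text \<open>Derivative facts are carried as \<open>GDERIV\<close>, which asserts existence as well;
  this leads back to the total function \<open>gradient\<close>.\<close>

lemma gderiv_gradient: "GDERIV f x :> v \<Longrightarrow> gradient f x = v"
  unfolding gradient_def partial_deriv_def gderiv_def
  by (auto simp: vec_eq_iff frechet_derivative_at[symmetric] inner_axis' )

lemma divergence_gderiv:
  fixes A :: "real^'n^'n" and V :: "real^'n \<Rightarrow> real^'n"
  assumes "\<And>i. GDERIV (\<lambda>y. V y $ i) x :> W i"
  shows "(\<lambda>y. A *v V y) differentiable (at x)"
    and "divergence (\<lambda>y. A *v V y) x = (\<Sum>i\<in>UNIV. \<Sum>j\<in>UNIV. A $ i $ j * (W j $ i))"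
proof -
  have d: "((\<lambda>y. A *v V y) has_derivative (\<lambda>h. \<chi> i. \<Sum>j\<in>UNIV. A $ i $ j * (h \<bullet> W j))) (at x)"
  proof (subst has_derivative_componentwise_within, intro ballI)
    fix b :: "real^'n" assume "b \<in> Basis"
    then obtain i where b: "b = axis i 1" by (auto simp: Basis_vec_def)
    show "((\<lambda>y. (A *v V y) \<bullet> b) has_derivative (\<lambda>h. (\<chi> i. \<Sum>j\<in>UNIV. A $ i $ j * (h \<bullet> W j)) \<bullet> b)) (at x)"
      unfolding b by (simp add: inner_axis matrix_vector_mult_def)
       (auto intro!: derivative_eq_intros assms[unfolded gderiv_def])
  qed
  then show "(\<lambda>y. A *v V y) differentiable (at x)" by (auto simp: differentiable_def)
  show "divergence (\<lambda>y. A *v V y) x = (\<Sum>i\<in>UNIV. \<Sum>j\<in>UNIV. A $ i $ j * (W j $ i))"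
    unfolding divergence_def frechet_derivative_at[OF d, symmetric] by (simp add: inner_axis')
qed

text \<open>For \<open>A = 0\<close> the field is constant whatever \<open>V\<close> is, so the
  local part of the operator is defined without second derivatives.\<close>

lemma divergence_zero: "divergence (\<lambda>y. 0 *v V y) x = 0"
  "(\<lambda>y. (0::real^'n^'n) *v V y) differentiable (at x)"
  unfolding divergence_def by (auto simp: frechet_derivative_const)

lemma cis_taylor:
  shows "norm (1 - cis t + \<i> * complex_of_real t) \<le> t\<^sup>2" "norm (1 - cis t) \<le> 2"
proof -
  have "norm (cis t - (1 + \<i> * complex_of_real t)) \<le> t\<^sup>2 / 2"
    using iexp_approx1[of t 1] by (simp add: cis_conv_exp power2_eq_square)
  then show "norm (1 - cis t + \<i> * complex_of_real t) \<le> t\<^sup>2" 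
    by (smt (verit) norm_minus_commute add_diff_eq diff_add_eq diff_diff_eq2 zero_le_power2 field_sum_of_halves)
  show "norm (1 - cis t) \<le> 2" using norm_triangle_ineq4[of 1 "cis t"] by simp
qed

lemma gderiv_cis:
  shows "GDERIV (\<lambda>x. Re (c * cis (x \<bullet> \<xi>))) x :> (- Im (c * cis (x \<bullet> \<xi>))) *\<^sub>R \<xi>"
    and "GDERIV (\<lambda>x. Im (c * cis (x \<bullet> \<xi>))) x :> Re (c * cis (x \<bullet> \<xi>)) *\<^sub>R \<xi>"
  unfolding gderiv_def by (auto intro!: derivative_eq_intros simp: algebra_simps)

text \<open>The integrand of the jump part of \<open>levy_symbol\<close>.\<close>

definition levy_exp :: "real^'n \<Rightarrow> real^'n \<Rightarrow> complex" where
  "levy_exp \<xi> z = 1 - cis (\<xi> \<bullet> z) + \<i> * complex_of_real (\<xi> \<bullet> z) * indicator (ball 0 1) z"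

text \<open>Second-order Taylor bound for small jumps, the trivial bound 2 for large ones.\<close>

lemma levy_exp_bound: "norm (levy_exp \<xi> z) \<le> (2 + (norm \<xi>)\<^sup>2) * min 1 ((norm z)\<^sup>2)"
proof (cases "norm z < 1")
  case True
  have "norm (levy_exp \<xi> z) \<le> (\<xi> \<bullet> z)\<^sup>2" using cis_taylor(1)[of "\<xi> \<bullet> z"] True by (simp add: levy_exp_def)
  also have "\<dots> \<le> (norm \<xi> * norm z)\<^sup>2" using Cauchy_Schwarz_ineq2[of \<xi> z] by (rule abs_le_square_iff[THEN iffD1, OF order_trans]) simp
  also have "\<dots> \<le> (2 + (norm \<xi>)\<^sup>2) * (norm z)\<^sup>2" by (simp add: power_mult_distrib algebra_simps)
  also have "(norm z)\<^sup>2 = min 1 ((norm z)\<^sup>2)" using True by (intro min_absorb2[symmetric] power_le_one) auto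
  finally show ?thesis .
next
  case False
  then have "min 1 ((norm z)\<^sup>2) = 1" by (simp add: min_def)
  then show ?thesis using False order_trans[OF cis_taylor(2)[of "\<xi> \<bullet> z"], of "2 + (norm \<xi>)\<^sup>2"] unfolding levy_exp_def
    by simp
qed

text \<open>The measure is a parameter so that a Gaussian can provide the decay in \<xi>; the
  coefficient \<open>c\<close> then only has to be bounded.\<close>

definition fourier_int :: "(real^'n) measure \<Rightarrow> (real^'n \<Rightarrow> complex) \<Rightarrow> real^'n \<Rightarrow> real" where
  "fourier_int M c x = Re (\<integral>\<xi>. c \<xi> * cis (x \<bullet> \<xi>) \<partial>M)"

section \<open>The kernel and its symbol acting on Fourier integrals\<close>

locale levy_heat =
  fixes A :: "real^'n^'n" and \<mu> :: "(real^'n) measure" and p :: "real \<Rightarrow> real^'n \<Rightarrow> real"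
  assumes triplet: "levy_triplet A \<mu>" and kernel: "heat_kernel A \<mu> p"
begin

abbreviation "\<psi> \<equiv> levy_symbol A \<mu>"

definition Q :: "real \<Rightarrow> (real^'n) measure" where "Q t = density lborel (\<lambda>x. ennreal (p t x))"

text \<open>The convolution with the translation on \<phi> and a fixed probability measure: limits
  and derivatives in x fall on \<phi>.\<close>

definition P :: "real \<Rightarrow> (real^'n \<Rightarrow> real) \<Rightarrow> real^'n \<Rightarrow> real" where
  "P t \<phi> x = (\<integral>y. \<phi> (x - y) \<partial>Q t)"

lemma sets_Q[measurable_cong, simp]: "sets (Q t) = sets borel" and space_Q[simp]: "space (Q t) = UNIV"
  by (simp_all add: Q_def)

lemma sets_mu[measurable_cong, simp]: "sets \<mu> = sets borel"
  using triplet by (simp add: levy_triplet_def)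

lemma space_mu[simp]: "space \<mu> = UNIV" using sets_eq_imp_space_eq[OF sets_mu] by simp

lemma p_borel: "0 < t \<Longrightarrow> p t \<in> borel_measurable borel" and p_nonneg: "0 < t \<Longrightarrow> 0 \<le> p t x"
  and prob_Q: "0 < t \<Longrightarrow> prob_space (Q t)"
  using kernel by (auto simp: heat_kernel_def Q_def)

lemma integral_Q:
  fixes f :: "real^'n \<Rightarrow> 'c::{banach,second_countable_topology}"
  assumes "0 < t" "f \<in> borel_measurable borel"
  shows "(\<integral>y. f y \<partial>Q t) = (\<integral>y. p t y *\<^sub>R f y \<partial>lborel)"
  unfolding Q_def using assms p_borel p_nonneg by (subst integral_density) auto

lemma p_integrable: "0 < t \<Longrightarrow> integrable lborel (p t)"
proof -
  assume t: "0 < t"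
  interpret prob_space "Q t" by (rule prob_Q[OF t])
  have "integrable (Q t) (\<lambda>_. 1::real)" by simp
  then show "integrable lborel (p t)"
    unfolding Q_def using p_borel[OF t] p_nonneg[OF t] by (subst (asm) integrable_density) auto
qed

lemma heat_semigroup_eq:
  assumes t: "0 < t" and [measurable]: "\<phi> \<in> borel_measurable borel"
  shows "heat_semigroup p t \<phi> x = P t \<phi> x"
proof -
  note [measurable] = p_borel[OF t]
  have "heat_semigroup p t \<phi> x = (\<integral>y. p t y * \<phi> (x - y) \<partial>lborel)"
    unfolding heat_semigroup_def
    by (subst lborel_integral_affine(1)[of "-1" _ x]) auto
  then show ?thesis unfolding P_def by (subst integral_Q[OF t]) auto
qed

text \<open>Markov's inequality makes the sets |z| >= 1/(n+1) finite, and the origin is a null set.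
  Fubini with the jump measure rests on this.\<close>

lemma sigma_finite_mu: "sigma_finite_measure \<mu>"
proof
  have z: "emeasure \<mu> {0} = 0" and f: "(\<integral>\<^sup>+z. ennreal (min 1 ((norm z)\<^sup>2)) \<partial>\<mu>) < \<infinity>"
    using triplet by (auto simp: levy_triplet_def)
  have fin: "emeasure \<mu> {z. 1 / real (Suc n) \<le> norm z} < \<infinity>" for n
  proof -
    let ?c = "ennreal ((1 / real (Suc n))\<^sup>2)"
    have 1: "(1 / real (Suc n))\<^sup>2 \<le> 1" by (intro power_le_one) auto
    have "?c * emeasure \<mu> {z. 1 / real (Suc n) \<le> norm z} = (\<integral>\<^sup>+z. ?c * indicator {z. 1 / real (Suc n) \<le> norm z} z \<partial>\<mu>)"
      by (subst nn_integral_cmult_indicator) auto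
    also have "\<dots> \<le> (\<integral>\<^sup>+z. ennreal (min 1 ((norm z)\<^sup>2)) \<partial>\<mu>)"
    proof (rule nn_integral_mono)
      fix z :: "real^'n"
      have "(1 / real (Suc n))\<^sup>2 \<le> (norm z)\<^sup>2" if "1 / real (Suc n) \<le> norm z" using that by (intro power_mono) auto
      then show "?c * indicator {z. 1 / real (Suc n) \<le> norm z} z \<le> ennreal (min 1 ((norm z)\<^sup>2))"
        using 1 by (auto simp: indicator_def intro!: ennreal_leI)
    qed
    finally have "?c * emeasure \<mu> {z. 1 / real (Suc n) \<le> norm z} < \<infinity>" using f by (rule order.strict_trans1)
    then show ?thesis by (auto simp: ennreal_mult_less_top less_top)
  qed
  define S where "S = insert {0} (range (\<lambda>n. {z :: real^'n. 1 / real (Suc n) \<le> norm z}))"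
  have "countable S" "S \<subseteq> sets \<mu>" by (auto simp: S_def)
  moreover have "\<Union> S = space \<mu>"
  proof -
    have "\<exists>n. 1 / real (Suc n) \<le> norm z" if "z \<noteq> 0" for z :: "real^'n"
      using reals_Archimedean[of "norm z"] that by (auto simp: divide_inverse intro: less_imp_le)
    then show ?thesis unfolding S_def by auto
  qed
  moreover have "\<forall>a\<in>S. emeasure \<mu> a \<noteq> \<infinity>" unfolding S_def using fin z by (auto simp: less_top)
  ultimately show "\<exists>A. countable A \<and> A \<subseteq> sets \<mu> \<and> \<Union> A = space \<mu> \<and> (\<forall>a\<in>A. emeasure \<mu> a \<noteq> \<infinity>)"
    by blast
qed

lemma mu_min_integrable: "integrable \<mu> (\<lambda>z. min 1 ((norm z)\<^sup>2))"
  using triplet by (intro integrableI_nonneg) (auto simp: levy_triplet_def)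

lemma levy_exp_measurable[measurable]: "(\<lambda>(\<xi> :: real^'n, z). levy_exp \<xi> z) \<in> borel_measurable (borel \<Otimes>\<^sub>M borel)"
proof -
  have i: "indicator (ball 0 1) z = (if norm z < 1 then 1 else 0 :: complex)" for z :: "real^'n" by simp
  show ?thesis unfolding levy_exp_def i by measurable
qed

lemma psi_eq: "\<psi> \<xi> = complex_of_real (\<xi> \<bullet> (A *v \<xi>)) + (\<integral>z. levy_exp \<xi> z \<partial>\<mu>)"
  unfolding levy_symbol_def levy_exp_def cis_conv_exp by simp

lemma levy_exp_integrable: "integrable \<mu> (levy_exp \<xi>)"
  by (rule Bochner_Integration.integrable_bound[of _ "\<lambda>z. (2 + (norm \<xi>)\<^sup>2) * min 1 ((norm z)\<^sup>2)"])
    (use mu_min_integrable levy_exp_bound in \<open>auto intro!: AE_I2 simp: abs_mult add_nonneg_nonneg\<close>)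

lemma psi_measurable[measurable]: "\<psi> \<in> borel_measurable borel"
proof -
  interpret sigma_finite_measure \<mu> by (rule sigma_finite_mu)
  have [measurable]: "(\<lambda>\<xi>. \<xi> \<bullet> (A *v \<xi>)) \<in> borel_measurable borel"
    by (intro borel_measurable_continuous_onI continuous_intros matrix_vector_mult_linear_continuous_on)
  show ?thesis unfolding psi_eq[abs_def] by measurable
qed

text \<open>Quadratic growth of the symbol is matched by the second moment of the coefficients, so
  \<psi> c stays integrable.\<close>

lemma psi_bound: obtains K where "0 \<le> K" "\<And>\<xi>. norm (\<psi> \<xi>) \<le> K * (1 + (norm \<xi>)\<^sup>2)"
proof -
  obtain B where B: "\<And>x. norm (A *v x) \<le> B * norm x" "0 < B"
    using bounded_linear.pos_bounded[OF matrix_vector_mul_bounded_linear[of A]] by (auto simp: mult.commute)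
  let ?I = "\<integral>z. min 1 ((norm z)\<^sup>2) \<partial>\<mu>"
  have I: "0 \<le> ?I" by simp
  show ?thesis
  proof (rule that[of "B + 2 * ?I"])
    show "0 \<le> B + 2 * ?I" using B I by simp
    fix \<xi>
    have "norm (\<integral>z. levy_exp \<xi> z \<partial>\<mu>) \<le> (\<integral>z. norm (levy_exp \<xi> z) \<partial>\<mu>)" by (rule integral_norm_bound)
    also have "\<dots> \<le> (\<integral>z. (2 + (norm \<xi>)\<^sup>2) * min 1 ((norm z)\<^sup>2) \<partial>\<mu>)"
      using levy_exp_integrable mu_min_integrable levy_exp_bound by (intro integral_mono) auto
    finally have 1: "norm (\<integral>z. levy_exp \<xi> z \<partial>\<mu>) \<le> (2 + (norm \<xi>)\<^sup>2) * ?I" by simp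
    have "\<bar>\<xi> \<bullet> (A *v \<xi>)\<bar> \<le> norm \<xi> * (B * norm \<xi>)"
      using Cauchy_Schwarz_ineq2[of \<xi> "A *v \<xi>"] mult_left_mono[OF B(1)[of \<xi>] norm_ge_zero[of \<xi>]] by linarith
    then have "norm (\<psi> \<xi>) \<le> B * (norm \<xi>)\<^sup>2 + (2 + (norm \<xi>)\<^sup>2) * ?I"
      unfolding psi_eq using 1 norm_triangle_ineq[of "complex_of_real (\<xi> \<bullet> (A *v \<xi>))" "\<integral>z. levy_exp \<xi> z \<partial>\<mu>"]
      by (simp add: power2_eq_square mult.commute mult.left_commute)
    also have "\<dots> \<le> (B + 2 * ?I) * (1 + (norm \<xi>)\<^sup>2)" using B I by (simp add: algebra_simps)
    finally show "norm (\<psi> \<xi>) \<le> (B + 2 * ?I) * (1 + (norm \<xi>)\<^sup>2)" .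
  qed
qed

lemma Q_char:
  assumes "0 < t" shows "(\<integral>y. cis ((x - y) \<bullet> \<xi>) \<partial>Q t) = cis (x \<bullet> \<xi>) * exp (- (complex_of_real t * \<psi> \<xi>))"
proof -
  have "(\<integral>y. cis ((x - y) \<bullet> \<xi>) \<partial>Q t) = (\<integral>y. cis (x \<bullet> \<xi>) * exp (- (\<i> * complex_of_real (\<xi> \<bullet> y))) \<partial>Q t)"
    by (rule Bochner_Integration.integral_cong) (auto simp: cis_conv_exp exp_add[symmetric] algebra_simps inner_commute)
  then show ?thesis using kernel assms by (simp add: heat_kernel_def Q_def)
qed

text \<open>The factor is a Fourier transform of a probability measure, so the sign of the real part
  of \<psi> need not be computed.\<close>

lemma norm_exp_psi: assumes "0 \<le> t" shows "norm (exp (- (complex_of_real t * \<psi> \<xi>))) \<le> 1"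
proof (cases "t = 0")
  case False
  then have t: "0 < t" using assms by simp
  have "norm (\<integral>y. cis ((0 - y) \<bullet> \<xi>) \<partial>Q t) \<le> 1"
    by (rule norm_integral_le_prob[OF prob_Q[OF t]]) auto
  then show ?thesis unfolding Q_char[OF t] by simp
qed simp

lemma P_fourier:
  assumes t: "0 < t" and M: "sigma_finite_measure M" "sets M = sets borel" and c: "integrable M c"
  shows "P t (fourier_int M c) x = fourier_int M (\<lambda>\<xi>. c \<xi> * exp (- (complex_of_real t * \<psi> \<xi>))) x"
proof -
  note [measurable_cong] = M(2) and [measurable] = borel_measurable_integrable[OF c]
  interpret Qt: prob_space "Q t" by (rule prob_Q[OF t])
  have b: "norm (c \<xi> * cis ((x - y) \<bullet> \<xi>)) \<le> 1 * norm (c \<xi>)" for y \<xi> by (simp add: norm_mult)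
  have m: "(\<lambda>(y, \<xi>). c \<xi> * cis ((x - y) \<bullet> \<xi>)) \<in> borel_measurable (Q t \<Otimes>\<^sub>M M)" by measurable
  note fub = fubini_dom[OF Qt.sigma_finite_measure_axioms M(1) m _ integrable_norm[OF c] b]
  have "P t (fourier_int M c) x = Re (\<integral>y. \<integral>\<xi>. c \<xi> * cis ((x - y) \<bullet> \<xi>) \<partial>M \<partial>Q t)"
    unfolding P_def fourier_int_def using fub(3) by simp
  also have "\<dots> = Re (\<integral>\<xi>. \<integral>y. c \<xi> * cis ((x - y) \<bullet> \<xi>) \<partial>Q t \<partial>M)" using fub(2) by simp
  also have "\<dots> = fourier_int M (\<lambda>\<xi>. c \<xi> * exp (- (complex_of_real t * \<psi> \<xi>))) x"
    unfolding fourier_int_def using Q_char[OF t] by (simp add: mult.commute mult.left_commute)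
  finally show ?thesis .
qed

lemma fourier_int_integrable: 
  assumes "sets M = sets borel" "integrable M c"
  shows "integrable M (\<lambda>\<xi>. c \<xi> * cis (x \<bullet> \<xi>))"
proof -
  note [measurable_cong] = assms(1) and [measurable] = borel_measurable_integrable[OF assms(2)]
  show ?thesis by (rule Bochner_Integration.integrable_bound[OF assms(2)]) (measurable, auto simp: norm_mult)
qed

lemma fourier_int_eq:
  assumes "sets M = sets borel" "integrable M c"
  shows "fourier_int M c = (\<lambda>x. \<integral>\<xi>. Re (c \<xi> * cis (x \<bullet> \<xi>)) \<partial>M)"
  unfolding fourier_int_def using fourier_int_integrable[OF assms] by (intro ext) (simp only: integral_Re)

lemma integral_vec_nth: "integrable M v \<Longrightarrow> (\<integral>x. v x \<partial>M) $ i = (\<integral>x. v x $ i \<partial>M)"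
  for v :: "'s \<Rightarrow> real^'m"
  by (rule integral_bounded_linear[OF bounded_linear_vec_nth, symmetric])

text \<open>Two differentiations under the integral, dominated by |\<xi>| |c| and |\<xi>|^2 |c|; the
  first moment follows from |\<xi>| <= 1 + |\<xi>|^2.\<close>

lemma fourier_gderiv:
  fixes M :: "(real^'n) measure"
  assumes M: "sets M = sets borel" and c: "integrable M c" and c2: "integrable M (\<lambda>\<xi>. (norm \<xi>)\<^sup>2 * norm (c \<xi>))"
  defines "V \<equiv> \<lambda>x. \<integral>\<xi>. (- Im (c \<xi> * cis (x \<bullet> \<xi>))) *\<^sub>R \<xi> \<partial>M"
    and "W \<equiv> \<lambda>i x. \<integral>\<xi>. (- Re (c \<xi> * cis (x \<bullet> \<xi>)) * \<xi> $ i) *\<^sub>R \<xi> \<partial>M"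
  shows "integrable M (\<lambda>\<xi>. (- Im (c \<xi> * cis (x \<bullet> \<xi>))) *\<^sub>R \<xi>)"
    and "GDERIV (fourier_int M c) x :> V x"
    and "integrable M (\<lambda>\<xi>. (- Re (c \<xi> * cis (x \<bullet> \<xi>)) * \<xi> $ i) *\<^sub>R \<xi>)"
    and "GDERIV (\<lambda>x. V x $ i) x :> W i x"
proof -
  note [measurable_cong] = M and [measurable] = borel_measurable_integrable[OF c]
  have c1: "integrable M (\<lambda>\<xi>. norm \<xi> * norm (c \<xi>))"
  proof (rule Bochner_Integration.integrable_bound)
    show "integrable M (\<lambda>\<xi>. norm (c \<xi>) + (norm \<xi>)\<^sup>2 * norm (c \<xi>))" using c c2 by auto
    show "AE \<xi> in M. norm (norm \<xi> * norm (c \<xi>)) \<le> norm (norm (c \<xi>) + (norm \<xi>)\<^sup>2 * norm (c \<xi>))"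
    proof (rule AE_I2)
      fix \<xi> :: "real^'n"
      have "norm \<xi> \<le> 1 + (norm \<xi>)\<^sup>2" using sum_squares_bound[of 1 "norm \<xi>"] norm_ge_zero[of \<xi>] by (simp del: norm_ge_zero)
      then have "norm \<xi> * norm (c \<xi>) \<le> (1 + (norm \<xi>)\<^sup>2) * norm (c \<xi>)" by (rule mult_right_mono) simp
      then show "norm (norm \<xi> * norm (c \<xi>)) \<le> norm (norm (c \<xi>) + (norm \<xi>)\<^sup>2 * norm (c \<xi>))"
        by (simp add: algebra_simps)
    qed
  qed measurable
  have F: "integrable M (\<lambda>\<xi>. Re (c \<xi> * cis (x \<bullet> \<xi>)))" for x
    using fourier_int_integrable[OF M c] by (rule integrable_Re)
  have b: "\<bar>Re w\<bar> \<le> norm w" "\<bar>Im w\<bar> \<le> norm w" for w by (auto simp: abs_Re_le_cmod abs_Im_le_cmod)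
  have nc: "norm (c \<xi> * cis y) = norm (c \<xi>)" for \<xi> y by (simp add: norm_mult)
  have bd1: "norm ((- Im (c \<xi> * cis (x \<bullet> \<xi>))) *\<^sub>R \<xi>) \<le> norm \<xi> * norm (c \<xi>)" for \<xi> x
    unfolding norm_scaleR using mult_left_mono[OF b(2)[of "c \<xi> * cis (x \<bullet> \<xi>)"] norm_ge_zero[of \<xi>]] 
    by (simp only: nc mult.commute abs_minus real_norm_def)
  note 1 = gderiv_lebesgue_integral[OF F gderiv_cis(1) bd1 c1]
  show i1: "integrable M (\<lambda>\<xi>. (- Im (c \<xi> * cis (x \<bullet> \<xi>))) *\<^sub>R \<xi>)" for x by (rule 1)
  show "GDERIV (fourier_int M c) x :> V x" unfolding fourier_int_eq[OF M c] V_def by (rule 1)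
  have V: "V x $ i = (\<integral>\<xi>. - (Im (c \<xi> * cis (x \<bullet> \<xi>)) * \<xi> $ i) \<partial>M)" for x
    using integral_vec_nth[OF i1[of x], of i] unfolding V_def
    by (simp only: vector_scaleR_component real_scaleR_def mult_minus_left)
  have F2: "integrable M (\<lambda>\<xi>. - (Im (c \<xi> * cis (x \<bullet> \<xi>)) * \<xi> $ i))" for x
    using integrable_bounded_linear[OF bounded_linear_vec_nth i1[of x], of i] 
    by (simp only: vector_scaleR_component real_scaleR_def mult_minus_left)
  have g2: "GDERIV (\<lambda>x. - (Im (c \<xi> * cis (x \<bullet> \<xi>)) * \<xi> $ i)) x :> (- Re (c \<xi> * cis (x \<bullet> \<xi>)) * \<xi> $ i) *\<^sub>R \<xi>" for \<xi> x
    by (rule GDERIV_subst[OF GDERIV_minus[OF GDERIV_mult[OF gderiv_cis(2) GDERIV_const]]])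
      (simp only: scaleR_zero_right add_0_left scaleR_scaleR scaleR_minus_left mult_minus_left mult.commute[of "\<xi> $ i"])
  have bd2: "norm ((- Re (c \<xi> * cis (x \<bullet> \<xi>)) * \<xi> $ i) *\<^sub>R \<xi>) \<le> (norm \<xi>)\<^sup>2 * norm (c \<xi>)" for \<xi> x
  proof -
    have "\<bar>Re (c \<xi> * cis (x \<bullet> \<xi>))\<bar> * \<bar>\<xi> $ i\<bar> * norm \<xi> \<le> norm (c \<xi>) * norm \<xi> * norm \<xi>"
      using b(1)[of "c \<xi> * cis (x \<bullet> \<xi>)"] component_le_norm_cart[of \<xi> i] unfolding nc
      by (intro mult_mono) auto
    then show ?thesis unfolding norm_scaleR real_norm_def abs_mult abs_minus by (simp only: power2_eq_square mult_ac)
  qed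
  note 2 = gderiv_lebesgue_integral[OF F2 g2 bd2 c2]
  show "integrable M (\<lambda>\<xi>. (- Re (c \<xi> * cis (x \<bullet> \<xi>)) * \<xi> $ i) *\<^sub>R \<xi>)" by (rule 2)
  show "GDERIV (\<lambda>x. V x $ i) x :> W i x" unfolding V W_def by (rule 2)
qed

lemma psi_c_integrable:
  assumes M: "sets M = sets borel" and c: "integrable M c" and c2: "integrable M (\<lambda>\<xi>. (norm \<xi>)\<^sup>2 * norm (c \<xi>))"
  shows "integrable M (\<lambda>\<xi>. - \<psi> \<xi> * c \<xi>)"
proof -
  note [measurable_cong] = M and [measurable] = borel_measurable_integrable[OF c]
  obtain K where K: "0 \<le> K" "\<And>\<xi>. norm (\<psi> \<xi>) \<le> K * (1 + (norm \<xi>)\<^sup>2)" using psi_bound by blast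
  show ?thesis
  proof (rule Bochner_Integration.integrable_bound)
    show "integrable M (\<lambda>\<xi>. K * (norm (c \<xi>) + (norm \<xi>)\<^sup>2 * norm (c \<xi>)))" using c c2 by auto
    show "AE \<xi> in M. norm (- \<psi> \<xi> * c \<xi>) \<le> norm (K * (norm (c \<xi>) + (norm \<xi>)\<^sup>2 * norm (c \<xi>)))"
    proof (rule AE_I2)
      fix \<xi> :: "real^'n"
      have "norm (\<psi> \<xi>) * norm (c \<xi>) \<le> K * (1 + (norm \<xi>)\<^sup>2) * norm (c \<xi>)" using K(2) by (rule mult_right_mono) simp
      also have "\<dots> = K * (norm (c \<xi>) + (norm \<xi>)\<^sup>2 * norm (c \<xi>))" by (simp add: algebra_simps)
      finally show "norm (- \<psi> \<xi> * c \<xi>) \<le> norm (K * (norm (c \<xi>) + (norm \<xi>)\<^sup>2 * norm (c \<xi>)))"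
        by (simp add: norm_mult)
    qed
  qed measurable
qed

text \<open>On a character, the second derivatives give -\<xi> . A \<xi>; translation by z
  multiplies it by cis (\<xi> . z), so the jump integrand becomes -\<open>levy_exp\<close>. Fubini
  exchanges the integrals over z and \<xi>.\<close>

lemma levy_operator_fourier:
  assumes sf: "sigma_finite_measure M" and M: "sets M = sets borel" 
    and c: "integrable M c" and c2: "integrable M (\<lambda>\<xi>. (norm \<xi>)\<^sup>2 * norm (c \<xi>))"
  shows "levy_operator A \<mu> (fourier_int M c) x = fourier_int M (\<lambda>\<xi>. - \<psi> \<xi> * c \<xi>) x"
proof -
  note [measurable_cong] = M and [measurable] = borel_measurable_integrable[OF c]
  define e where "e \<xi> = c \<xi> * cis (x \<bullet> \<xi>)" for \<xi>
  have e: "integrable M e" unfolding e_def using fourier_int_integrable[OF M c] .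
  note [measurable] = borel_measurable_integrable[OF e]
  define V where "V x = (\<integral>\<xi>. (- Im (c \<xi> * cis (x \<bullet> \<xi>))) *\<^sub>R \<xi> \<partial>M)" for x
  define W where "W i x = (\<integral>\<xi>. (- Re (c \<xi> * cis (x \<bullet> \<xi>)) * \<xi> $ i) *\<^sub>R \<xi> \<partial>M)" for i x
  note g = fourier_gderiv[OF M c c2, folded V_def W_def]
  have grad: "gradient (fourier_int M c) = V" using gderiv_gradient[OF g(2)] by blast
  have Wi: "integrable M (\<lambda>\<xi>. - Re (e \<xi>) * (\<xi> $ j * \<xi> $ i))" for i j
    using integrable_bounded_linear[OF bounded_linear_vec_nth g(3)[of x j], of i] by (simp add: e_def mult.assoc)
  have "W j x $ i = (\<integral>\<xi>. - Re (e \<xi>) * (\<xi> $ j * \<xi> $ i) \<partial>M)" for i j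
    unfolding W_def by (subst integral_vec_nth[OF g(3)]) (simp add: e_def mult.assoc)
  then have "divergence (\<lambda>y. A *v V y) x = (\<Sum>i\<in>UNIV. \<Sum>j\<in>UNIV. A $ i $ j * (\<integral>\<xi>. - Re (e \<xi>) * (\<xi> $ j * \<xi> $ i) \<partial>M))"
    using divergence_gderiv(2)[where W = "\<lambda>i. W i x", OF g(4)] by simp
  also have "\<dots> = (\<Sum>i\<in>UNIV. \<Sum>j\<in>UNIV. (\<integral>\<xi>. A $ i $ j * (- Re (e \<xi>) * (\<xi> $ j * \<xi> $ i)) \<partial>M))"
    by simp
  also have "\<dots> = (\<integral>\<xi>. (\<Sum>i\<in>UNIV. \<Sum>j\<in>UNIV. A $ i $ j * (- Re (e \<xi>) * (\<xi> $ j * \<xi> $ i))) \<partial>M)"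
    using Wi by (subst Bochner_Integration.integral_sum; (intro Bochner_Integration.integrable_sum integrable_mult_right)?)
      (auto intro!: sum.cong Bochner_Integration.integral_sum[symmetric])
  also have "(\<lambda>\<xi>. (\<Sum>i\<in>UNIV. \<Sum>j\<in>UNIV. A $ i $ j * (- Re (e \<xi>) * (\<xi> $ j * \<xi> $ i)))) = (\<lambda>\<xi>. - Re (e \<xi>) * (\<xi> \<bullet> (A *v \<xi>)))"
    by (auto simp: inner_vec_def matrix_vector_mult_def sum_distrib_left mult_ac sum_negf intro!: sum.cong)
  finally have div: "divergence (\<lambda>y. A *v V y) x = (\<integral>\<xi>. - Re (e \<xi>) * (\<xi> \<bullet> (A *v \<xi>)) \<partial>M)" .
  have "integrable M (\<lambda>\<xi>. (\<Sum>i\<in>UNIV. \<Sum>j\<in>UNIV. A $ i $ j * (- Re (e \<xi>) * (\<xi> $ j * \<xi> $ i))))"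
    using Wi by (intro Bochner_Integration.integrable_sum integrable_mult_right)
  then have divi: "integrable M (\<lambda>\<xi>. - Re (e \<xi>) * (\<xi> \<bullet> (A *v \<xi>)))"
    by (subst (asm) \<open>(\<lambda>\<xi>. (\<Sum>i\<in>UNIV. \<Sum>j\<in>UNIV. A $ i $ j * (- Re (e \<xi>) * (\<xi> $ j * \<xi> $ i)))) = (\<lambda>\<xi>. - Re (e \<xi>) * (\<xi> \<bullet> (A *v \<xi>)))\<close>)
  have m: "(\<lambda>(z, \<xi>). - (e \<xi> * levy_exp \<xi> z)) \<in> borel_measurable (\<mu> \<Otimes>\<^sub>M M)"
    by measurable
  have bd: "norm (- (e \<xi> * levy_exp \<xi> z)) \<le> min 1 ((norm z)\<^sup>2) * (norm (c \<xi>) * (2 + (norm \<xi>)\<^sup>2))" for z \<xi>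
    using mult_left_mono[OF levy_exp_bound[of \<xi> z] norm_ge_zero[of "c \<xi>"]]
    by (simp add: norm_mult e_def mult_ac)
  have ci: "integrable M (\<lambda>\<xi>. norm (c \<xi>) * (2 + (norm \<xi>)\<^sup>2))"
    using Bochner_Integration.integrable_add[OF integrable_mult_right[OF integrable_norm[OF c], of 2] c2]
    by (simp add: algebra_simps)
  note fub = fubini_dom[OF sigma_finite_mu sf m mu_min_integrable ci bd]
  have li: "levy_integrand (fourier_int M c) x z = Re (\<integral>\<xi>. - (e \<xi> * levy_exp \<xi> z) \<partial>M)" for z
  proof -
    have 1: "integrable M (\<lambda>\<xi>. Re (c \<xi> * cis ((x + z) \<bullet> \<xi>)))" "integrable M (\<lambda>\<xi>. Re (e \<xi>))"
      using fourier_int_integrable[OF M c] e by (auto simp only: intro!: integrable_Re)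
    have 2: "integrable M (\<lambda>\<xi>. - Im (e \<xi>) * (\<xi> \<bullet> z))" "V x \<bullet> z = (\<integral>\<xi>. - Im (e \<xi>) * (\<xi> \<bullet> z) \<partial>M)"
      using integrable_inner_left[OF g(1)[of x], of z] integral_inner_left[OF g(1)[of x], of z] unfolding V_def e_def by auto
    have 3: "integrable M (\<lambda>\<xi>. - (e \<xi> * levy_exp \<xi> z))"
      by (rule Bochner_Integration.integrable_bound[OF integrable_mult_right[OF ci, of "min 1 ((norm z)\<^sup>2)"]])
        (use bd in \<open>auto simp: abs_mult add_nonneg_nonneg intro!: AE_I2\<close>)
    have "levy_integrand (fourier_int M c) x z = 
      (\<integral>\<xi>. Re (c \<xi> * cis ((x + z) \<bullet> \<xi>)) - Re (e \<xi>) - indicator (ball 0 1) z * (- Im (e \<xi>) * (\<xi> \<bullet> z)) \<partial>M)"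
      unfolding levy_integrand_def grad unfolding fourier_int_eq[OF M c] e_def[symmetric] 2(2)
      using 1 2(1) by (simp only: Bochner_Integration.integral_diff Bochner_Integration.integrable_diff integrable_mult_right integral_mult_right_zero)
    also have "\<dots> = (\<integral>\<xi>. Re (- (e \<xi> * levy_exp \<xi> z)) \<partial>M)"
    proof (rule Bochner_Integration.integral_cong[OF refl])
      fix \<xi>
      have "c \<xi> * cis ((x + z) \<bullet> \<xi>) = e \<xi> * cis (\<xi> \<bullet> z)"
        unfolding e_def inner_add_left cis_mult[symmetric] by (simp add: inner_commute mult.assoc)
      then show "Re (c \<xi> * cis ((x + z) \<bullet> \<xi>)) - Re (e \<xi>) - indicator (ball 0 1) z * (- Im (e \<xi>) * (\<xi> \<bullet> z)) = Re (- (e \<xi> * levy_exp \<xi> z))"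
        by (simp add: levy_exp_def algebra_simps indicator_def)
    qed
    also have "\<dots> = Re (\<integral>\<xi>. - (e \<xi> * levy_exp \<xi> z) \<partial>M)" using 3 by (rule integral_Re)
    finally show ?thesis .
  qed
  have "(LINT z|\<mu>. levy_integrand (fourier_int M c) x z) = Re (\<integral>z. \<integral>\<xi>. - (e \<xi> * levy_exp \<xi> z) \<partial>M \<partial>\<mu>)"
    unfolding li using fub(3) by (rule integral_Re)
  also have "\<dots> = Re (\<integral>\<xi>. \<integral>z. - (e \<xi> * levy_exp \<xi> z) \<partial>\<mu> \<partial>M)" using fub(2) by simp
  also have "\<dots> = (\<integral>\<xi>. Re (\<integral>z. - (e \<xi> * levy_exp \<xi> z) \<partial>\<mu>) \<partial>M)" using integral_Re[OF fub(4)] by simp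
  finally have j: "(LINT z|\<mu>. levy_integrand (fourier_int M c) x z) = (\<integral>\<xi>. Re (\<integral>z. - (e \<xi> * levy_exp \<xi> z) \<partial>\<mu>) \<partial>M)" .
  have "levy_operator A \<mu> (fourier_int M c) x = 
     (\<integral>\<xi>. - Re (e \<xi>) * (\<xi> \<bullet> (A *v \<xi>)) + Re (\<integral>z. - (e \<xi> * levy_exp \<xi> z) \<partial>\<mu>) \<partial>M)"
    unfolding levy_operator_def grad div j by (intro Bochner_Integration.integral_add[symmetric] divi integrable_Re fub(4))
  also have "\<dots> = (\<integral>\<xi>. Re ((- \<psi> \<xi> * c \<xi>) * cis (x \<bullet> \<xi>)) \<partial>M)"
    using levy_exp_integrable by (intro Bochner_Integration.integral_cong) (auto simp: psi_eq e_def algebra_simps)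
  also have "\<dots> = fourier_int M (\<lambda>\<xi>. - \<psi> \<xi> * c \<xi>) x"
    unfolding fourier_int_eq[OF M psi_c_integrable[OF M c c2]] ..
  finally show ?thesis .
qed

end

text \<open>A time interval as a finite measure space, so that results on measures apply directly.
  It is open because the kernel is specified for positive times only.\<close>

definition itv :: "real \<Rightarrow> real \<Rightarrow> real measure" where "itv a b = restrict_space lborel {a<..<b}"

lemma space_itv[simp]: "space (itv a b) = {a<..<b}" by (simp add: itv_def space_restrict_space)

lemma finite_itv: "finite_measure (itv a b)"
  by (rule finite_measureI) (cases "a \<le> b"; simp add: itv_def space_restrict_space emeasure_restrict_space)

lemma sigma_finite_itv: "sigma_finite_measure (itv a b)"
  using finite_itv finite_measure_def by blast

lemma measure_itv: "a \<le> b \<Longrightarrow> measure (itv a b) {a<..<b} = b - a"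
  by (simp add: itv_def measure_restrict_space)

lemma integral_itv: 
  fixes f :: "real \<Rightarrow> 'b::{banach,second_countable_topology}"
  shows "integral\<^sup>L (itv a b) f = (LINT s:{a<..<b}|lborel. f s)"
  unfolding itv_def set_lebesgue_integral_def by (rule integral_restrict_space) simp

lemma integrable_itv: 
  fixes f :: "real \<Rightarrow> 'b::{banach,second_countable_topology}"
  shows "integrable (itv a b) f \<longleftrightarrow> set_integrable lborel {a<..<b} f"
  unfolding itv_def set_integrable_def by (rule integrable_restrict_space) simp

lemma interval_integral_itv:
  fixes f :: "real \<Rightarrow> 'b::{banach,second_countable_topology}"
  assumes "a \<le> b" shows "interval_lebesgue_integral lborel (ereal a) (ereal b) f = integral\<^sup>L (itv a b) f"
  using assms by (simp add: interval_lebesgue_integral_def integral_itv)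

lemma integral_itv_const: "a \<le> b \<Longrightarrow> (\<integral>r. c \<partial>itv a b) = (b - a) *\<^sub>R (c::'b::euclidean_space)"
  by (simp add: measure_itv)

lemma integral_itv_exp:
  assumes "0 \<le> h"
  shows "(\<integral>r. - w * exp (- (complex_of_real r * w)) \<partial>itv 0 h) = exp (- (complex_of_real h * w)) - 1"
proof -
  have "interval_lebesgue_integral lborel (ereal 0) (ereal h) (\<lambda>r. - w * exp (- (complex_of_real r * w)))
     = exp (- (complex_of_real h * w)) - exp (- (complex_of_real 0 * w))"
  proof (rule interval_integral_FTC_finite)
    show "continuous_on {min 0 h..max 0 h} (\<lambda>r. - w * exp (- (complex_of_real r * w)))"
      by (intro continuous_intros)
    show "((\<lambda>r. exp (- (complex_of_real r * w))) has_vector_derivative - w * exp (- (complex_of_real r * w))) (at r within {min 0 h..max 0 h})" for r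
    proof -
      have "((\<lambda>z. exp (- (z * w))) has_field_derivative - w * exp (- (complex_of_real r * w))) (at (complex_of_real r))"
        by (auto intro!: derivative_eq_intros)
      then show ?thesis
        by (rule has_vector_derivative_real_field[THEN has_vector_derivative_at_within])
    qed
  qed
  then show ?thesis using assms by (simp add: interval_integral_itv)
qed

context levy_heat
begin

text \<open>P r L has multiplier -\<psi> exp (-r \<psi>), the r-derivative of exp (-r \<psi>). Since
  the exponential is bounded by 1, |\<psi> c| dominates uniformly in r and Fubini applies.\<close>

lemma dynkin_fourier:
  assumes sf: "sigma_finite_measure M" and M: "sets M = sets borel" 
    and c: "integrable M c" and c2: "integrable M (\<lambda>\<xi>. (norm \<xi>)\<^sup>2 * norm (c \<xi>))" and h: "0 < h"
  shows "integrable (itv 0 h) (\<lambda>r. P r (levy_operator A \<mu> (fourier_int M c)) x)"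
    and "P h (fourier_int M c) x - fourier_int M c x = (\<integral>r. P r (levy_operator A \<mu> (fourier_int M c)) x \<partial>itv 0 h)"
proof -
  note [measurable_cong] = M and [measurable] = borel_measurable_integrable[OF c]
  let ?e = "\<lambda>r \<xi>. exp (- (complex_of_real r * \<psi> \<xi>))"
  have L: "levy_operator A \<mu> (fourier_int M c) = fourier_int M (\<lambda>\<xi>. - \<psi> \<xi> * c \<xi>)"
    using levy_operator_fourier[OF sf M c c2] by auto
  have pc: "integrable M (\<lambda>\<xi>. - \<psi> \<xi> * c \<xi>)" by (rule psi_c_integrable[OF M c c2])
  have PL: "P r (levy_operator A \<mu> (fourier_int M c)) x = Re (\<integral>\<xi>. (- \<psi> \<xi> * ?e r \<xi>) * (c \<xi> * cis (x \<bullet> \<xi>)) \<partial>M)" if "r \<in> space (itv 0 h)" for r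
    using that unfolding L by (subst P_fourier[OF _ sf M pc]) (auto simp: fourier_int_def mult_ac)
  have [measurable]: "(\<lambda>r. r) \<in> borel_measurable (itv 0 h)" unfolding itv_def by (rule measurable_restrict_space1) simp
  have m: "(\<lambda>(r, \<xi>). (- \<psi> \<xi> * ?e r \<xi>) * (c \<xi> * cis (x \<bullet> \<xi>))) \<in> borel_measurable (itv 0 h \<Otimes>\<^sub>M M)"
    by measurable
  have bd: "norm ((- \<psi> \<xi> * ?e r \<xi>) * (c \<xi> * cis (x \<bullet> \<xi>))) \<le> 1 * norm (- \<psi> \<xi> * c \<xi>)" if "r \<in> space (itv 0 h)" for r \<xi>
    using mult_left_mono[OF norm_exp_psi[of r \<xi>], of "norm (\<psi> \<xi>) * norm (c \<xi>)"] that by (simp add: norm_mult mult_ac)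
  interpret I: finite_measure "itv 0 h" by (rule finite_itv)
  note fub = fubini_dom[OF sigma_finite_itv sf m _ integrable_norm[OF pc] bd]
  have i1: "integrable (itv 0 h) (\<lambda>_. 1::real)" by simp
  show "integrable (itv 0 h) (\<lambda>r. P r (levy_operator A \<mu> (fourier_int M c)) x)"
    using integrable_Re[OF fub(3)[OF i1]] by (subst Bochner_Integration.integrable_cong[OF refl PL]) auto
  have "(\<integral>r. P r (levy_operator A \<mu> (fourier_int M c)) x \<partial>itv 0 h) = 
     (\<integral>r. Re (\<integral>\<xi>. (- \<psi> \<xi> * ?e r \<xi>) * (c \<xi> * cis (x \<bullet> \<xi>)) \<partial>M) \<partial>itv 0 h)"
    by (rule Bochner_Integration.integral_cong[OF refl PL])
  also have "\<dots> = Re (\<integral>r. \<integral>\<xi>. (- \<psi> \<xi> * ?e r \<xi>) * (c \<xi> * cis (x \<bullet> \<xi>)) \<partial>M \<partial>itv 0 h)"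
    using fub(3)[OF i1] by (rule integral_Re)
  also have "\<dots> = Re (\<integral>\<xi>. \<integral>r. (- \<psi> \<xi> * ?e r \<xi>) * (c \<xi> * cis (x \<bullet> \<xi>)) \<partial>itv 0 h \<partial>M)"
    using fub(2)[OF i1] by simp
  also have "\<dots> = Re (\<integral>\<xi>. (?e h \<xi> - 1) * (c \<xi> * cis (x \<bullet> \<xi>)) \<partial>M)"
    using integral_itv_exp[of h] h by (simp only: integral_mult_left_zero less_imp_le)
  also have "\<dots> = Re ((\<integral>\<xi>. ?e h \<xi> * (c \<xi> * cis (x \<bullet> \<xi>)) \<partial>M) - (\<integral>\<xi>. c \<xi> * cis (x \<bullet> \<xi>) \<partial>M))"
  proof -
    have i: "integrable M (\<lambda>\<xi>. c \<xi> * cis (x \<bullet> \<xi>))" by (rule fourier_int_integrable[OF M c])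
    have "integrable M (\<lambda>\<xi>. ?e h \<xi> * (c \<xi> * cis (x \<bullet> \<xi>)))"
    proof (rule Bochner_Integration.integrable_bound[OF i])
      show "AE \<xi> in M. norm (?e h \<xi> * (c \<xi> * cis (x \<bullet> \<xi>))) \<le> norm (c \<xi> * cis (x \<bullet> \<xi>))"
        using mult_right_mono[OF norm_exp_psi[of h]] h by (auto intro!: AE_I2 simp: norm_mult mult_left_le_one_le)
    qed measurable
    then show ?thesis using i by (subst Bochner_Integration.integral_diff[symmetric]) (auto simp: algebra_simps)
  qed
  also have "\<dots> = P h (fourier_int M c) x - fourier_int M c x"
    unfolding P_fourier[OF h sf M c] by (simp add: fourier_int_def mult_ac)
  finally show "P h (fourier_int M c) x - fourier_int M c x = (\<integral>r. P r (levy_operator A \<mu> (fourier_int M c)) x \<partial>itv 0 h)" by simp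
qed

lemma P_fourier_semigroup:
  assumes t: "0 < t" and s: "0 < s" and sf: "sigma_finite_measure M" and M: "sets M = sets borel" and c: "integrable M c"
  shows "P t (P s (fourier_int M c)) x = P (t + s) (fourier_int M c) x"
proof -
  note [measurable_cong] = M and [measurable] = borel_measurable_integrable[OF c]
  have i: "integrable M (\<lambda>\<xi>. c \<xi> * exp (- (complex_of_real s * \<psi> \<xi>)))"
  proof (rule Bochner_Integration.integrable_bound[OF c])
    show "AE \<xi> in M. norm (c \<xi> * exp (- (complex_of_real s * \<psi> \<xi>))) \<le> norm (c \<xi>)"
      unfolding norm_mult using norm_exp_psi[of s] s by (intro AE_I2 mult_left_le) auto
  qed measurable
  have "P s (fourier_int M c) = fourier_int M (\<lambda>\<xi>. c \<xi> * exp (- (complex_of_real s * \<psi> \<xi>)))"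
    using P_fourier[OF s sf M c] by auto
  then show ?thesis using P_fourier[OF t sf M i] P_fourier[OF _ sf M c, of "t + s"] t s
    by (simp add: mult.assoc exp_add[symmetric] algebra_simps)
qed

end

subsection \<open>Truncation and Gaussian mollification\<close>

text \<open>Both the slope of the cutoff and the width of the mollifier, so one index drives both
  limits.\<close>

definition shrink :: "nat \<Rightarrow> real" where "shrink n = 1 / real (Suc n)"

lemma shrink_pos: "0 < shrink n" and shrink_le1: "shrink n \<le> 1"
  by (auto simp: shrink_def)

lemma shrink_tendsto: "shrink \<longlonglongrightarrow> 0"
  using LIMSEQ_inverse_real_of_nat by (simp add: shrink_def[abs_def] divide_inverse)

definition cut :: "nat \<Rightarrow> 'a::euclidean_space \<Rightarrow> real" where "cut n x = chi (shrink n *\<^sub>R x)"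

definition cut' :: "nat \<Rightarrow> 'a::euclidean_space \<Rightarrow> 'a" where
  "cut' n x = shrink n *\<^sub>R (- chi (shrink n *\<^sub>R x) *\<^sub>R (shrink n *\<^sub>R x))"

text \<open>Row \<open>i\<close> of the Hessian of \<open>cut n\<close>; likewise
  \<open>cut'\<close> is the gradient.\<close>

definition cut'' :: "nat \<Rightarrow> 'n \<Rightarrow> real^'n \<Rightarrow> real^'n" where
  "cut'' n i x = shrink n *\<^sub>R shrink n *\<^sub>R ((chi (shrink n *\<^sub>R x) * (shrink n *\<^sub>R x) $ i) *\<^sub>R (shrink n *\<^sub>R x) 
      - chi (shrink n *\<^sub>R x) *\<^sub>R axis i 1)"

lemma gderiv_compose_scaleR:
  assumes "GDERIV f (c *\<^sub>R x) :> v" shows "GDERIV (\<lambda>x. f (c *\<^sub>R x)) x :> c *\<^sub>R v"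
proof -
  have "((\<lambda>x. f (c *\<^sub>R x)) has_derivative (\<lambda>h. (c *\<^sub>R h) \<bullet> v)) (at x)"
    by (rule has_derivative_compose[where f = "\<lambda>x. c *\<^sub>R x" and g = f])
      (use assms in \<open>auto simp: gderiv_def intro!: derivative_eq_intros\<close>)
  then show ?thesis by (simp add: gderiv_def)
qed

lemma gderiv_compose_affine:
  assumes "GDERIV f (x - a) :> v" shows "GDERIV (\<lambda>x. f (x - a)) x :> v"
proof -
  have "((\<lambda>x. f (x - a)) has_derivative (\<lambda>h. h \<bullet> v)) (at x)"
    by (rule has_derivative_compose[where f = "\<lambda>x. x - a" and g = f])
      (use assms in \<open>auto simp: gderiv_def intro!: derivative_eq_intros\<close>)
  then show ?thesis by (simp add: gderiv_def)
qed

lemma gderiv_nth: "GDERIV (\<lambda>y::real^'n. y $ i) x :> axis i 1"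
  unfolding gderiv_def inner_axis by (simp add: bounded_linear_imp_has_derivative bounded_linear_vec_nth)

lemma gderiv_continuous_on: "(\<And>x. GDERIV f x :> V x) \<Longrightarrow> continuous_on S f"
  by (intro continuous_at_imp_continuous_on ballI gderiv_continuous)

lemma gderiv_cut: "GDERIV (cut n) x :> cut' n x"
  unfolding cut_def[abs_def] cut'_def by (rule gderiv_compose_scaleR[OF gderiv_chi])

lemma gderiv_cut': 
  fixes x :: "real^'n"
  shows "GDERIV (\<lambda>x. cut' n x $ i) x :> cut'' n i x"
proof -
  have "GDERIV (\<lambda>y. - (chi y * y $ i)) y :> (chi y * y $ i) *\<^sub>R y - chi y *\<^sub>R axis i 1" for y :: "real^'n"
    by (rule GDERIV_subst[OF GDERIV_minus[OF GDERIV_mult[OF gderiv_chi gderiv_nth]]])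
      (simp add: algebra_simps)
  from gderiv_compose_scaleR[OF this, of "shrink n" x]
  have "GDERIV (\<lambda>x. - (chi (shrink n *\<^sub>R x) * (shrink n *\<^sub>R x) $ i)) x :> shrink n *\<^sub>R ((chi (shrink n *\<^sub>R x) * (shrink n *\<^sub>R x) $ i) *\<^sub>R (shrink n *\<^sub>R x) 
      - chi (shrink n *\<^sub>R x) *\<^sub>R axis i 1)" .
  from GDERIV_mult[OF GDERIV_const[of "shrink n"] this]
  show ?thesis by (simp add: cut'_def cut''_def scaleR_diff_right mult_ac)
qed

lemma cut_pos: "0 < cut n x" and cut_le1: "cut n x \<le> 1" by (auto simp: cut_def chi_pos chi_le1)

lemma cut_abs: "\<bar>cut n x\<bar> \<le> 1" using cut_pos[of n x] cut_le1[of n x] by simp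

lemma norm_cut': "norm (cut' n x) \<le> shrink n"
proof -
  have "norm (cut' n x) = shrink n * (norm (shrink n *\<^sub>R x) * chi (shrink n *\<^sub>R x))"
    using shrink_pos[of n] chi_pos[of "shrink n *\<^sub>R x"] by (simp add: cut'_def mult_ac)
  also have "\<dots> \<le> shrink n * 1" by (rule mult_left_mono[OF norm_mult_chi_le1(1)]) (use shrink_pos[of n] in simp)
  finally show ?thesis by simp
qed

lemma norm_cut'': "norm (cut'' n i x) \<le> 2 * shrink n"
proof -
  define y where "y = shrink n *\<^sub>R x"
  have "\<bar>chi y * y $ i\<bar> * norm y \<le> chi y * norm y * norm y"
    unfolding abs_mult using chi_pos[of y] component_le_norm_cart[of y i] by (intro mult_right_mono mult_mono) auto
  also have "\<dots> \<le> 1" using norm_mult_chi_le1(2)[of y] by (simp add: power2_eq_square mult_ac)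
  finally have 1: "norm ((chi y * y $ i) *\<^sub>R y) \<le> 1" by simp
  have 2: "norm (chi y *\<^sub>R axis i (1::real)) \<le> 1" using chi_pos[of y] chi_le1[of y] by simp
  have "norm (cut'' n i x) = shrink n * shrink n * norm ((chi y * y $ i) *\<^sub>R y - chi y *\<^sub>R axis i 1)"
    using shrink_pos[of n] by (simp add: cut''_def y_def[symmetric])
  also have "\<dots> \<le> shrink n * 1 * 2"
    using norm_triangle_ineq4[of "(chi y * y $ i) *\<^sub>R y" "chi y *\<^sub>R axis i 1"] 1 2 shrink_pos[of n] shrink_le1[of n]
    by (intro mult_mono) auto
  finally show ?thesis by simp
qed

lemma cut_borel[measurable]: "cut n \<in> borel_measurable borel" unfolding cut_def[abs_def] by measurable

lemma continuous_cut: "continuous_on UNIV (cut n)"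
  by (rule gderiv_continuous_on[OF gderiv_cut])

lemma cut_tendsto: assumes "X \<longlonglongrightarrow> x" shows "(\<lambda>n. cut n (X n)) \<longlonglongrightarrow> 1"
proof -
  have "(\<lambda>n. shrink n *\<^sub>R X n) \<longlonglongrightarrow> 0 *\<^sub>R x" by (intro tendsto_scaleR shrink_tendsto assms)
  then have "(\<lambda>n. chi (shrink n *\<^sub>R X n)) \<longlonglongrightarrow> chi (0 *\<^sub>R x)"
    by (rule isCont_tendsto_compose[OF gderiv_continuous[OF gderiv_chi]])
  then show ?thesis by (simp add: cut_def chi_0)
qed

lemma cut'_tendsto: "(\<lambda>n. cut' n (X n)) \<longlonglongrightarrow> 0"
  by (rule Lim_null_comparison[OF _ shrink_tendsto]) (simp add: norm_cut')

lemma cut''_tendsto: "(\<lambda>n. cut'' n i (X n)) \<longlonglongrightarrow> 0"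
proof (rule Lim_null_comparison)
  show "(\<lambda>n. 2 * shrink n) \<longlonglongrightarrow> 0" using tendsto_mult_left[OF shrink_tendsto, of 2] by simp
qed (simp add: norm_cut'')

lemma vector_lipschitz:
  fixes V :: "real^'n \<Rightarrow> real^'n"
  assumes "\<And>i x. GDERIV (\<lambda>y. V y $ i) x :> W i x" "\<And>i x. norm (W i x) \<le> C"
  shows "norm (V x - V y) \<le> real CARD('n) * C * norm (x - y)"
proof -
  have "norm (V x - V y) \<le> (\<Sum>i\<in>UNIV. \<bar>V x $ i - V y $ i\<bar>)" using norm_le_l1_cart[of "V x - V y"] by simp
  also have "\<dots> \<le> (\<Sum>i\<in>(UNIV::'n set). C * norm (x - y))" 
    by (rule sum_mono) (rule gderiv_bound[OF assms(1) assms(2)])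
  finally show ?thesis by simp
qed

text \<open>The constant is independent of n because \<open>shrink n \<le> 1\<close>; the uniform
  bound on L of the truncated functions depends on that.\<close>

lemma cut_taylor: "\<bar>cut n (y + z) - cut n y - cut' n y \<bullet> z\<bar> \<le> real CARD('n) * 2 * (norm z)\<^sup>2" for y z :: "real^'n"
proof (cases "z = 0")
  case False
  have 2: "norm (cut'' n i x) \<le> 2" for i and x :: "real^'n" using norm_cut''[of n i x] shrink_le1[of n] by simp
  have "\<bar>cut n (y + z) - cut n y - cut' n y \<bullet> z\<bar> \<le> (real CARD('n) * 2) * norm z powr (1 + 1)"
  proof (rule gderiv_taylor_holder[OF gderiv_cut])
    show "norm (cut' n x - cut' n y) \<le> (real CARD('n) * 2) * norm (x - y) powr 1" for x y :: "real^'n"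
      using vector_lipschitz[of "cut' n" "cut'' n" 2 x y, OF gderiv_cut' 2] by simp
  qed auto
  moreover have "norm z powr (1 + 1) = (norm z)\<^sup>2" using False by (subst powr_add) (simp add: power2_eq_square)
  ultimately show ?thesis by simp
qed simp

definition moll :: "nat \<Rightarrow> ('a::euclidean_space \<Rightarrow> 'b::{banach,second_countable_topology}) \<Rightarrow> 'a \<Rightarrow> 'b" where
  "moll n F x = (\<integral>z. F (x - shrink n *\<^sub>R z) \<partial>gauss)"

lemma moll_bound: "(\<And>x. norm (F x) \<le> C) \<Longrightarrow> norm (moll n F x) \<le> C"
  unfolding moll_def by (rule norm_integral_le_prob[OF prob_space_gauss]) (auto intro: order_trans[OF norm_ge_zero])

lemma moll_integrable:
  fixes F :: "'a::euclidean_space \<Rightarrow> 'b::{banach,second_countable_topology}"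
  assumes "continuous_on UNIV F" "\<And>x. norm (F x) \<le> C"
  shows "integrable gauss (\<lambda>z. F (x - shrink n *\<^sub>R z))"
proof -
  interpret prob_space "gauss :: 'a measure" by (rule prob_space_gauss)
  have [measurable]: "F \<in> borel_measurable borel" by (rule borel_measurable_continuous_onI[OF assms(1)])
  show ?thesis by (rule integrable_const_bound[of _ C]) (use assms(2) in auto)
qed

lemma moll_gderiv:
  fixes F :: "'a::euclidean_space \<Rightarrow> real"
  assumes "\<And>x. GDERIV F x :> V x" "\<And>x. \<bar>F x\<bar> \<le> C" "\<And>x. norm (V x) \<le> C"
  shows "GDERIV (moll n F) x :> moll n V x" "integrable gauss (\<lambda>z. V (x - shrink n *\<^sub>R z))"
proof -
  have c: "continuous_on UNIV F" by (rule gderiv_continuous_on[OF assms(1)])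
  have i: "integrable gauss (\<lambda>z. F (x - shrink n *\<^sub>R z))" for x by (rule moll_integrable[OF c]) (use assms(2) in simp)
  interpret prob_space "gauss :: 'a measure" by (rule prob_space_gauss)
  have k: "integrable (gauss :: 'a measure) (\<lambda>_. C)" by simp
  note g = gderiv_lebesgue_integral[OF i gderiv_compose_affine[OF assms(1)] assms(3) k]
  show "GDERIV (moll n F) x :> moll n V x" "integrable gauss (\<lambda>z. V (x - shrink n *\<^sub>R z))"
    unfolding moll_def[abs_def] using g by auto
qed

text \<open>The last hypothesis is continuous convergence of \<open>F n\<close> at x. It allows the
  mollified function to change with n, as truncation and mollification happen together.\<close>

lemma moll_tendsto:
  fixes F :: "nat \<Rightarrow> 'a::euclidean_space \<Rightarrow> 'b::{banach,second_countable_topology}"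
  assumes "\<And>n. continuous_on UNIV (F n)" "\<And>n x. norm (F n x) \<le> C"
    and "\<And>X. X \<longlonglongrightarrow> x \<Longrightarrow> (\<lambda>n. F n (X n)) \<longlonglongrightarrow> G"
  shows "(\<lambda>n. moll n (F n) x) \<longlonglongrightarrow> G"
proof -
  interpret prob_space "gauss :: 'a measure" by (rule prob_space_gauss)
  have "(\<lambda>n. \<integral>z. F n (x - shrink n *\<^sub>R z) \<partial>gauss) \<longlonglongrightarrow> (\<integral>z. G \<partial>(gauss :: 'a measure))"
  proof (rule tendsto_lebesgue_integral_bounded(1)[where C = C])
    show "(\<lambda>n. F n (x - shrink n *\<^sub>R z)) \<longlonglongrightarrow> G" for z
    proof (rule assms(3))
      have "(\<lambda>n. x - shrink n *\<^sub>R z) \<longlonglongrightarrow> x - 0 *\<^sub>R z" by (intro tendsto_intros shrink_tendsto)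
      then show "(\<lambda>n. x - shrink n *\<^sub>R z) \<longlonglongrightarrow> x" by simp
    qed
    show "(\<lambda>z. F n (x - shrink n *\<^sub>R z)) \<in> borel_measurable gauss" for n
      using borel_measurable_integrable[OF moll_integrable[OF assms(1,2)]] .
  qed (use assms(2) finite_measure_axioms in auto)
  then show ?thesis using prob_space by (simp add: moll_def)
qed

text \<open>This works because a Gaussian density is itself a Fourier integral, see \<open>gauss_char\<close>.\<close>

lemma moll_fourier:
  fixes F :: "real^'n \<Rightarrow> real"
  assumes F: "integrable lborel F"
  obtains M :: "(real^'n) measure" and c where "sigma_finite_measure M" "sets M = sets borel" "integrable M c"
    "integrable M (\<lambda>\<xi>. (norm \<xi>)\<^sup>2 * norm (c \<xi>))" "moll n F = fourier_int M c"
proof -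
  have [measurable]: "F \<in> borel_measurable borel" using F by simp
  interpret g: prob_space "gauss :: (real^'n) measure" by (rule prob_space_gauss)
  define \<nu> where "\<nu> = real (Suc n)"
  have \<nu>: "0 < \<nu>" "shrink n * \<nu> = 1" by (auto simp: \<nu>_def shrink_def)
  define \<kappa> where "\<kappa> = (1 / sqrt (2 * pi)) ^ DIM(real^'n)"
  have \<kappa>: "0 \<le> \<kappa>" unfolding \<kappa>_def by simp
  \<comment> \<open>Gaussian normalisation times the Jacobian of the substitution z = \<nu> (x -
    y).\<close>
  define k where "k = \<bar>- \<nu>\<bar> ^ DIM(real^'n) * \<kappa>"
  have k: "0 \<le> k" unfolding k_def using \<kappa> by simp
  \<comment> \<open>The density value chi (\<nu> (x - y)) is the characteristic function of the
    Gaussian scaled by \<nu>. Convolving with F therefore produces the Fourier transform of F as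
    coefficient, which is bounded as F is integrable.\<close>
  define M :: "(real^'n) measure" where "M = distr gauss borel (\<lambda>\<xi>. \<nu> *\<^sub>R \<xi>)"
  define c where "c \<xi> = (\<integral>y. complex_of_real (k * F y) * cis (- (y \<bullet> \<xi>)) \<partial>lborel)" for \<xi>
  have [measurable]: "c \<in> borel_measurable borel" unfolding c_def by measurable
  have cb: "norm (c \<xi>) \<le> k * (\<integral>y. norm (F y) \<partial>lborel)" for \<xi>
  proof -
    have "norm (c \<xi>) \<le> (\<integral>y. norm (complex_of_real (k * F y) * cis (- (y \<bullet> \<xi>))) \<partial>lborel)" unfolding c_def by (rule integral_norm_bound)
    also have "\<dots> = k * (\<integral>y. norm (F y) \<partial>lborel)" using k by (simp add: norm_mult abs_mult)
    finally show ?thesis .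
  qed
  show ?thesis
  proof (rule that[of M c])
    interpret M: prob_space M unfolding M_def by (rule g.prob_space_distr) measurable
    show "sigma_finite_measure M" by unfold_locales
    show [measurable_cong]: "sets M = sets borel" by (simp add: M_def)
    show "integrable M c" by (rule M.integrable_const_bound) (use cb in auto)
    have "integrable M (\<lambda>\<xi>. (norm \<xi>)\<^sup>2)" unfolding M_def using integrable_mult_right[OF gauss_norm2, of "\<nu>\<^sup>2"]
      by (subst integrable_distr_eq) (auto simp: power_mult_distrib)
    then have i: "integrable M (\<lambda>\<xi>. (k * (\<integral>y. norm (F y) \<partial>lborel)) * (norm \<xi>)\<^sup>2)" by simp
    show "integrable M (\<lambda>\<xi>. (norm \<xi>)\<^sup>2 * norm (c \<xi>))"
    proof (rule Bochner_Integration.integrable_bound[OF i])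
      show "AE \<xi> in M. norm ((norm \<xi>)\<^sup>2 * norm (c \<xi>)) \<le> norm ((k * (\<integral>y. norm (F y) \<partial>lborel)) * (norm \<xi>)\<^sup>2)"
        using mult_left_mono[OF cb, of "(norm \<xi>)\<^sup>2" for \<xi> :: "real^'n"] k by (auto intro!: AE_I2 simp: abs_mult mult.commute)
    qed measurable
    show "moll n F = fourier_int M c"
    proof
      fix x
      have m: "(\<lambda>(y, \<xi>). complex_of_real (k * F y) * cis ((x - y) \<bullet> (\<nu> *\<^sub>R \<xi>))) \<in> borel_measurable (lborel \<Otimes>\<^sub>M gauss)"
        by measurable
      have kF: "integrable lborel (\<lambda>y. norm (k * F y))" using F by auto
      note fub = fubini_dom[OF lborel.sigma_finite_measure_axioms g.sigma_finite_measure_axioms m kF, of "\<lambda>_. 1"]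
      have "moll n F x = (\<integral>z. \<kappa> * chi z * F (x - shrink n *\<^sub>R z) \<partial>lborel)"
        unfolding moll_def gauss_chi \<kappa>_def by (subst integral_density) (auto simp: chi_pos[THEN less_imp_le])
      also have "\<dots> = \<bar>- \<nu>\<bar> ^ DIM(real^'n) * (\<integral>y. \<kappa> * chi (\<nu> *\<^sub>R x + (- \<nu>) *\<^sub>R y) * F (x - shrink n *\<^sub>R (\<nu> *\<^sub>R x + (- \<nu>) *\<^sub>R y)) \<partial>lborel)"
        using \<nu> by (subst lborel_integral_affine(1)[of "- \<nu>" _ "\<nu> *\<^sub>R x"]) auto
      also have "\<dots> = (\<integral>y. k * F y * chi (\<nu> *\<^sub>R (x - y)) \<partial>lborel)"
      proof -
        have "\<kappa> * chi (\<nu> *\<^sub>R x + (- \<nu>) *\<^sub>R y) * F (x - shrink n *\<^sub>R (\<nu> *\<^sub>R x + (- \<nu>) *\<^sub>R y)) = \<kappa> * (F y * chi (\<nu> *\<^sub>R (x - y)))" for y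
          using \<nu> by (simp add: scaleR_diff_right)
        moreover have "k * F y * chi (\<nu> *\<^sub>R (x - y)) = \<bar>- \<nu>\<bar> ^ DIM(real^'n) * (\<kappa> * (F y * chi (\<nu> *\<^sub>R (x - y))))" for y
          unfolding k_def by (simp only: mult.assoc)
        ultimately show ?thesis by (simp only: integral_mult_right_zero)
      qed
      also have "complex_of_real \<dots> = (\<integral>y. complex_of_real (k * F y) * (\<integral>\<xi>. cis ((\<nu> *\<^sub>R (x - y)) \<bullet> \<xi>) \<partial>gauss) \<partial>lborel)"
        unfolding gauss_char integral_complex_of_real[symmetric] by simp
      also have "\<dots> = (\<integral>y. \<integral>\<xi>. complex_of_real (k * F y) * cis ((x - y) \<bullet> (\<nu> *\<^sub>R \<xi>)) \<partial>gauss \<partial>lborel)" by simp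
      also have "\<dots> = (\<integral>\<xi>. \<integral>y. complex_of_real (k * F y) * cis ((x - y) \<bullet> (\<nu> *\<^sub>R \<xi>)) \<partial>lborel \<partial>gauss)"
        using fub(2) by (simp add: norm_mult abs_mult)
      also have "\<dots> = (\<integral>\<xi>. c (\<nu> *\<^sub>R \<xi>) * cis (x \<bullet> (\<nu> *\<^sub>R \<xi>)) \<partial>gauss)"
      proof -
        have "(\<integral>y. complex_of_real (k * F y) * cis ((x - y) \<bullet> \<xi>) \<partial>lborel) = c \<xi> * cis (x \<bullet> \<xi>)" for \<xi>
        proof -
          have "c \<xi> * cis (x \<bullet> \<xi>) = (\<integral>y. (complex_of_real (k * F y) * cis (- (y \<bullet> \<xi>))) * cis (x \<bullet> \<xi>) \<partial>lborel)"
            unfolding c_def by (rule integral_mult_left_zero[symmetric])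
          then show ?thesis by (simp add: mult.assoc cis_mult inner_diff_left)
        qed
        then show ?thesis by (simp only:)
      qed
      also have "\<dots> = (\<integral>\<xi>. c \<xi> * cis (x \<bullet> \<xi>) \<partial>M)" unfolding M_def by (subst integral_distr) auto
      finally have e: "complex_of_real (moll n F x) = (\<integral>\<xi>. c \<xi> * cis (x \<bullet> \<xi>) \<partial>M)" .
      show "moll n F x = fourier_int M c x" using arg_cong[OF e, of Re] by (simp only: fourier_int_def Re_complex_of_real)
    qed
  qed
qed

lemma cut_integrable: 
  assumes "continuous_on UNIV \<phi>" "\<And>x. \<bar>\<phi> x\<bar> \<le> C"
  shows "integrable lborel (\<lambda>x. \<phi> x * cut n (x::real^'n))"
proof -
  have [measurable]: "\<phi> \<in> borel_measurable borel" by (rule borel_measurable_continuous_onI[OF assms(1)])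
  have "integrable lborel (\<lambda>x::real^'n. chi (0 + shrink n *\<^sub>R x))"
    using lborel_integral_affine(2)[of "shrink n" chi 0] chi_integrable shrink_pos[of n] by auto
  then have i: "integrable lborel (\<lambda>x::real^'n. C * cut n x)" by (simp add: cut_def)
  show ?thesis
    by (rule Bochner_Integration.integrable_bound[OF i])
      (use assms(2) in \<open>auto intro!: AE_I2 mult_right_mono intro: order_trans[OF _ abs_ge_self] simp: abs_mult\<close>)
qed

subsection \<open>Functions in the domain of the Levy operator\<close>

lemma abs_add3_le: "\<bar>a\<bar> \<le> x \<Longrightarrow> \<bar>b\<bar> \<le> y \<Longrightarrow> \<bar>c\<bar> \<le> z \<Longrightarrow> \<bar>a + b + c\<bar> \<le> x + y + (z::real)"
  by linarith

context levy_heat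
begin

text \<open>What L needs, with one constant: a Taylor remainder of order 1 + \<theta> for small
  jumps, boundedness for large jumps, and rows \<open>W i\<close> of the Hessian for the local part,
  constrained only when \<open>A \<noteq> 0\<close>. A common \<open>C\<close> along a sequence
  gives dominated convergence.\<close>

definition levy_reg :: "real \<Rightarrow> real \<Rightarrow> (real^'n \<Rightarrow> real) \<Rightarrow> (real^'n \<Rightarrow> real^'n) \<Rightarrow> ('n \<Rightarrow> real^'n \<Rightarrow> real^'n) \<Rightarrow> bool" where
  "levy_reg \<theta> C \<phi> V W \<longleftrightarrow> 0 \<le> C \<and> (\<forall>x. GDERIV \<phi> x :> V x) \<and> (\<forall>x. \<bar>\<phi> x\<bar> \<le> C) \<and> (\<forall>x. norm (V x) \<le> C) \<and>
     (\<forall>x z. norm z < 1 \<longrightarrow> \<bar>\<phi> (x + z) - \<phi> x - V x \<bullet> z\<bar> \<le> C * norm z powr (1 + \<theta>)) \<and>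
     (A = 0 \<or> (\<forall>i x. GDERIV (\<lambda>y. V y $ i) x :> W i x \<and> norm (W i x) \<le> C))"

lemma levy_regD:
  assumes "levy_reg \<theta> C \<phi> V W"
  shows "0 \<le> C" "GDERIV \<phi> x :> V x" "\<bar>\<phi> x\<bar> \<le> C" "norm (V x) \<le> C"
    "norm z < 1 \<Longrightarrow> \<bar>\<phi> (x + z) - \<phi> x - V x \<bullet> z\<bar> \<le> C * norm z powr (1 + \<theta>)"
    "A \<noteq> 0 \<Longrightarrow> GDERIV (\<lambda>y. V y $ i) x :> W i x" "A \<noteq> 0 \<Longrightarrow> norm (W i x) \<le> C"
    "gradient \<phi> x = V x" "continuous_on UNIV \<phi>"
  using assms gderiv_gradient gderiv_continuous_on unfolding levy_reg_def by blast+

definition mu_moment :: "real \<Rightarrow> real" where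
  "mu_moment \<theta> = (\<integral>z. min 1 (norm z powr (1 + \<theta>)) \<partial>\<mu>)"

text \<open>The factor 2 comes from large jumps, where \<open>\<phi> (x + z)\<close> and
  \<open>\<phi> x\<close> are bounded separately.\<close>

lemma levy_integrand_bound:
  assumes r: "levy_reg \<theta> C \<phi> V W" and th: "0 < \<theta>"
  shows "\<bar>levy_integrand \<phi> x z\<bar> \<le> 2 * C * min 1 (norm z powr (1 + \<theta>))"
proof (cases "norm z < 1")
  case True
  then have "norm z powr (1 + \<theta>) \<le> 1 powr (1 + \<theta>)" using th by (intro powr_mono2) auto
  then have m: "min 1 (norm z powr (1 + \<theta>)) = norm z powr (1 + \<theta>)" by simp
  have "0 \<le> C * norm z powr (1 + \<theta>)" using levy_regD(1)[OF r] by simp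
  then show ?thesis using levy_regD(5)[OF r True, of x] True unfolding m levy_integrand_def levy_regD(8)[OF r] by simp
next
  case False
  then have "1 powr (1 + \<theta>) \<le> norm z powr (1 + \<theta>)" using th by (intro powr_mono2) auto
  then have m: "min 1 (norm z powr (1 + \<theta>)) = 1" by simp
  show ?thesis using False levy_regD(3)[OF r, of "x + z"] levy_regD(3)[OF r, of x] unfolding m levy_integrand_def by simp
qed

lemma levy_integrand_measurable:
  assumes r: "levy_reg \<theta> C \<phi> V W"
  shows "levy_integrand \<phi> x \<in> borel_measurable \<mu>"
proof -
  have [measurable]: "\<phi> \<in> borel_measurable borel" by (rule borel_measurable_continuous_onI[OF levy_regD(9)[OF r]])
  have [measurable]: "(\<lambda>z. gradient \<phi> x \<bullet> z) \<in> borel_measurable borel"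
    by (intro borel_measurable_continuous_onI continuous_intros)
  have i: "indicator (ball 0 1) z = (if norm z < 1 then 1 else 0 :: real)" for z :: "real^'n" by simp
  have "levy_integrand \<phi> x \<in> borel_measurable borel" unfolding levy_integrand_def[abs_def] i by measurable
  then show ?thesis by (subst measurable_cong_sets[OF sets_mu refl])
qed

lemma levy_integrand_integrable:
  assumes r: "levy_reg \<theta> C \<phi> V W" and th: "0 < \<theta>" and mu: "integrable \<mu> (\<lambda>z. min 1 (norm z powr (1 + \<theta>)))"
  shows "integrable \<mu> (levy_integrand \<phi> x)"
proof (rule Bochner_Integration.integrable_bound)
  show "integrable \<mu> (\<lambda>z. 2 * C * min 1 (norm z powr (1 + \<theta>)))" using mu by simp
  show "AE z in \<mu>. norm (levy_integrand \<phi> x z) \<le> norm (2 * C * min 1 (norm z powr (1 + \<theta>)))"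
  proof (rule AE_I2)
    fix z
    have "norm (levy_integrand \<phi> x z) \<le> 2 * C * min 1 (norm z powr (1 + \<theta>))" using levy_integrand_bound[OF r th] by simp
    also have "\<dots> \<le> norm \<dots>" by simp
    finally show "norm (levy_integrand \<phi> x z) \<le> norm (2 * C * min 1 (norm z powr (1 + \<theta>)))" .
  qed
qed (rule levy_integrand_measurable[OF r])

lemma levy_reg_divergence:
  assumes r: "levy_reg \<theta> C \<phi> V W"
  shows "divergence (\<lambda>y. A *v gradient \<phi> y) x = (\<Sum>i\<in>UNIV. \<Sum>j\<in>UNIV. A $ i $ j * (W j x $ i))"
    and "(\<lambda>y. A *v gradient \<phi> y) differentiable (at x)"
proof -
  have "divergence (\<lambda>y. A *v gradient \<phi> y) x = (\<Sum>i\<in>UNIV. \<Sum>j\<in>UNIV. A $ i $ j * (W j x $ i))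
    \<and> (\<lambda>y. A *v gradient \<phi> y) differentiable (at x)"
  proof (cases "A = 0")
    case True
    show ?thesis unfolding True using divergence_zero by simp
  next
    case False
    show ?thesis unfolding levy_regD(8)[OF r] using divergence_gderiv[OF levy_regD(6)[OF r False]] by blast
  qed
  then show "divergence (\<lambda>y. A *v gradient \<phi> y) x = (\<Sum>i\<in>UNIV. \<Sum>j\<in>UNIV. A $ i $ j * (W j x $ i))"
    and "(\<lambda>y. A *v gradient \<phi> y) differentiable (at x)" by auto
qed

lemma levy_operator_defined_reg:
  assumes r: "levy_reg \<theta> C \<phi> V W" and th: "0 < \<theta>" and mu: "integrable \<mu> (\<lambda>z. min 1 (norm z powr (1 + \<theta>)))"
  shows "levy_operator_defined A \<mu> \<phi> x"
  unfolding levy_operator_defined_def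
  using levy_integrand_integrable[OF r th mu] levy_reg_divergence(2)[OF r] 
    differentiableI[OF levy_regD(2)[OF r, unfolded gderiv_def]] by blast

lemma levy_operator_bound:
  assumes r: "levy_reg \<theta> C \<phi> V W" and th: "0 < \<theta>" and mu: "integrable \<mu> (\<lambda>z. min 1 (norm z powr (1 + \<theta>)))"
  shows "\<bar>levy_operator A \<mu> \<phi> x\<bar> \<le> C * ((\<Sum>i\<in>UNIV. \<Sum>j\<in>UNIV. \<bar>A $ i $ j\<bar>) + 2 * mu_moment \<theta>)"
proof -
  have "\<bar>A $ i $ j * (W j x $ i)\<bar> \<le> C * \<bar>A $ i $ j\<bar>" for i j
  proof (cases "A = 0")
    case False
    then have "\<bar>W j x $ i\<bar> \<le> C" using component_le_norm_cart[of "W j x" i] levy_regD(7)[OF r, of j x] by linarith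
    then show ?thesis using mult_left_mono[of "\<bar>W j x $ i\<bar>" C "\<bar>A $ i $ j\<bar>"] by (simp add: abs_mult mult.commute)
  qed simp
  then have "\<bar>\<Sum>i\<in>UNIV. \<Sum>j\<in>UNIV. A $ i $ j * (W j x $ i)\<bar> \<le> (\<Sum>i\<in>UNIV. \<Sum>j\<in>UNIV. C * \<bar>A $ i $ j\<bar>)"
    by (intro order_trans[OF sum_abs] sum_mono)
  then have 1: "\<bar>divergence (\<lambda>y. A *v gradient \<phi> y) x\<bar> \<le> C * (\<Sum>i\<in>UNIV. \<Sum>j\<in>UNIV. \<bar>A $ i $ j\<bar>)"
    unfolding levy_reg_divergence(1)[OF r] by (simp add: sum_distrib_left)
  have "\<bar>LINT z|\<mu>. levy_integrand \<phi> x z\<bar> \<le> (LINT z|\<mu>. \<bar>levy_integrand \<phi> x z\<bar>)" using integral_norm_bound[of \<mu> "levy_integrand \<phi> x"] by simp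
  also have "\<dots> \<le> (LINT z|\<mu>. 2 * C * min 1 (norm z powr (1 + \<theta>)))"
    using levy_integrand_integrable[OF r th mu] mu levy_integrand_bound[OF r th] by (intro integral_mono) auto
  finally have "\<bar>LINT z|\<mu>. levy_integrand \<phi> x z\<bar> \<le> 2 * C * mu_moment \<theta>" by (simp add: mu_moment_def)
  then show ?thesis using 1 unfolding levy_operator_def by (simp add: algebra_simps)
qed

text \<open>The common constant dominates all jump integrands. With \<open>X\<close> constant this
  is used for approximation in \<open>dynkin\<close>, with \<open>X\<close> moving for the joint
  continuity of L u.\<close>

lemma levy_operator_tendsto:
  assumes rn: "\<And>n. levy_reg \<theta> C (\<phi>n n) (Vn n) (Wn n)" and r: "levy_reg \<theta> C' \<phi> V W"
    and th: "0 < \<theta>" and mu: "integrable \<mu> (\<lambda>z. min 1 (norm z powr (1 + \<theta>)))"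
    and lim: "\<And>z. (\<lambda>n. \<phi>n n (X n + z)) \<longlonglongrightarrow> \<phi> (x + z)" "(\<lambda>n. Vn n (X n)) \<longlonglongrightarrow> V x"
      "\<And>i. A \<noteq> 0 \<Longrightarrow> (\<lambda>n. Wn n i (X n)) \<longlonglongrightarrow> W i x"
  shows "(\<lambda>n. levy_operator A \<mu> (\<phi>n n) (X n)) \<longlonglongrightarrow> levy_operator A \<mu> \<phi> x"
  unfolding levy_operator_def
proof (rule tendsto_add)
  show "(\<lambda>n. divergence (\<lambda>y. A *v gradient (\<phi>n n) y) (X n)) \<longlonglongrightarrow> divergence (\<lambda>y. A *v gradient \<phi> y) x"
  proof (cases "A = 0")
    case True
    show ?thesis unfolding True divergence_zero by (rule tendsto_const)
  next
    case False
    show ?thesis unfolding levy_reg_divergence(1)[OF r] levy_reg_divergence(1)[OF rn]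
      by (intro tendsto_sum tendsto_mult_left tendsto_vec_nth lim(3)[OF False])
  qed
  show "(\<lambda>n. LINT z|\<mu>. levy_integrand (\<phi>n n) (X n) z) \<longlonglongrightarrow> (LINT z|\<mu>. levy_integrand \<phi> x z)"
  proof (rule integral_dominated_convergence[where w = "\<lambda>z. 2 * C * min 1 (norm z powr (1 + \<theta>))"])
    show "AE z in \<mu>. (\<lambda>n. levy_integrand (\<phi>n n) (X n) z) \<longlonglongrightarrow> levy_integrand \<phi> x z"
      unfolding levy_integrand_def levy_regD(8)[OF r] levy_regD(8)[OF rn]
      using lim(1)[of 0] by (intro AE_I2 tendsto_diff tendsto_mult_left tendsto_inner lim tendsto_const) simp
    show "AE z in \<mu>. norm (levy_integrand (\<phi>n n) (X n) z) \<le> 2 * C * min 1 (norm z powr (1 + \<theta>))" for n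
      using levy_integrand_bound[OF rn th] by simp
  qed (use levy_integrand_measurable[OF r] levy_integrand_measurable[OF rn] mu in auto)
qed

text \<open>With \<open>\<Delta>g = g (x + z) - g x\<close> and the Taylor remainder \<open>R g = \<Delta>g - Dg x \<bullet> z\<close>, the product with the cutoff
  \<open>\<chi>\<close> satisfies \<open>R (\<phi> \<chi>) = \<chi> (R \<phi>) + \<phi> (R \<chi>) + \<Delta>\<phi> \<Delta>\<chi>\<close>.\<close>

lemma levy_reg_cut:
  assumes r: "levy_reg \<theta> C \<phi> V W" and th: "0 < \<theta>" "\<theta> \<le> 1"
  defines "C' \<equiv> C * (5 + real CARD('n) * 2)"
  defines "F n x \<equiv> \<phi> x * cut n x" and "V' n x \<equiv> \<phi> x *\<^sub>R cut' n x + cut n x *\<^sub>R V x"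
    and "W' n i x \<equiv> (\<phi> x *\<^sub>R cut'' n i x + cut' n x $ i *\<^sub>R V x) + (cut n x *\<^sub>R W i x + V x $ i *\<^sub>R cut' n x)"
  shows "levy_reg \<theta> C' (F n) (V' n) (W' n)"
proof -
  note D = levy_regD[OF r]
  have C: "0 \<le> C" by (rule D)
  \<comment> \<open>The second derivatives of the product need 2 + 1 + 1 + 1 = 5 copies of
    \<open>C\<close>; the summand with CARD pays for \<open>cut_taylor\<close>.\<close>
  have C': "k * C \<le> C'" if "k \<le> 5" for k
    unfolding C'_def mult.commute[of k] by (rule mult_left_mono[OF _ C]) (use that in simp)
  have n1: "norm (cut' n x) \<le> 1" for x :: "real^'n" using norm_cut'[of n x] shrink_le1[of n] by simp
  have n2: "norm (cut'' n i x) \<le> 2" for i and x :: "real^'n" using norm_cut''[of n i x] shrink_le1[of n] by simp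
  have p: "\<bar>a * b\<bar> \<le> x * y" if "\<bar>a\<bar> \<le> x" "\<bar>b\<bar> \<le> y" for a b x y :: real
    unfolding abs_mult by (rule mult_mono[OF that]) (use that in \<open>auto intro: order_trans[OF abs_ge_zero]\<close>)
  have s: "norm (a *\<^sub>R b) \<le> x * y" if "\<bar>a\<bar> \<le> x" "norm b \<le> y" for a x y :: real and b :: "real^'n"
    unfolding norm_scaleR by (rule mult_mono[OF that]) (use that in \<open>auto intro: order_trans[OF abs_ge_zero]\<close>)
  show ?thesis unfolding levy_reg_def
  proof (intro conjI allI)
    show "0 \<le> C'" using C'[of 0] by simp
    show "GDERIV (F n) x :> V' n x" for x unfolding F_def V'_def by (rule GDERIV_mult[OF D(2) gderiv_cut])
    show "\<bar>F n x\<bar> \<le> C'" for x using p[OF D(3)[of x] cut_abs[of n x]] C'[of 1] unfolding F_def by simp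
    show "norm (V' n x) \<le> C'" for x
      using norm_triangle_ineq[of "\<phi> x *\<^sub>R cut' n x" "cut n x *\<^sub>R V x"] s[OF D(3)[of x] n1[of x]] s[OF cut_abs[of n x] D(4)[of x]] C'[of 2]
      unfolding V'_def by simp
    show "norm z < 1 \<longrightarrow> \<bar>F n (x + z) - F n x - V' n x \<bullet> z\<bar> \<le> C' * norm z powr (1 + \<theta>)" for x z
    proof
      assume z: "norm z < 1"
      let ?N = "norm z powr (1 + \<theta>)"
      \<comment> \<open>The remainder of the cutoff is quadratic and fits the order 1 + \<theta>
        because |z| < 1 and \<theta> is at most 1.\<close>
      have zz: "(norm z)\<^sup>2 \<le> ?N"
      proof (cases "z = 0")
        case False
        then have "(norm z)\<^sup>2 = norm z powr 2" by simp
        also have "\<dots> \<le> ?N" using z th False by (intro powr_mono') auto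
        finally show ?thesis .
      qed simp
      have d1: "\<bar>\<phi> (x + z) - \<phi> x\<bar> \<le> C * norm z" using gderiv_bound[OF D(2) D(4), of "x + z" x] by simp
      have d2: "\<bar>cut n (x + z) - cut n x\<bar> \<le> 1 * norm z" using gderiv_bound[OF gderiv_cut n1, of "x + z" x] by simp
      have "F n (x + z) - F n x - V' n x \<bullet> z = cut n x * (\<phi> (x + z) - \<phi> x - V x \<bullet> z) 
        + \<phi> x * (cut n (x + z) - cut n x - cut' n x \<bullet> z) + (\<phi> (x + z) - \<phi> x) * (cut n (x + z) - cut n x)"
        unfolding F_def V'_def by (simp add: algebra_simps inner_add_left)
      also have "\<bar>\<dots>\<bar> \<le> 1 * (C * ?N) + C * (real CARD('n) * 2 * (norm z)\<^sup>2) + (C * norm z) * (1 * norm z)"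
        by (rule abs_add3_le[OF p[OF cut_abs D(5)[OF z]] p[OF D(3) cut_taylor] p[OF d1 d2]])
      also have "\<dots> \<le> C * ?N + C * (real CARD('n) * 2 * ?N) + C * ?N"
      proof -
        have "C * (real CARD('n) * 2 * (norm z)\<^sup>2) \<le> C * (real CARD('n) * 2 * ?N)"
          by (intro mult_left_mono zz C) simp
        moreover have "(C * norm z) * (1 * norm z) \<le> C * ?N"
          using mult_left_mono[OF zz C] by (simp add: power2_eq_square)
        ultimately show ?thesis by simp
      qed
      also have "\<dots> \<le> C' * ?N" unfolding C'_def using C by (simp add: algebra_simps)
      finally show "\<bar>F n (x + z) - F n x - V' n x \<bullet> z\<bar> \<le> C' * ?N" .
    qed
    show "A = 0 \<or> (\<forall>i x. GDERIV (\<lambda>y. V' n y $ i) x :> W' n i x \<and> norm (W' n i x) \<le> C')"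
    proof (cases "A = 0")
      case False
      have "GDERIV (\<lambda>y. V' n y $ i) x :> W' n i x" for i x
        unfolding V'_def W'_def vector_add_component vector_scaleR_component real_scaleR_def
        by (rule GDERIV_add[OF GDERIV_mult[OF D(2) gderiv_cut'] GDERIV_mult[OF gderiv_cut D(6)[OF False]]])
      moreover have "norm (W' n i x) \<le> C'" for i x
      proof -
        have c: "\<bar>cut' n x $ i\<bar> \<le> 1" "\<bar>V x $ i\<bar> \<le> C"
          using component_le_norm_cart[of "cut' n x" i] n1[of x] component_le_norm_cart[of "V x" i] D(4)[of x] by linarith+
        have "norm (W' n i x) \<le> (C * 2 + 1 * C) + (1 * C + C * 1)" unfolding W'_def
          by (intro order_trans[OF norm_triangle_ineq] add_mono s D(3) n2 c D(4) cut_abs D(7)[OF False] n1)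
        then show ?thesis using C'[of 5] by simp
      qed
      ultimately show ?thesis by blast
    qed simp
  qed
qed

text \<open>Each condition is linear and translation invariant, so averaging over a probability
  measure keeps the constant.\<close>

lemma levy_reg_moll:
  assumes r: "levy_reg \<theta> C \<phi> V W"
  shows "levy_reg \<theta> C (moll n \<phi>) (moll n V) (\<lambda>i. moll n (W i))"
proof -
  note D = levy_regD[OF r]
  interpret prob_space "gauss :: (real^'n) measure" by (rule prob_space_gauss)
  note g = moll_gderiv[OF D(2,3,4)]
  have i\<phi>: "integrable gauss (\<lambda>z. \<phi> (x - shrink n *\<^sub>R z))" for x n by (rule moll_integrable[OF D(9)]) (use D(3) in simp)
  show ?thesis unfolding levy_reg_def
  proof (intro conjI allI)
    show "0 \<le> C" by (rule D)
    show "GDERIV (moll n \<phi>) x :> moll n V x" for x by (rule g)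
    show "\<bar>moll n \<phi> x\<bar> \<le> C" for x using moll_bound[of \<phi> C n x] D(3) by simp
    show "norm (moll n V x) \<le> C" for x by (rule moll_bound[OF D(4)])
    show "norm z < 1 \<longrightarrow> \<bar>moll n \<phi> (x + z) - moll n \<phi> x - moll n V x \<bullet> z\<bar> \<le> C * norm z powr (1 + \<theta>)" for x z
    proof
      assume z: "norm z < 1"
      have "moll n \<phi> (x + z) - moll n \<phi> x - moll n V x \<bullet> z = 
        (\<integral>y. \<phi> ((x - shrink n *\<^sub>R y) + z) - \<phi> (x - shrink n *\<^sub>R y) - V (x - shrink n *\<^sub>R y) \<bullet> z \<partial>gauss)"
        unfolding moll_def using i\<phi>[of x n] i\<phi>[of "x + z" n] g(2)[of x n]
        by (simp add: algebra_simps)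
      moreover have "norm (\<integral>y. \<phi> ((x - shrink n *\<^sub>R y) + z) - \<phi> (x - shrink n *\<^sub>R y) - V (x - shrink n *\<^sub>R y) \<bullet> z \<partial>gauss) \<le> C * norm z powr (1 + \<theta>)"
        by (rule norm_integral_le_prob[OF prob_space_gauss]) (use D(5)[OF z] D(1) in auto)
      ultimately show "\<bar>moll n \<phi> (x + z) - moll n \<phi> x - moll n V x \<bullet> z\<bar> \<le> C * norm z powr (1 + \<theta>)" by simp
    qed
    show "A = 0 \<or> (\<forall>i x. GDERIV (\<lambda>y. moll n V y $ i) x :> moll n (W i) x \<and> norm (moll n (W i) x) \<le> C)"
    proof (cases "A = 0")
      case False
      have b: "\<bar>V x $ i\<bar> \<le> C" for x i using component_le_norm_cart[of "V x" i] D(4)[of x] by linarith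
      have e: "(\<lambda>y. moll n V y $ i) = moll n (\<lambda>y. V y $ i)" for i
        unfolding moll_def using integral_vec_nth[OF g(2)] by auto
      have "GDERIV (\<lambda>y. moll n V y $ i) x :> moll n (W i) x" for i x
        unfolding e by (rule moll_gderiv[OF D(6)[OF False] b D(7)[OF False]])
      moreover have "norm (moll n (W i) x) \<le> C" for i x by (rule moll_bound) (rule D(7)[OF False])
      ultimately show ?thesis by blast
    qed simp
  qed
qed

end

subsection \<open>Semigroup property and the Dynkin formula\<close>

text \<open>The bound is explicit since limits and moduli in time must be uniform over families with
  the same bound.\<close>

definition bc :: "real \<Rightarrow> ('a::topological_space \<Rightarrow> real) \<Rightarrow> bool" where
  "bc C \<phi> \<longleftrightarrow> continuous_on UNIV \<phi> \<and> (\<forall>x. \<bar>\<phi> x\<bar> \<le> C)"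

lemma bcD: "bc C \<phi> \<Longrightarrow> continuous_on UNIV \<phi>" "bc C \<phi> \<Longrightarrow> \<bar>\<phi> x\<bar> \<le> C"
  by (auto simp: bc_def)

lemma bc_borel: "bc C \<phi> \<Longrightarrow> \<phi> \<in> borel_measurable borel"
  by (intro borel_measurable_continuous_onI bcD)

lemma bc_nonneg: "bc C \<phi> \<Longrightarrow> 0 \<le> C"
  unfolding bc_def by (meson abs_ge_zero order_trans)

lemma bc_tendsto: "bc C \<phi> \<Longrightarrow> X \<longlonglongrightarrow> x \<Longrightarrow> (\<lambda>n. \<phi> (X n)) \<longlonglongrightarrow> \<phi> x"
  using continuous_on_tendsto_compose[of UNIV \<phi> X x] bcD(1) by auto

lemma fourier_int_borel:
  fixes c :: "real^'n \<Rightarrow> complex"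
  assumes "sigma_finite_measure M" "sets M = sets borel" "integrable M c"
  shows "fourier_int M c \<in> borel_measurable borel"
proof -
  interpret sigma_finite_measure M by fact
  note [measurable_cong] = assms(2) and [measurable] = borel_measurable_integrable[OF assms(3)]
  show ?thesis unfolding fourier_int_def[abs_def] by measurable
qed

context levy_heat
begin

lemma P_integrable:
  fixes \<phi> :: "real^'n \<Rightarrow> real"
  assumes "0 < t" "\<phi> \<in> borel_measurable borel" "\<And>x. \<bar>\<phi> x\<bar> \<le> C"
  shows "integrable (Q t) (\<lambda>y. \<phi> (x - y))"
proof -
  interpret prob_space "Q t" by (rule prob_Q[OF assms(1)])
  note [measurable] = assms(2)
  show ?thesis by (rule integrable_const_bound[of _ C]) (use assms(3) in auto)
qed

lemma P_tendsto:
  assumes t: "0 < t" and m: "\<And>n. \<phi>n n \<in> borel_measurable borel" and bd: "\<And>n x. \<bar>\<phi>n n x\<bar> \<le> C"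
    and lim: "\<And>y. (\<lambda>n. \<phi>n n (X n - y)) \<longlonglongrightarrow> \<phi> (x - y)"
  shows "(\<lambda>n. P t (\<phi>n n) (X n)) \<longlonglongrightarrow> P t \<phi> x"
proof -
  interpret prob_space "Q t" by (rule prob_Q[OF t])
  show ?thesis unfolding P_def
    by (rule tendsto_lebesgue_integral_bounded(1)[where C = C])
      (use finite_measure_axioms lim bd borel_measurable_integrable[OF P_integrable[OF t m bd]] in auto)
qed

lemma P_bound: "0 < t \<Longrightarrow> (\<And>x. \<bar>\<phi> x\<bar> \<le> C) \<Longrightarrow> \<bar>P t \<phi> x\<bar> \<le> C"
  unfolding P_def using norm_integral_le_prob[OF prob_Q, of t "\<lambda>y. \<phi> (x - y)" C]
  by (metis abs_ge_zero order_trans real_norm_def)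

lemma P_bc:
  assumes "0 < t" "bc C \<phi>" shows "bc C (P t \<phi>)"
  unfolding bc_def
proof
  show "continuous_on UNIV (P t \<phi>)"
    unfolding continuous_on_sequentially comp_def
  proof (intro allI impI ballI)
    fix X and x :: "real^'n" assume "(\<forall>n. X n \<in> UNIV) \<and> X \<longlonglongrightarrow> x"
    then have l: "(\<lambda>n. X n - y) \<longlonglongrightarrow> x - y" for y by (intro tendsto_diff) auto
    show "(\<lambda>n. P t \<phi> (X n)) \<longlonglongrightarrow> P t \<phi> x"
      by (rule P_tendsto[OF assms(1) bc_borel[OF assms(2)] bcD(2)[OF assms(2)] bc_tendsto[OF assms(2) l]])
  qed
  show "\<forall>x. \<bar>P t \<phi> x\<bar> \<le> C" by (intro allI P_bound assms(1) bcD(2)[OF assms(2)])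
qed

lemma P_diff:
  assumes "0 < t" "\<phi> \<in> borel_measurable borel" "\<And>x. \<bar>\<phi> x\<bar> \<le> C" "\<eta> \<in> borel_measurable borel" "\<And>x. \<bar>\<eta> x\<bar> \<le> C'"
  shows "P t \<phi> x - P t \<eta> x = P t (\<lambda>y. \<phi> y - \<eta> y) x"
  unfolding P_def using P_integrable[OF assms(1-3)] P_integrable[OF assms(1,4,5)] by simp

lemma P_diff_bound:
  assumes "0 < t" "bc C \<phi>" "bc C' \<eta>" "\<And>x. \<bar>\<phi> x - \<eta> x\<bar> \<le> d"
  shows "\<bar>P t \<phi> x - P t \<eta> x\<bar> \<le> d"
  unfolding P_diff[OF assms(1) bc_borel[OF assms(2)] bcD(2)[OF assms(2)] bc_borel[OF assms(3)] bcD(2)[OF assms(3)]]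
  by (rule P_bound[OF assms(1,4)])

lemma P_shift: "P t \<phi> (x + h) = P t (\<lambda>y. \<phi> (y + h)) x"
  by (simp add: P_def algebra_simps)

lemma bc_shift: "bc C \<phi> \<Longrightarrow> bc C (\<lambda>y. \<phi> (y + (h::'a::real_normed_vector)))"
  unfolding bc_def by (auto intro!: continuous_on_compose2[of UNIV \<phi>] continuous_intros)

text \<open>Convolution commutes with translations and contracts the sup norm.\<close>

lemma P_lipschitz:
  assumes "0 < t" "bc C \<phi>" "\<And>x y. \<bar>\<phi> x - \<phi> y\<bar> \<le> K * norm (x - y)"
  shows "\<bar>P t \<phi> x - P t \<phi> y\<bar> \<le> K * norm (x - y)"
proof -
  have "\<bar>P t (\<lambda>w. \<phi> (w + (x - y))) y - P t \<phi> y\<bar> \<le> K * norm (x - y)"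
    by (rule P_diff_bound[OF assms(1) bc_shift[OF assms(2)] assms(2)]) (use assms(3)[of "w + (x - y)" w for w] in simp)
  then show ?thesis using P_shift[of t \<phi> y "x - y"] by simp
qed

lemma P_gderiv:
  assumes t: "0 < t" and \<phi>: "bc C \<phi>" and der: "\<And>x. GDERIV \<phi> x :> V x" and V: "\<And>x. norm (V x) \<le> C'"
  shows "GDERIV (P t \<phi>) x :> (\<chi> i. P t (\<lambda>y. V y $ i) x)"
proof -
  interpret prob_space "Q t" by (rule prob_Q[OF t])
  have k: "integrable (Q t) (\<lambda>_. C')" by simp
  note g = gderiv_lebesgue_integral[OF P_integrable[OF t bc_borel[OF \<phi>] bcD(2)[OF \<phi>]] gderiv_compose_affine[OF der] V k]
  have "(\<integral>y. V (x - y) \<partial>Q t) = (\<chi> i. P t (\<lambda>y. V y $ i) x)"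
    using integral_vec_nth[OF g(1)] by (simp add: vec_eq_iff P_def)
  then show ?thesis using g(2)[of x] unfolding P_def[abs_def] by simp
qed

lemma approx_fourier:
  assumes \<phi>: "bc C \<phi>"
  obtains M :: "(real^'n) measure" and c where "sigma_finite_measure M" "sets M = sets borel" "integrable M c"
    "integrable M (\<lambda>\<xi>. (norm \<xi>)\<^sup>2 * norm (c \<xi>))" "moll n (\<lambda>x. \<phi> x * cut n x) = fourier_int M c"
  using moll_fourier[OF cut_integrable[OF bcD[OF \<phi>]]] by blast

lemma approx_props:
  assumes \<phi>: "bc C (\<phi> :: real^'n \<Rightarrow> real)"
  shows "\<bar>moll n (\<lambda>x. \<phi> x * cut n x) x\<bar> \<le> C" "(\<lambda>n. moll n (\<lambda>x. \<phi> x * cut n x) x) \<longlonglongrightarrow> \<phi> x"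
    "moll n (\<lambda>x. \<phi> x * cut n x) \<in> borel_measurable borel"
proof -
  have b: "norm (\<phi> x * cut n x) \<le> C" for x n
    using mult_mono[OF bcD(2)[OF \<phi>, of x] cut_abs[of n x]] bc_nonneg[OF \<phi>] by (simp add: abs_mult)
  have c: "continuous_on UNIV (\<lambda>x. \<phi> x * cut n x)" for n by (intro continuous_on_mult bcD(1)[OF \<phi>] continuous_cut)
  show "\<bar>moll n (\<lambda>x. \<phi> x * cut n x) x\<bar> \<le> C" using moll_bound[OF b] by simp
  show "(\<lambda>n. moll n (\<lambda>x. \<phi> x * cut n x) x) \<longlonglongrightarrow> \<phi> x"
  proof (rule moll_tendsto[OF c b])
    fix X assume "X \<longlonglongrightarrow> x"
    from tendsto_mult[OF bc_tendsto[OF \<phi> this] cut_tendsto[OF this]]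
    show "(\<lambda>n. \<phi> (X n) * cut n (X n)) \<longlonglongrightarrow> \<phi> x" by simp
  qed
  obtain M c where "sigma_finite_measure M" "sets M = sets (borel :: (real^'n) measure)" "integrable M c" 
    "moll n (\<lambda>x. \<phi> x * cut n x) = fourier_int M c" using approx_fourier[OF \<phi>] by blast
  then show "moll n (\<lambda>x. \<phi> x * cut n x) \<in> borel_measurable borel" using fourier_int_borel by metis
qed

lemma P_borel:
  assumes t: "0 < t" and [measurable]: "\<phi> \<in> borel_measurable borel"
  shows "P t \<phi> \<in> borel_measurable borel"
proof -
  interpret prob_space "Q t" by (rule prob_Q[OF t])
  show ?thesis unfolding P_def[abs_def] by measurable
qed

text \<open>For Fourier integrals the exponentials multiply; the truncated mollifications converge
  pointwise within the bound \<open>C\<close>, which survives both applications of P.\<close>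

lemma P_semigroup:
  assumes t: "0 < t" and s: "0 < s" and \<phi>: "bc C \<phi>"
  shows "P t (P s \<phi>) x = P (t + s) \<phi> x"
proof -
  let ?\<phi> = "\<lambda>n. moll n (\<lambda>x. \<phi> x * cut n x)"
  note a = approx_props[OF \<phi>]
  have "P t (P s (?\<phi> n)) x = P (t + s) (?\<phi> n) x" for n
  proof -
    obtain M c where "sigma_finite_measure M" "sets M = sets (borel :: (real^'n) measure)" "integrable M c" 
      "moll n (\<lambda>x. \<phi> x * cut n x) = fourier_int M c" using approx_fourier[OF \<phi>] by blast
    then show ?thesis using P_fourier_semigroup[OF t s] by metis
  qed
  moreover have "(\<lambda>n. P (t + s) (?\<phi> n) x) \<longlonglongrightarrow> P (t + s) \<phi> x"
    by (rule P_tendsto[OF _ a(3,1,2)]) (use t s in simp)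
  moreover have "(\<lambda>n. P t (P s (?\<phi> n)) x) \<longlonglongrightarrow> P t (P s \<phi>) x"
    by (intro P_tendsto[where C = C] P_bound P_borel t s a)
  ultimately show ?thesis using LIMSEQ_unique by fastforce
qed

text \<open>Limit of \<open>dynkin_fourier\<close> along truncated mollifications of \<open>\<phi>\<close>, whose images under the Levy operator are
  uniformly bounded.\<close>

lemma dynkin:
  assumes r: "levy_reg \<theta> C \<phi> V W" and th: "0 < \<theta>" "\<theta> \<le> 1" and mu: "integrable \<mu> (\<lambda>z. min 1 (norm z powr (1 + \<theta>)))"
    and V: "continuous_on UNIV V" and W: "\<And>i. A \<noteq> 0 \<Longrightarrow> continuous_on UNIV (W i)" and h: "0 < h"
  shows "levy_operator A \<mu> \<phi> \<in> borel_measurable borel"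
    and "integrable (itv 0 h) (\<lambda>r. P r (levy_operator A \<mu> \<phi>) x)"
    and "P h \<phi> x - \<phi> x = (\<integral>r. P r (levy_operator A \<mu> \<phi>) x \<partial>itv 0 h)"
proof -
  note D = levy_regD[OF r]
  have bc: "bc C \<phi>" using D(3,9) by (simp add: bc_def)
  define C' where "C' = C * (5 + real CARD('n) * 2)"
  define F where "F n x = \<phi> x * cut n x" for n x
  define V' where "V' n x = \<phi> x *\<^sub>R cut' n x + cut n x *\<^sub>R V x" for n x
  define W' where "W' n i x = (\<phi> x *\<^sub>R cut'' n i x + cut' n x $ i *\<^sub>R V x) + (cut n x *\<^sub>R W i x + V x $ i *\<^sub>R cut' n x)" for n i x
  have rc: "levy_reg \<theta> C' (F n) (V' n) (W' n)" for n
    unfolding C'_def F_def[abs_def] V'_def[abs_def] W'_def[abs_def] by (rule levy_reg_cut[OF r th])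
  have rn: "levy_reg \<theta> C' (moll n (F n)) (moll n (V' n)) (\<lambda>i. moll n (W' n i))" for n
    by (rule levy_reg_moll[OF rc])
  note Dn = levy_regD[OF rn]
  have c'': "continuous_on UNIV (cut' n :: real^'n \<Rightarrow> _)" for n unfolding cut'_def[abs_def]
    by (intro continuous_intros continuous_on_compose2[OF continuous_on_chi[of UNIV]]) auto
  have c3: "continuous_on UNIV (cut'' n i :: real^'n \<Rightarrow> _)" for n i unfolding cut''_def[abs_def]
    by (intro continuous_intros continuous_on_compose2[OF continuous_on_chi[of UNIV]]) auto
  have c: "continuous_on UNIV (F n)" "continuous_on UNIV (V' n)" "A \<noteq> 0 \<Longrightarrow> continuous_on UNIV (W' n i)" for n i
    unfolding F_def[abs_def] V'_def[abs_def] W'_def[abs_def]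
    by (intro continuous_intros D(9) continuous_cut c'' c3 V W; simp)+
  have vt: "(\<lambda>n. V (X n)) \<longlonglongrightarrow> V x" if "X \<longlonglongrightarrow> x" for X x
    using continuous_on_tendsto_compose[OF V that] by simp
  have lF: "(\<lambda>n. moll n (F n) x) \<longlonglongrightarrow> \<phi> x" for x using approx_props(2)[OF bc] by (simp add: F_def[abs_def])
  have lV: "(\<lambda>n. moll n (V' n) x) \<longlonglongrightarrow> V x" for x
  proof (rule moll_tendsto[OF c(2) levy_regD(4)[OF rc]])
    fix X assume X: "X \<longlonglongrightarrow> x"
    have "(\<lambda>n. V' n (X n)) \<longlonglongrightarrow> \<phi> x *\<^sub>R 0 + 1 *\<^sub>R V x" unfolding V'_def
      by (intro tendsto_add tendsto_scaleR bc_tendsto[OF bc X] cut'_tendsto cut_tendsto[OF X] vt[OF X])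
    then show "(\<lambda>n. V' n (X n)) \<longlonglongrightarrow> V x" by simp
  qed
  have lW: "(\<lambda>n. moll n (W' n i) x) \<longlonglongrightarrow> W i x" if A: "A \<noteq> 0" for x i
  proof (rule moll_tendsto[OF c(3)[OF A] levy_regD(7)[OF rc A]])
    fix X assume X: "X \<longlonglongrightarrow> x"
    have "(\<lambda>n. W i (X n)) \<longlonglongrightarrow> W i x" using continuous_on_tendsto_compose[OF W[OF A] X] by simp
    then have "(\<lambda>n. W' n i (X n)) \<longlonglongrightarrow> (\<phi> x *\<^sub>R 0 + 0 $ i *\<^sub>R V x) + (1 *\<^sub>R W i x + V x $ i *\<^sub>R 0)" unfolding W'_def
      by (intro tendsto_add tendsto_scaleR bc_tendsto[OF bc X] cut'_tendsto cut_tendsto[OF X] cut''_tendsto vt[OF X] tendsto_vec_nth)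
    then show "(\<lambda>n. W' n i (X n)) \<longlonglongrightarrow> W i x" by simp
  qed
  let ?L = "\<lambda>n. levy_operator A \<mu> (moll n (F n))"
  have lL: "(\<lambda>n. ?L n x) \<longlonglongrightarrow> levy_operator A \<mu> \<phi> x" for x
    by (rule levy_operator_tendsto[OF rn r th(1) mu, where X = "\<lambda>_. x"]) (use lF lV lW in auto)
  define K where "K = C' * ((\<Sum>i\<in>UNIV. \<Sum>j\<in>UNIV. \<bar>A $ i $ j\<bar>) + 2 * mu_moment \<theta>)"
  have bL: "\<bar>?L n x\<bar> \<le> K" for n x unfolding K_def by (rule levy_operator_bound[OF rn th(1) mu])
  have fn: "?L n \<in> borel_measurable borel \<and> integrable (itv 0 h) (\<lambda>r. P r (?L n) x) \<and> 
    P h (moll n (F n)) x - moll n (F n) x = (\<integral>r. P r (?L n) x \<partial>itv 0 h)" for n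
  proof -
    obtain M c where m: "sigma_finite_measure M" "sets M = sets (borel :: (real^'n) measure)" "integrable M c" 
      "integrable M (\<lambda>\<xi>. (norm \<xi>)\<^sup>2 * norm (c \<xi>))" and e: "moll n (F n) = fourier_int M c" 
      using approx_fourier[OF bc, of n] unfolding F_def[abs_def] by blast
    have "?L n = fourier_int M (\<lambda>\<xi>. - \<psi> \<xi> * c \<xi>)" unfolding e by (rule ext) (rule levy_operator_fourier[OF m])
    then have "?L n \<in> borel_measurable borel" using fourier_int_borel[OF m(1,2) psi_c_integrable[OF m(2-4)]] by simp
    then show ?thesis unfolding e using dynkin_fourier[OF m h] by blast
  qed
  \<comment> \<open>Measurability of the image comes from the approximation: it is a pointwise limit
    of Fourier integrals.\<close>
  show LB: "levy_operator A \<mu> \<phi> \<in> borel_measurable borel"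
    by (rule borel_measurable_LIMSEQ_real[OF lL]) (use fn in blast)
  have lP: "(\<lambda>n. P r (?L n) x) \<longlonglongrightarrow> P r (levy_operator A \<mu> \<phi>) x" if "0 < r" for r
    by (rule P_tendsto[OF that]) (use fn bL lL in auto)
  have l: "(\<lambda>n. \<integral>r. P r (?L n) x \<partial>itv 0 h) \<longlonglongrightarrow> (\<integral>r. P r (levy_operator A \<mu> \<phi>) x \<partial>itv 0 h)"
    and i: "integrable (itv 0 h) (\<lambda>r. P r (levy_operator A \<mu> \<phi>) x)"
    using tendsto_lebesgue_integral_bounded[OF finite_itv, of "\<lambda>n r. P r (?L n) x" 0 h "\<lambda>r. P r (levy_operator A \<mu> \<phi>) x" K]
      fn lP P_bound[OF _ bL] by auto
  show "integrable (itv 0 h) (\<lambda>r. P r (levy_operator A \<mu> \<phi>) x)" by (rule i)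
  have "(\<lambda>n. P h (moll n (F n)) x - moll n (F n) x) \<longlonglongrightarrow> P h \<phi> x - \<phi> x"
    by (intro tendsto_diff lF P_tendsto[OF h]) (use approx_props[OF bc] lF in \<open>auto simp: F_def[abs_def]\<close>)
  then have "(\<lambda>n. \<integral>r. P r (?L n) x \<partial>itv 0 h) \<longlonglongrightarrow> P h \<phi> x - \<phi> x" using fn by simp
  then show "P h \<phi> x - \<phi> x = (\<integral>r. P r (levy_operator A \<mu> \<phi>) x \<partial>itv 0 h)"
    by (rule LIMSEQ_unique[OF _ l])
qed

text \<open>By \<open>gauss_char\<close> the integral equals a Gaussian average of exp (-h \<psi>),
  and dominated convergence applies. As chi is 1 only at the origin, this encodes concentration of
  the kernel there.\<close>

lemma Q_chi_tendsto: "((\<lambda>h. \<integral>y. chi y \<partial>Q h) \<longlongrightarrow> 1) (at_right 0)"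
  unfolding tendsto_at_iff_sequentially comp_def
proof (intro allI impI)
  fix X assume X: "\<forall>i. X i \<in> {0<..} - {0::real}" "X \<longlonglongrightarrow> 0"
  interpret prob_space "gauss :: (real^'n) measure" by (rule prob_space_gauss)
  have 1: "integrable (gauss :: (real^'n) measure) (\<lambda>_. 1::complex)" by simp
  have "chi = fourier_int gauss (\<lambda>_::real^'n. 1)" by (rule ext) (simp add: fourier_int_def gauss_char)
  then have "P t chi 0 = fourier_int gauss (\<lambda>\<xi>. 1 * exp (- (complex_of_real t * \<psi> \<xi>))) 0" if "0 < t" for t
    using P_fourier[OF that sigma_finite_measure_axioms _ 1, of 0] by simp
  then have e: "(\<integral>y. chi y \<partial>Q t) = Re (\<integral>\<xi>. exp (- (complex_of_real t * \<psi> \<xi>)) \<partial>gauss)" if "0 < t" for t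
    using that by (simp add: P_def fourier_int_def chi_def)
  have "(\<lambda>n. \<integral>\<xi>. exp (- (complex_of_real (X n) * \<psi> \<xi>)) \<partial>gauss) \<longlonglongrightarrow> (\<integral>\<xi>. 1 \<partial>(gauss :: (real^'n) measure))"
  proof (rule tendsto_lebesgue_integral_bounded(1)[where C = 1])
    show "(\<lambda>n. exp (- (complex_of_real (X n) * \<psi> \<xi>))) \<longlonglongrightarrow> 1" for \<xi>
    proof -
      have "(\<lambda>n. exp (- (complex_of_real (X n) * \<psi> \<xi>))) \<longlonglongrightarrow> exp (- (complex_of_real 0 * \<psi> \<xi>))"
        by (intro tendsto_intros X)
      then show ?thesis by simp
    qed
    show "norm (exp (- (complex_of_real (X n) * \<psi> \<xi>))) \<le> 1" for n \<xi> using X(1) by (intro norm_exp_psi) (simp add: less_imp_le)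
  qed (use finite_measure_axioms in auto)
  then have "(\<lambda>n. Re (\<integral>\<xi>. exp (- (complex_of_real (X n) * \<psi> \<xi>)) \<partial>gauss)) \<longlonglongrightarrow> Re 1"
    using prob_space by (intro tendsto_Re) simp
  then show "(\<lambda>n. \<integral>y. chi y \<partial>Q (X n)) \<longlonglongrightarrow> 1" using e X(1) by simp
qed

text \<open>Split at |y| = \<rho>. Near the origin the oscillation is at most e; far from it, 1 -
  chi y is at least the denominator, so a Chebyshev estimate applies.\<close>

lemma P_near:
  assumes h: "0 < h" and \<rho>: "0 < \<rho>" and m: "\<phi> \<in> borel_measurable borel" and B: "\<And>y. \<bar>\<phi> y - c\<bar> \<le> B"
    and e: "\<And>y. norm (y - x) < \<rho> \<Longrightarrow> \<bar>\<phi> y - c\<bar> \<le> e" and "0 \<le> e"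
  shows "\<bar>P h \<phi> x - c\<bar> \<le> e + B * (1 - (\<integral>y. chi y \<partial>Q h)) / (1 - exp (- \<rho>\<^sup>2 / 2))"
proof -
  interpret prob_space "Q h" by (rule prob_Q[OF h])
  define \<eta> where "\<eta> = 1 - exp (- \<rho>\<^sup>2 / 2)"
  have \<eta>: "0 < \<eta>" unfolding \<eta>_def using \<rho> by simp
  have B0: "0 \<le> B" using B[of 0] by linarith
  have ci: "integrable (Q h) chi" by (rule integrable_const_bound[of _ 1]) (auto simp: chi_le1 chi_pos[THEN less_imp_le])
  have i: "integrable (Q h) (\<lambda>y. \<phi> (x - y))"
  proof (rule P_integrable[OF h m])
    show "\<bar>\<phi> y\<bar> \<le> B + \<bar>c\<bar>" for y using B[of y] by linarith
  qed
  have "P h \<phi> x - c = (\<integral>y. \<phi> (x - y) - c \<partial>Q h)" unfolding P_def using i prob_space by simp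
  also have "\<bar>\<dots>\<bar> \<le> (\<integral>y. norm (\<phi> (x - y) - c) \<partial>Q h)" using integral_norm_bound[of "Q h" "\<lambda>y. \<phi> (x - y) - c"] by simp
  also have "\<dots> \<le> (\<integral>y. e + B * (1 - chi y) / \<eta> \<partial>Q h)"
  proof (rule integral_mono)
    fix y :: "real^'n"
    show "norm (\<phi> (x - y) - c) \<le> e + B * (1 - chi y) / \<eta>"
    proof (cases "norm y < \<rho>")
      case True
      have "0 \<le> B * (1 - chi y) / \<eta>" using B0 \<eta> chi_le1[of y] by simp
      then show ?thesis using e[of "x - y"] True by simp
    next
      case False
      then have "\<rho>\<^sup>2 \<le> (norm y)\<^sup>2" using \<rho> by (intro power_mono) auto
      then have "\<eta> \<le> 1 - chi y" by (simp add: \<eta>_def chi_def)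
      then have "1 \<le> (1 - chi y) / \<eta>" using \<eta> by simp
      from mult_left_mono[OF this B0] show ?thesis using B[of "x - y"] assms(6) by simp
    qed
  qed (use i ci in auto)
  also have "\<dots> = e + B * (1 - (\<integral>y. chi y \<partial>Q h)) / \<eta>" using ci prob_space by simp
  finally show ?thesis unfolding \<eta>_def .
qed

text \<open>The point is the order of quantifiers: d depends on e, \<rho>, B alone and serves all
  \<phi>, x and c at once.\<close>

lemma P_approx:
  assumes "0 < e" "0 < \<rho>" "0 \<le> B"
  obtains d where "0 < d" "\<And>h \<phi> x c. 0 < h \<Longrightarrow> h < d \<Longrightarrow> \<phi> \<in> borel_measurable borel \<Longrightarrow> (\<And>y. \<bar>\<phi> y - c\<bar> \<le> B)
    \<Longrightarrow> (\<And>y. norm (y - x) < \<rho> \<Longrightarrow> \<bar>\<phi> y - c\<bar> \<le> e) \<Longrightarrow> \<bar>P h \<phi> x - c\<bar> \<le> 2 * e"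
proof -
  define \<eta> where "\<eta> = 1 - exp (- \<rho>\<^sup>2 / 2)"
  have \<eta>: "0 < \<eta>" unfolding \<eta>_def using assms by simp
  have "((\<lambda>h. B * (1 - (\<integral>y. chi y \<partial>Q h)) / \<eta>) \<longlongrightarrow> B * (1 - 1) / \<eta>) (at_right 0)"
    by (intro tendsto_intros Q_chi_tendsto) (use \<eta> in simp)
  then have "\<forall>\<^sub>F h in at_right 0. B * (1 - (\<integral>y. chi y \<partial>Q h)) / \<eta> < e"
    by (rule order_tendstoD(2)) (use assms in simp)
  then obtain d where d: "0 < d" "\<And>h. 0 < h \<Longrightarrow> h < d \<Longrightarrow> B * (1 - (\<integral>y. chi y \<partial>Q h)) / \<eta> < e"
    unfolding eventually_at_right_field by auto
  show ?thesis
  proof (rule that[OF d(1)])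
    fix h and \<phi> :: "real^'n \<Rightarrow> real" and x c assume h: "0 < h" "h < d" "\<phi> \<in> borel_measurable borel" "\<And>y. \<bar>\<phi> y - c\<bar> \<le> B" "\<And>y. norm (y - x) < \<rho> \<Longrightarrow> \<bar>\<phi> y - c\<bar> \<le> e"
    have "\<bar>P h \<phi> x - c\<bar> \<le> e + B * (1 - (\<integral>y. chi y \<partial>Q h)) / \<eta>"
      unfolding \<eta>_def by (rule P_near[OF h(1) assms(2) h(3,4)]) (use h(5) assms in auto)
    then show "\<bar>P h \<phi> x - c\<bar> \<le> 2 * e" using d(2)[OF h(1,2)] by simp
  qed
qed

lemma P_lipschitz_time:
  assumes "0 < e" "0 \<le> K"
  obtains d where "0 < d" "\<And>h \<phi> x. 0 < h \<Longrightarrow> h < d \<Longrightarrow> bc C \<phi> \<Longrightarrow> (\<And>x y. \<bar>\<phi> x - \<phi> y\<bar> \<le> K * norm (x - y))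
    \<Longrightarrow> \<bar>P h \<phi> x - \<phi> x\<bar> \<le> e"
proof -
  \<comment> \<open>Within radius (e/2)/(K+1) a K-Lipschitz function varies by at most e/2; K + 1
    avoids division by zero.\<close>
  obtain d where d: "0 < d" "\<And>h \<phi> x c. 0 < h \<Longrightarrow> h < d \<Longrightarrow> \<phi> \<in> borel_measurable borel \<Longrightarrow> (\<And>y. \<bar>\<phi> y - c\<bar> \<le> 2 * \<bar>C\<bar>)
    \<Longrightarrow> (\<And>y. norm (y - x) < e / 2 / (K + 1) \<Longrightarrow> \<bar>\<phi> y - c\<bar> \<le> e / 2) \<Longrightarrow> \<bar>P h \<phi> x - c\<bar> \<le> 2 * (e / 2)"
    using P_approx[of "e / 2" "e / 2 / (K + 1)" "2 * \<bar>C\<bar>"] assms by (auto simp: add_nonneg_pos)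
  show ?thesis
  proof (rule that[OF d(1)])
    fix h and \<phi> :: "real^'n \<Rightarrow> real" and x assume h: "0 < h" "h < d" "bc C \<phi>" "\<And>x y. \<bar>\<phi> x - \<phi> y\<bar> \<le> K * norm (x - y)"
    have "\<bar>P h \<phi> x - \<phi> x\<bar> \<le> 2 * (e / 2)"
    proof (rule d(2)[OF h(1,2) bc_borel[OF h(3)]])
      show "\<bar>\<phi> y - \<phi> x\<bar> \<le> 2 * \<bar>C\<bar>" for y using bcD(2)[OF h(3), of x] bcD(2)[OF h(3), of y] by linarith
      fix y assume "norm (y - x) < e / 2 / (K + 1)"
      then have "norm (y - x) * (K + 1) < e / 2" by (subst (asm) pos_less_divide_eq) (use assms in linarith)+
      then have "K * norm (y - x) \<le> e / 2" using norm_ge_zero[of "y - x"] unfolding distrib_left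
        by (simp only: mult.commute[of K] mult_1_right)
      then show "\<bar>\<phi> y - \<phi> x\<bar> \<le> e / 2" using h(4)[of y x] by linarith
    qed
    then show "\<bar>P h \<phi> x - \<phi> x\<bar> \<le> e" by simp
  qed
qed

end

subsection \<open>Gradient estimates for the semigroup\<close>

lemma differentiable_gderiv:
  fixes f :: "real^'n \<Rightarrow> real"
  assumes "f differentiable (at x)" shows "GDERIV f x :> gradient f x"
proof -
  have d: "(f has_derivative frechet_derivative f (at x)) (at x)" using assms frechet_derivative_works by blast
  interpret bounded_linear "frechet_derivative f (at x)" using d by (rule has_derivative_bounded_linear)
  have "frechet_derivative f (at x) h = h \<bullet> gradient f x" for h
  proof -
    have "frechet_derivative f (at x) h = frechet_derivative f (at x) (\<Sum>i\<in>UNIV. h $ i *\<^sub>R axis i 1)"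
      using basis_expansion[of h] by (simp add: scalar_mult_eq_scaleR)
    also have "\<dots> = h \<bullet> gradient f x"
      by (simp add: sum scaleR gradient_def partial_deriv_def inner_vec_def)
    finally show ?thesis .
  qed
  then have "frechet_derivative f (at x) = (\<lambda>h. h \<bullet> gradient f x)" by (rule ext)
  then show ?thesis using d unfolding gderiv_def by simp
qed

text \<open>Difference quotients in the direction of v itself give |v|^2 <= K |v|.\<close>

lemma gderiv_le_lipschitz:
  fixes f :: "'a::real_inner \<Rightarrow> real"
  assumes d: "GDERIV f x :> v" and l: "\<And>y z. \<bar>f y - f z\<bar> \<le> K * norm (y - z)" and "0 \<le> K"
  shows "norm v \<le> K"
proof (cases "v = 0")
  case False
  have "(\<lambda>n. real (Suc n) * (f (x + (1 / real (Suc n)) *\<^sub>R v) - f x)) \<longlonglongrightarrow> v \<bullet> v"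
    by (rule gderiv_scale_tendsto[OF d])
  moreover have "real (Suc n) * (f (x + (1 / real (Suc n)) *\<^sub>R v) - f x) \<le> K * norm v" for n
  proof -
    have "f (x + (1 / real (Suc n)) *\<^sub>R v) - f x \<le> K * (norm v / real (Suc n))"
      using l[of "x + (1 / real (Suc n)) *\<^sub>R v" x] by simp
    then have "real (Suc n) * (f (x + (1 / real (Suc n)) *\<^sub>R v) - f x) \<le> real (Suc n) * (K * (norm v / real (Suc n)))"
      by (rule mult_left_mono) simp
    also have "\<dots> = K * norm v" by (simp del: of_nat_Suc)
    finally show ?thesis .
  qed
  ultimately have "v \<bullet> v \<le> K * norm v" by (intro LIMSEQ_le_const2) auto
  then have "norm v * norm v \<le> K * norm v" by (simp add: power2_norm_eq_inner[symmetric] power2_eq_square)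
  then show ?thesis using False by simp
qed (use \<open>0 \<le> K\<close> in simp)

lemma borel_measurable_itv:
  fixes f :: "real \<Rightarrow> 'b::topological_space"
  assumes "continuous_on {a<..<b} f" shows "f \<in> borel_measurable (itv a b)"
proof -
  have "sets (itv a b) = sets (restrict_space borel {a<..<b})" unfolding itv_def by (rule sets_restrict_space_cong) simp
  from measurable_cong_sets[OF this refl] show ?thesis using borel_measurable_continuous_on_restrict[OF assms] by blast
qed

lemma powr_interp:
  fixes X a b \<theta> :: real
  assumes "0 \<le> X" "X \<le> a" "X \<le> b" "0 \<le> \<theta>" "\<theta> \<le> 1"
  shows "X \<le> a powr \<theta> * b powr (1 - \<theta>)"
proof (cases "X = 0")
  case False
  then have "X = X powr (\<theta> + (1 - \<theta>))" using assms by simp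
  also have "\<dots> = X powr \<theta> * X powr (1 - \<theta>)" by (rule powr_add)
  also have "\<dots> \<le> a powr \<theta> * b powr (1 - \<theta>)" using assms by (intro mult_mono powr_mono2) auto
  finally show ?thesis .
qed simp

locale levy_kernel = levy_heat A \<mu> p for A :: "real^'n^'n" and \<mu> :: "(real^'n) measure" and p +
  fixes T \<alpha> c0 :: real
  assumes T: "0 < T" and p_smooth: "\<forall>t\<in>{0<..T}. Cb_infinity (p t)"
    and alpha: "1 < \<alpha>" "\<alpha> \<le> 2" and c0: "0 < c0"
    and p_gradient: "\<forall>t\<in>{0<..T}.
          (\<integral>\<^sup>+y. ennreal (norm (gradient (p t) y)) \<partial>lborel) \<le> ennreal (c0 * t powr (- 1 / \<alpha>))"
begin

abbreviation "Dp t \<equiv> gradient (p t)"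

definition K0 :: "real \<Rightarrow> real" where "K0 t = c0 * t powr (- 1 / \<alpha>)"

lemma K0_nonneg: "0 \<le> K0 t" unfolding K0_def using c0 by simp

lemma p_gderiv: "0 < t \<Longrightarrow> t \<le> T \<Longrightarrow> GDERIV (p t) x :> Dp t x"
  and Dp_cont: "0 < t \<Longrightarrow> t \<le> T \<Longrightarrow> continuous_on UNIV (Dp t)"
proof -
  assume t: "0 < t" "t \<le> T"
  then have "Cb_infinity (p t)" using p_smooth by auto
  then have c: "Cb (Suc (Suc 0)) (p t)" unfolding Cb_infinity_def by blast
  then show "GDERIV (p t) x :> Dp t x" by (intro differentiable_gderiv) simp
  from c show "continuous_on UNIV (Dp t)" unfolding gradient_def[abs_def] by (intro continuous_on_vec_lambda) auto
qed

lemma Dp_borel[measurable]: "0 < t \<Longrightarrow> t \<le> T \<Longrightarrow> Dp t \<in> borel_measurable borel"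
  by (intro borel_measurable_continuous_onI Dp_cont)

lemma Dp_integrable: "0 < t \<Longrightarrow> t \<le> T \<Longrightarrow> integrable lborel (Dp t)"
  and Dp_integral: "0 < t \<Longrightarrow> t \<le> T \<Longrightarrow> (\<integral>y. norm (Dp t y) \<partial>lborel) \<le> K0 t"
proof -
  assume t: "0 < t" "t \<le> T"
  have b: "(\<integral>\<^sup>+y. ennreal (norm (Dp t y)) \<partial>lborel) \<le> ennreal (K0 t)" using p_gradient t unfolding K0_def by auto
  then have "(\<integral>\<^sup>+y. ennreal (norm (Dp t y)) \<partial>lborel) < \<infinity>" using ennreal_less_top order.strict_trans1 infinity_ennreal_def by metis
  then show i: "integrable lborel (Dp t)" using Dp_borel[OF t] by (intro integrableI_bounded) auto
  show "(\<integral>y. norm (Dp t y) \<partial>lborel) \<le> K0 t"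
    using b nn_integral_eq_integral[OF integrable_norm[OF i]] K0_nonneg by (simp add: ennreal_le_iff)
qed

text \<open>The gradient of P t \<phi>, with the derivative on the kernel; identified in
  \<open>G_gderiv\<close>.\<close>

definition G :: "real \<Rightarrow> (real^'n \<Rightarrow> real) \<Rightarrow> real^'n \<Rightarrow> real^'n" where
  "G t \<phi> x = (\<integral>y. \<phi> (x - y) *\<^sub>R Dp t y \<partial>lborel)"

lemma G_integrable:
  assumes t: "0 < t" "t \<le> T" and \<phi>: "bc C \<phi>"
  shows "integrable lborel (\<lambda>y. \<phi> (x - y) *\<^sub>R Dp t y)"
proof -
  note [measurable] = bc_borel[OF \<phi>] Dp_borel[OF t]
  have i: "integrable lborel (\<lambda>y. C *\<^sub>R Dp t y)" using Dp_integrable[OF t] by simp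
  show ?thesis
    by (rule Bochner_Integration.integrable_bound[OF i])
      (use bcD(2)[OF \<phi>] bc_nonneg[OF \<phi>] in \<open>auto intro!: AE_I2 mult_right_mono\<close>)
qed

lemma G_bound:
  assumes t: "0 < t" "t \<le> T" and \<phi>: "bc C \<phi>"
  shows "norm (G t \<phi> x) \<le> K0 t * C"
proof -
  have "norm (G t \<phi> x) \<le> (\<integral>y. norm (\<phi> (x - y) *\<^sub>R Dp t y) \<partial>lborel)" unfolding G_def by (rule integral_norm_bound)
  also have "\<dots> \<le> (\<integral>y. C * norm (Dp t y) \<partial>lborel)"
  proof (rule integral_mono[OF integrable_norm[OF G_integrable[OF t \<phi>]]])
    show "norm (\<phi> (x - y) *\<^sub>R Dp t y) \<le> C * norm (Dp t y)" for y
      unfolding norm_scaleR using bcD(2)[OF \<phi>] by (intro mult_right_mono) auto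
  qed (use Dp_integrable[OF t] in simp)
  also have "\<dots> \<le> K0 t * C" using mult_left_mono[OF Dp_integral[OF t] bc_nonneg[OF \<phi>]] by (simp add: mult.commute)
  finally show ?thesis .
qed

lemma G_tendsto:
  assumes t: "0 < t" "t \<le> T" and \<phi>n: "\<And>n. bc C (\<phi>n n)" and \<phi>: "bc C' \<phi>"
    and lim: "\<And>y. (\<lambda>n. \<phi>n n (X n - y)) \<longlonglongrightarrow> \<phi> (x - y)"
  shows "(\<lambda>n. G t (\<phi>n n) (X n)) \<longlonglongrightarrow> G t \<phi> x"
  unfolding G_def
proof (rule integral_dominated_convergence[where w = "\<lambda>y. C * norm (Dp t y)"])
  show "AE y in lborel. (\<lambda>n. \<phi>n n (X n - y) *\<^sub>R Dp t y) \<longlonglongrightarrow> \<phi> (x - y) *\<^sub>R Dp t y"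
    using lim by (intro AE_I2 tendsto_scaleR) auto
  show "AE y in lborel. norm (\<phi>n n (X n - y) *\<^sub>R Dp t y) \<le> C * norm (Dp t y)" for n
    using bcD(2)[OF \<phi>n] by (auto intro!: AE_I2 mult_right_mono)
qed (use borel_measurable_integrable[OF G_integrable[OF t \<phi>]] borel_measurable_integrable[OF G_integrable[OF t \<phi>n]] Dp_integrable[OF t] in auto)

lemma G_cont:
  assumes t: "0 < t" "t \<le> T" and \<phi>: "bc C \<phi>"
  shows "continuous_on UNIV (G t \<phi>)"
  unfolding continuous_on_sequentially comp_def
proof (intro allI impI ballI)
  fix X and x :: "real^'n" assume "(\<forall>n. X n \<in> UNIV) \<and> X \<longlonglongrightarrow> x"
  then have l: "(\<lambda>n. X n - y) \<longlonglongrightarrow> x - y" for y by (intro tendsto_diff) auto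
  show "(\<lambda>n. G t \<phi> (X n)) \<longlonglongrightarrow> G t \<phi> x" by (rule G_tendsto[OF t \<phi> \<phi> bc_tendsto[OF \<phi> l]])
qed

lemma G_bc:
  assumes t: "0 < t" "t \<le> T" and \<phi>: "bc C \<phi>"
  shows "bc (K0 t * C) (\<lambda>x. G t \<phi> x $ i)"
  unfolding bc_def using G_cont[OF t \<phi>] order_trans[OF component_le_norm_cart G_bound[OF t \<phi>]]
  by (auto intro: continuous_on_component)

text \<open>Only the integral of the gradient of the kernel is controlled, so differentiation under the integral is 
  replaced by integration of the gradient along a segment and Fubini.\<close>

lemma P_increment:
  assumes t: "0 < t" "t \<le> T" and \<phi>: "bc C \<phi>"
  shows "P t \<phi> (x + h) - P t \<phi> x = (\<integral>\<tau>. h \<bullet> G t \<phi> (x + \<tau> *\<^sub>R h) \<partial>itv 0 1)"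
proof -
  note [measurable] = bc_borel[OF \<phi>] Dp_borel[OF t] p_borel[OF t(1)]
  interpret I: finite_measure "itv 0 1" by (rule finite_itv)
  interpret pair_sigma_finite "itv 0 1" "lborel :: (real^'n) measure"
    by (intro pair_sigma_finite.intro sigma_finite_itv lborel.sigma_finite_measure_axioms)
  have [measurable]: "(\<lambda>r. r) \<in> borel_measurable (itv 0 1)" unfolding itv_def by (rule measurable_restrict_space1) simp
  have ftc: "p t (w + h) - p t w = (\<integral>\<tau>. h \<bullet> Dp t (w + \<tau> *\<^sub>R h) \<partial>itv 0 1)" for w
  proof -
    have "interval_lebesgue_integral lborel (ereal 0) (ereal 1) (\<lambda>\<tau>. h \<bullet> Dp t (w + \<tau> *\<^sub>R h)) = p t (w + 1 *\<^sub>R h) - p t (w + 0 *\<^sub>R h)"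
    proof (rule interval_integral_FTC_finite)
      show "continuous_on {min 0 1..max 0 1} (\<lambda>\<tau>. h \<bullet> Dp t (w + \<tau> *\<^sub>R h))"
        by (intro continuous_intros continuous_on_compose2[OF Dp_cont[OF t]]) auto
      show "((\<lambda>\<tau>. p t (w + \<tau> *\<^sub>R h)) has_vector_derivative h \<bullet> Dp t (w + \<tau> *\<^sub>R h)) (at \<tau> within {min 0 1..max 0 1})" for \<tau>
      proof -
        have "((\<lambda>s. p t (w + s *\<^sub>R h)) has_derivative (\<lambda>s. (s *\<^sub>R h) \<bullet> Dp t (w + \<tau> *\<^sub>R h))) (at \<tau>)"
          by (rule has_derivative_compose[where f = "\<lambda>s. w + s *\<^sub>R h" and g = "p t"])
            (use p_gderiv[OF t] in \<open>auto simp: gderiv_def intro!: derivative_eq_intros\<close>)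
        then show ?thesis unfolding has_vector_derivative_def by (subst has_derivative_at_withinI) simp_all
      qed
    qed
    then show ?thesis by (simp add: interval_integral_itv)
  qed
  define f where "f \<tau> y = \<phi> y * (h \<bullet> Dp t ((x - y) + \<tau> *\<^sub>R h))" for \<tau> y
  \<comment> \<open>Recentred at x + \<tau> h, the integrand is that of \<open>G\<close> up to the
    reflection y -> x + \<tau> h - y.\<close>
  have fe: "f \<tau> y = h \<bullet> (\<phi> ((x + \<tau> *\<^sub>R h) - ((x + \<tau> *\<^sub>R h) - y)) *\<^sub>R Dp t ((x + \<tau> *\<^sub>R h) - y))" for \<tau> y
  proof -
    have "(x + \<tau> *\<^sub>R h) - ((x + \<tau> *\<^sub>R h) - y) = y" "(x - y) + \<tau> *\<^sub>R h = (x + \<tau> *\<^sub>R h) - y" by simp_all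
    then show ?thesis unfolding f_def by (simp only: inner_scaleR_right)
  qed
  have subst: "(\<integral>y. g (w - y) \<partial>lborel) = (\<integral>y. g y \<partial>lborel)" "integrable lborel (\<lambda>y. g (w - y)) \<longleftrightarrow> integrable lborel g"
    if "g \<in> borel_measurable borel" for g :: "real^'n \<Rightarrow> real" and w
    using lborel_integral_affine[of "-1" g w] that by auto
  have gi: "integrable lborel (\<lambda>y. h \<bullet> (\<phi> (w - y) *\<^sub>R Dp t y))" for w
    by (rule integrable_inner_right) (rule G_integrable[OF t \<phi>])
  have gm: "(\<lambda>y. h \<bullet> (\<phi> (w - y) *\<^sub>R Dp t y)) \<in> borel_measurable borel" for w by measurable
  have fi: "integrable lborel (f \<tau>)" for \<tau>
    unfolding fe subst(2)[OF gm] by (rule gi)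
  have fI: "(\<integral>y. f \<tau> y \<partial>lborel) = h \<bullet> G t \<phi> (x + \<tau> *\<^sub>R h)" for \<tau>
    unfolding fe subst(1)[OF gm] G_def by (rule integral_inner_right) (rule G_integrable[OF t \<phi>])
  have m: "(\<lambda>(\<tau>, y). f \<tau> y) \<in> borel_measurable (itv 0 1 \<Otimes>\<^sub>M lborel)" unfolding f_def by measurable
  \<comment> \<open>The L1 norm of the gradient is translation invariant, so this bound is uniform
    in \<tau>; that is what Fubini requires.\<close>
  have fb: "(\<integral>y. norm (f \<tau> y) \<partial>lborel) \<le> C * norm h * K0 t" for \<tau>
  proof -
    have i2: "integrable lborel (\<lambda>y. C * norm h * norm (Dp t (x + \<tau> *\<^sub>R h - y)))"
      using Dp_integrable[OF t] by (subst subst(2)[of "\<lambda>y. C * norm h * norm (Dp t y)"]) auto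
    have "(\<integral>y. norm (f \<tau> y) \<partial>lborel) \<le> (\<integral>y. C * norm h * norm (Dp t (x + \<tau> *\<^sub>R h - y)) \<partial>lborel)"
    proof (rule integral_mono[OF integrable_norm[OF fi] i2])
      fix y
      have "norm (f \<tau> y) = \<bar>\<phi> y\<bar> * \<bar>h \<bullet> Dp t (x + \<tau> *\<^sub>R h - y)\<bar>" 
      proof -
        have "(x - y) + \<tau> *\<^sub>R h = (x + \<tau> *\<^sub>R h) - y" by simp
        then show ?thesis unfolding f_def by (simp only: abs_mult real_norm_def)
      qed
      also have "\<dots> \<le> C * (norm h * norm (Dp t (x + \<tau> *\<^sub>R h - y)))"
        by (intro mult_mono bcD(2)[OF \<phi>] Cauchy_Schwarz_ineq2 bc_nonneg[OF \<phi>]) auto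
      finally show "norm (f \<tau> y) \<le> C * norm h * norm (Dp t (x + \<tau> *\<^sub>R h - y))" by (simp add: mult.assoc)
    qed
    also have "\<dots> = C * norm h * (\<integral>y. norm (Dp t y) \<partial>lborel)"
      by (subst subst(1)[of "\<lambda>y. C * norm h * norm (Dp t y)"]) auto
    also have "\<dots> \<le> C * norm h * K0 t" by (intro mult_left_mono Dp_integral[OF t] mult_nonneg_nonneg bc_nonneg[OF \<phi>]) simp
    finally show ?thesis .
  qed
  have Fi: "integrable (itv 0 1 \<Otimes>\<^sub>M lborel) (\<lambda>(\<tau>, y). f \<tau> y)"
  proof (rule Fubini_integrable[OF m])
    have [measurable]: "(\<lambda>(\<tau>, y). norm (f \<tau> y)) \<in> borel_measurable (itv 0 1 \<Otimes>\<^sub>M lborel)"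
      using measurable_compose[OF m borel_measurable_norm] by (simp add: case_prod_unfold)
    have "(\<lambda>\<tau>. \<integral>y. norm (f \<tau> y) \<partial>lborel) \<in> borel_measurable (itv 0 1)" by measurable
    then show "integrable (itv 0 1) (\<lambda>\<tau>. \<integral>y. norm (case (\<tau>, y) of (\<tau>, y) \<Rightarrow> f \<tau> y) \<partial>lborel)"
      by (intro I.integrable_const_bound[of _ "C * norm h * K0 t"]) (use fb in auto)
  qed (use fi in auto)
  have hs: "P t \<phi> x = (\<integral>y. p t (x - y) * \<phi> y \<partial>lborel)" for x
    using heat_semigroup_eq[OF t(1) bc_borel[OF \<phi>], of x] by (simp add: heat_semigroup_def)
  have pi: "integrable lborel (\<lambda>y. p t (x - y) * \<phi> y)" for x
  proof (rule Bochner_Integration.integrable_bound)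
    have i: "integrable lborel (\<lambda>y. C * p t y)" using p_integrable[OF t(1)] by simp
    show "integrable lborel (\<lambda>y. C * p t (x - y))" using i by (subst subst(2)[of "\<lambda>y. C * p t y" x]) auto
    show "AE y in lborel. norm (p t (x - y) * \<phi> y) \<le> norm (C * p t (x - y))"
      using bcD(2)[OF \<phi>] bc_nonneg[OF \<phi>] by (auto intro!: AE_I2 mult_right_mono simp: abs_mult mult.commute)
  qed measurable
  have "P t \<phi> (x + h) - P t \<phi> x = (\<integral>y. p t (x + h - y) * \<phi> y - p t (x - y) * \<phi> y \<partial>lborel)"
    unfolding hs using pi by (intro Bochner_Integration.integral_diff[symmetric])
  also have "\<dots> = (\<integral>y. \<integral>\<tau>. f \<tau> y \<partial>itv 0 1 \<partial>lborel)"
  proof (rule Bochner_Integration.integral_cong[OF refl])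
    fix y
    have "p t (x + h - y) * \<phi> y - p t (x - y) * \<phi> y = \<phi> y * (p t ((x - y) + h) - p t (x - y))" by (simp add: algebra_simps)
    also have "\<dots> = (\<integral>\<tau>. f \<tau> y \<partial>itv 0 1)" unfolding ftc f_def by (rule integral_mult_right_zero[symmetric])
    finally show "p t (x + h - y) * \<phi> y - p t (x - y) * \<phi> y = (\<integral>\<tau>. f \<tau> y \<partial>itv 0 1)" .
  qed
  also have "\<dots> = (\<integral>\<tau>. \<integral>y. f \<tau> y \<partial>lborel \<partial>itv 0 1)" by (rule Fubini_integral[OF Fi])
  also have "\<dots> = (\<integral>\<tau>. h \<bullet> G t \<phi> (x + \<tau> *\<^sub>R h) \<partial>itv 0 1)" unfolding fI ..
  finally show ?thesis .
qed

text \<open>By \<open>P_increment\<close> the remainder is an average of h . (G (x + \<tau> h) - G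
  x), which is small relative to |h| by continuity of G.\<close>

lemma G_gderiv:
  assumes t: "0 < t" "t \<le> T" and \<phi>: "bc C \<phi>"
  shows "GDERIV (P t \<phi>) x :> G t \<phi> x"
  unfolding gderiv_def has_derivative_at_alt
proof (intro conjI allI impI)
  show "bounded_linear (\<lambda>h. h \<bullet> G t \<phi> x)" by (rule bounded_linear_inner_left)
  fix e :: real assume e: "0 < e"
  interpret I: finite_measure "itv 0 1" by (rule finite_itv)
  have I: "prob_space (itv 0 1)" by (rule prob_spaceI) (simp add: itv_def emeasure_restrict_space)
  obtain d where d: "0 < d" "\<And>y. norm (y - x) < d \<Longrightarrow> norm (G t \<phi> y - G t \<phi> x) < e"
    using G_cont[OF t \<phi>] e unfolding continuous_on_iff dist_norm by blast
  show "\<exists>d>0. \<forall>y. norm (y - x) < d \<longrightarrow> norm (P t \<phi> y - P t \<phi> x - (y - x) \<bullet> G t \<phi> x) \<le> e * norm (y - x)"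
  proof (intro exI[of _ d] conjI d(1) allI impI)
    fix y assume y: "norm (y - x) < d"
    define h where "h = y - x"
    have c: "continuous_on {0<..<1} (\<lambda>\<tau>. h \<bullet> G t \<phi> (x + \<tau> *\<^sub>R h))"
      by (intro continuous_intros continuous_on_compose2[OF G_cont[OF t \<phi>]]) auto
    have i: "integrable (itv 0 1) (\<lambda>\<tau>. h \<bullet> G t \<phi> (x + \<tau> *\<^sub>R h))"
    proof (rule I.integrable_const_bound)
      show "AE \<tau> in itv 0 1. norm (h \<bullet> G t \<phi> (x + \<tau> *\<^sub>R h)) \<le> norm h * (K0 t * C)"
        by (intro AE_I2 order_trans[OF Cauchy_Schwarz_ineq2[folded real_norm_def]] mult_left_mono G_bound[OF t \<phi>]) simp
      show "(\<lambda>\<tau>. h \<bullet> G t \<phi> (x + \<tau> *\<^sub>R h)) \<in> borel_measurable (itv 0 1)"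
        by (rule borel_measurable_itv[OF c])
    qed
    have "P t \<phi> y - P t \<phi> x - (y - x) \<bullet> G t \<phi> x = (\<integral>\<tau>. h \<bullet> G t \<phi> (x + \<tau> *\<^sub>R h) - h \<bullet> G t \<phi> x \<partial>itv 0 1)"
      using P_increment[OF t \<phi>, of x h] i prob_space.prob_space[OF I] by (simp add: h_def)
    moreover have "norm (\<integral>\<tau>. h \<bullet> G t \<phi> (x + \<tau> *\<^sub>R h) - h \<bullet> G t \<phi> x \<partial>itv 0 1) \<le> e * norm h"
    proof (rule norm_integral_le_prob[OF I])
      fix \<tau> assume "\<tau> \<in> space (itv 0 1)"
      then have "norm (x + \<tau> *\<^sub>R h - x) \<le> norm h" by (simp add: mult_left_le_one_le)
      then have "norm (G t \<phi> (x + \<tau> *\<^sub>R h) - G t \<phi> x) \<le> e" using d(2)[of "x + \<tau> *\<^sub>R h"] y h_def by fastforce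
      then have "norm h * norm (G t \<phi> (x + \<tau> *\<^sub>R h) - G t \<phi> x) \<le> norm h * e" by (rule mult_left_mono) simp
      then show "norm (h \<bullet> G t \<phi> (x + \<tau> *\<^sub>R h) - h \<bullet> G t \<phi> x) \<le> e * norm h"
        using Cauchy_Schwarz_ineq2[of h "G t \<phi> (x + \<tau> *\<^sub>R h) - G t \<phi> x"] by (simp add: inner_diff_right mult.commute)
    qed (use e in simp)
    ultimately show "norm (P t \<phi> y - P t \<phi> x - (y - x) \<bullet> G t \<phi> x) \<le> e * norm (y - x)" by (simp add: h_def)
  qed
qed

lemma P_components:
  assumes t: "0 < t" "t \<le> T" and \<phi>: "bc C \<phi>" and s: "0 < s"
  shows "GDERIV (P (s + t) \<phi>) x :> (\<chi> i. P s (\<lambda>y. G t \<phi> y $ i) x)"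
proof -
  have "P (s + t) \<phi> = P s (P t \<phi>)" using P_semigroup[OF s t(1) \<phi>] by auto
  then show ?thesis using P_gderiv[OF s P_bc[OF t(1) \<phi>] G_gderiv[OF t \<phi>] G_bound[OF t \<phi>], of x] by simp
qed

text \<open>P (s + t) \<phi> = P s (P t \<phi>) can be differentiated on the kernel at time s or on
  P t \<phi>; uniqueness of the gradient equates the results.\<close>

lemma G_P:
  assumes t: "0 < t" and \<phi>: "bc C \<phi>" and s: "0 < s" "s + t \<le> T"
  shows "G (s + t) \<phi> x = G s (P t \<phi>) x" "G (s + t) \<phi> x $ i = P s (\<lambda>y. G t \<phi> y $ i) x"
proof -
  have st: "0 < s + t" "s \<le> T" "t \<le> T" using t s by auto
  have e: "P (s + t) \<phi> = P s (P t \<phi>)" using P_semigroup[OF s(1) t \<phi>] by auto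
  note g = G_gderiv[OF st(1) s(2) \<phi>, of x]
  show "G (s + t) \<phi> x = G s (P t \<phi>) x"
    by (rule gderiv_unique[OF g]) (unfold e, rule G_gderiv[OF s(1) st(2) P_bc[OF t \<phi>]])
  show "G (s + t) \<phi> x $ i = P s (\<lambda>y. G t \<phi> y $ i) x"
    using gderiv_unique[OF g P_components[OF t st(3) \<phi> s(1)]] by simp
qed

text \<open>Row \<open>i\<close> of the Hessian of P t \<phi>. Each derivative is given half of the
  time, since only first derivatives of the kernel are bounded in L1.\<close>

definition W :: "real \<Rightarrow> (real^'n \<Rightarrow> real) \<Rightarrow> 'n \<Rightarrow> real^'n \<Rightarrow> real^'n" where
  "W t \<phi> i x = G (t / 2) (\<lambda>y. G (t / 2) \<phi> y $ i) x"

lemma half_time_bounds: "0 < t \<Longrightarrow> t \<le> T \<Longrightarrow> 0 < t / 2 \<and> t / 2 \<le> T" by simp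

lemma W_gderiv:
  assumes t: "0 < t" "t \<le> T" and \<phi>: "bc C \<phi>"
  shows "GDERIV (\<lambda>x. G t \<phi> x $ i) x :> W t \<phi> i x"
proof -
  have h: "0 < t / 2" "t / 2 \<le> T" "t / 2 + t / 2 \<le> T" "t / 2 + t / 2 = t" using t by auto
  have "(\<lambda>x. G t \<phi> x $ i) = P (t / 2) (\<lambda>y. G (t / 2) \<phi> y $ i)"
    using G_P(2)[OF h(1) \<phi> h(1,3)] unfolding h(4) by auto
  then show ?thesis unfolding W_def using G_gderiv[OF h(1,2) G_bc[OF h(1,2) \<phi>]] by simp
qed

lemma W_bound:
  assumes t: "0 < t" "t \<le> T" and \<phi>: "bc C \<phi>"
  shows "norm (W t \<phi> i x) \<le> K0 (t / 2) * (K0 (t / 2) * C)"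
  unfolding W_def using half_time_bounds[OF t] by (intro G_bound G_bc \<phi>) auto

lemma G_bound_lipschitz:
  assumes t: "0 < t" "t \<le> T" and \<phi>: "bc C \<phi>" and K: "0 \<le> K" "\<And>x y. \<bar>\<phi> x - \<phi> y\<bar> \<le> K * norm (x - y)"
  shows "norm (G t \<phi> x) \<le> K"
  by (rule gderiv_le_lipschitz[OF G_gderiv[OF t \<phi>] P_lipschitz[OF t(1) \<phi> K(2)] K(1)])

text \<open>The inner gradient is bounded by the Lipschitz constant, so only one singular factor
  remains.\<close>

lemma W_bound_lipschitz:
  assumes t: "0 < t" "t \<le> T" and \<phi>: "bc C \<phi>" and K: "0 \<le> K" "\<And>x y. \<bar>\<phi> x - \<phi> y\<bar> \<le> K * norm (x - y)"
  shows "norm (W t \<phi> i x) \<le> K0 (t / 2) * K"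
proof -
  have h: "0 < t / 2" "t / 2 \<le> T" using t by auto
  have "bc K (\<lambda>y. G (t / 2) \<phi> y $ i)" using G_bc[OF h \<phi>, of i] order_trans[OF component_le_norm_cart G_bound_lipschitz[OF h \<phi> K]]
    unfolding bc_def by blast
  then show ?thesis unfolding W_def by (rule G_bound[OF h])
qed

lemma W_tendsto:
  assumes t: "0 < t" "t \<le> T" and \<phi>n: "\<And>n. bc C (\<phi>n n)" and \<phi>: "bc C' \<phi>"
    and lim: "\<And>y. (\<lambda>n. \<phi>n n (X n - y)) \<longlonglongrightarrow> \<phi> (x - y)"
  shows "(\<lambda>n. W t (\<phi>n n) i (X n)) \<longlonglongrightarrow> W t \<phi> i x"
proof -
  have h: "0 < t / 2" "t / 2 \<le> T" using t by auto
  show ?thesis unfolding W_def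
  proof (rule G_tendsto[OF h G_bc[OF h \<phi>n] G_bc[OF h \<phi>]])
    fix y
    have "(\<lambda>n. G (t / 2) (\<phi>n n) (X n - y)) \<longlonglongrightarrow> G (t / 2) \<phi> (x - y)"
      by (rule G_tendsto[OF h \<phi>n \<phi>]) (use lim[of "y + z" for z] in \<open>simp add: diff_diff_eq\<close>)
    then show "(\<lambda>n. G (t / 2) (\<phi>n n) (X n - y) $ i) \<longlonglongrightarrow> G (t / 2) \<phi> (x - y) $ i" by (rule tendsto_vec_nth)
  qed
qed

text \<open>Shifts the dependence on time from W to P, where continuity in time is known; see
  \<open>W_joint_tendsto\<close>.\<close>

lemma W_P:
  assumes t: "0 < t" and \<phi>: "bc C \<phi>" and s: "0 < s" "s + t \<le> T"
  shows "W (s + t) \<phi> i x = W s (P t \<phi>) i x"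
proof (rule gderiv_unique)
  have st: "0 < s + t" "s \<le> T" using t s by auto
  show "GDERIV (\<lambda>x. G (s + t) \<phi> x $ i) x :> W (s + t) \<phi> i x" by (rule W_gderiv[OF st(1) s(2) \<phi>])
  show "GDERIV (\<lambda>x. G (s + t) \<phi> x $ i) x :> W s (P t \<phi>) i x"
    unfolding G_P(1)[OF t \<phi> s] by (rule W_gderiv[OF s(1) st(2) P_bc[OF t \<phi>]])
qed

lemma G_add:
  assumes t: "0 < t" "t \<le> T" and "bc C \<phi>" "bc C' \<eta>"
  shows "G t (\<lambda>x. \<phi> x + \<eta> x) x = G t \<phi> x + G t \<eta> x"
  unfolding G_def using G_integrable[OF t assms(3)] G_integrable[OF t assms(4)] by (simp add: scaleR_add_left)

lemma W_add:
  assumes t: "0 < t" "t \<le> T" and "bc C \<phi>" "bc C' \<eta>"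
  shows "W t (\<lambda>x. \<phi> x + \<eta> x) i x = W t \<phi> i x + W t \<eta> i x"
proof -
  have h: "0 < t / 2" "t / 2 \<le> T" using t by auto
  show ?thesis unfolding W_def G_add[OF h assms(3,4)] vector_add_component 
    by (rule G_add[OF h G_bc[OF h assms(3)] G_bc[OF h assms(4)]])
qed

text \<open>\<open>c1\<close> absorbs the factor 2^(1/\<alpha>) of the half time. \<open>c2\<close>
  adds the costs of the small part (two kernel gradients) and of the Lipschitz part (one).
  \<open>c3\<close> dominates both endpoint estimates in \<open>G_holder\<close>.\<close>

definition "c1 = c0 * 2 powr (1 / \<alpha>)"
definition "c2 = c1 * c1 + c1"
definition "c3 = real CARD('n) * c2 + 2 * (c0 + 1)"

lemma c_nonneg: "0 \<le> c1" "0 \<le> c2" "0 \<le> c3"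
  unfolding c1_def c2_def c3_def using c0 by (auto simp: add_nonneg_nonneg)

lemma K0_half: "0 < t \<Longrightarrow> K0 (t / 2) = c1 * t powr (- 1 / \<alpha>)"
  by (simp add: K0_def c1_def powr_divide powr_minus field_simps)

text \<open>Split \<open>\<phi>\<close> by \<open>holder_split\<close> at the scale \<open>\<delta> = t powr (1 / \<alpha>)\<close>, use the sup norm of the small part and the
  Lipschitz constant of the other one.\<close>

lemma interpolation:
  assumes t: "0 < t" "t \<le> T" and \<phi>: "bc C \<phi>" and M: "0 \<le> M" "\<And>x y. \<bar>\<phi> x - \<phi> y\<bar> \<le> M * norm (x - y) powr \<gamma>" 
    and g: "0 \<le> \<gamma>" "\<gamma> \<le> 1"
  shows "norm (G t \<phi> x) \<le> (c0 + 1) * M * t powr ((\<gamma> - 1) / \<alpha>)"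
    and "norm (W t \<phi> i x) \<le> c2 * M * t powr ((\<gamma> - 2) / \<alpha>)"
proof -
  define \<delta> where "\<delta> = t powr (1 / \<alpha>)"
  have \<delta>: "0 < \<delta>" unfolding \<delta>_def using t by simp
  obtain f where f: "\<And>x. \<bar>\<phi> x - f x\<bar> \<le> M * \<delta> powr \<gamma>" "\<And>x y. \<bar>f x - f y\<bar> \<le> M * \<delta> powr (\<gamma> - 1) * norm (x - y)"
    using holder_split[OF bcD(2)[OF \<phi>] M(2) g \<delta> M(1)] by blast
  define K where "K = M * \<delta> powr (\<gamma> - 1)"
  have K: "0 \<le> K" unfolding K_def using M by simp
  have "K-lipschitz_on UNIV f" using f(2) K unfolding K_def by (auto intro!: lipschitz_onI simp: dist_norm)
  then have fc: "continuous_on UNIV f" by (rule lipschitz_on_continuous_on)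
  have bf: "bc (C + M * \<delta> powr \<gamma>) f" unfolding bc_def
  proof (intro conjI fc allI)
    show "\<bar>f x\<bar> \<le> C + M * \<delta> powr \<gamma>" for x using f(1)[of x] bcD(2)[OF \<phi>, of x] by linarith
  qed
  have br: "bc (M * \<delta> powr \<gamma>) (\<lambda>x. \<phi> x - f x)" unfolding bc_def
    by (intro conjI allI f(1) continuous_on_diff fc bcD(1)[OF \<phi>])
  have e: "\<phi> = (\<lambda>x. f x + (\<phi> x - f x))" by auto
  have p1: "\<delta> powr \<gamma> = t powr (\<gamma> / \<alpha>)" "\<delta> powr (\<gamma> - 1) = t powr ((\<gamma> - 1) / \<alpha>)" unfolding \<delta>_def by (simp_all add: powr_powr)
  have p2: "t powr (- 1 / \<alpha>) * t powr (\<gamma> / \<alpha>) = t powr ((\<gamma> - 1) / \<alpha>)"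
    "t powr (- 1 / \<alpha>) * t powr ((\<gamma> - 1) / \<alpha>) = t powr ((\<gamma> - 2) / \<alpha>)"
  proof -
    have "- 1 / \<alpha> + \<gamma> / \<alpha> = (\<gamma> - 1) / \<alpha>" "- 1 / \<alpha> + (\<gamma> - 1) / \<alpha> = (\<gamma> - 2) / \<alpha>"
      using alpha by (simp_all add: field_simps)
    then show "t powr (- 1 / \<alpha>) * t powr (\<gamma> / \<alpha>) = t powr ((\<gamma> - 1) / \<alpha>)"
      "t powr (- 1 / \<alpha>) * t powr ((\<gamma> - 1) / \<alpha>) = t powr ((\<gamma> - 2) / \<alpha>)"
      by (simp_all only: powr_add[symmetric])
  qed
  have "norm (G t \<phi> x) \<le> norm (G t f x) + norm (G t (\<lambda>x. \<phi> x - f x) x)"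
    by (subst e, subst G_add[OF t bf br]) (rule norm_triangle_ineq)
  also have "\<dots> \<le> K + K0 t * (M * \<delta> powr \<gamma>)"
    by (intro add_mono G_bound_lipschitz[OF t bf K] G_bound[OF t br]) (use f(2) in \<open>simp add: K_def\<close>)
  also have "K0 t * (M * \<delta> powr \<gamma>) = c0 * M * t powr ((\<gamma> - 1) / \<alpha>)"
    unfolding K0_def p1 p2(1)[symmetric] by simp
  finally show "norm (G t \<phi> x) \<le> (c0 + 1) * M * t powr ((\<gamma> - 1) / \<alpha>)" unfolding K_def p1 by (simp add: algebra_simps)
  have "norm (W t \<phi> i x) \<le> norm (W t f i x) + norm (W t (\<lambda>x. \<phi> x - f x) i x)"
    by (subst e, subst W_add[OF t bf br]) (rule norm_triangle_ineq)
  also have "\<dots> \<le> K0 (t / 2) * K + K0 (t / 2) * (K0 (t / 2) * (M * \<delta> powr \<gamma>))"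
    by (intro add_mono W_bound_lipschitz[OF t bf K] W_bound[OF t br]) (use f(2) in \<open>simp add: K_def\<close>)
  also have "K0 (t / 2) * (K0 (t / 2) * (M * \<delta> powr \<gamma>)) = c1 * c1 * M * t powr ((\<gamma> - 2) / \<alpha>)"
    unfolding K0_half[OF t(1)] p1 p2(2)[symmetric] p2(1)[symmetric] by simp
  also have "K0 (t / 2) * K = c1 * M * t powr ((\<gamma> - 2) / \<alpha>)"
    unfolding K0_half[OF t(1)] K_def p1 p2(2)[symmetric] by simp
  finally show "norm (W t \<phi> i x) \<le> c2 * M * t powr ((\<gamma> - 2) / \<alpha>)" by (simp add: c2_def algebra_simps)
qed

text \<open>Interpolates with weight \<theta> between the Lipschitz bound for G (through W) and its
  sup bound; the exponents (\<gamma>-2)/\<alpha> and (\<gamma>-1)/\<alpha> average to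
  (\<gamma>-1-\<theta>)/\<alpha>.\<close>

lemma G_holder:
  assumes t: "0 < t" "t \<le> T" and \<phi>: "bc C \<phi>" and M: "0 \<le> M" "\<And>x y. \<bar>\<phi> x - \<phi> y\<bar> \<le> M * norm (x - y) powr \<gamma>" 
    and g: "0 \<le> \<gamma>" "\<gamma> \<le> 1" and th: "0 \<le> \<theta>" "\<theta> \<le> 1"
  shows "norm (G t \<phi> x - G t \<phi> y) \<le> c3 * M * t powr ((\<gamma> - 1 - \<theta>) / \<alpha>) * norm (x - y) powr \<theta>"
proof -
  note I = interpolation[OF t \<phi> M g]
  let ?r = "norm (x - y)"
  have 1: "norm (G t \<phi> x - G t \<phi> y) \<le> (c3 * M) * (t powr ((\<gamma> - 2) / \<alpha>) * ?r)"
  proof -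
    have "norm (G t \<phi> x - G t \<phi> y) \<le> real CARD('n) * (c2 * M * t powr ((\<gamma> - 2) / \<alpha>)) * ?r"
      by (rule vector_lipschitz[OF W_gderiv[OF t \<phi>] I(2)])
    also have "\<dots> = (real CARD('n) * c2) * (M * (t powr ((\<gamma> - 2) / \<alpha>) * ?r))" by simp
    also have "\<dots> \<le> c3 * (M * (t powr ((\<gamma> - 2) / \<alpha>) * ?r))"
      by (intro mult_right_mono mult_nonneg_nonneg M(1)) (use c0 in \<open>auto simp: c3_def\<close>)
    finally show ?thesis by (simp add: mult.assoc)
  qed
  have 2: "norm (G t \<phi> x - G t \<phi> y) \<le> (c3 * M) * t powr ((\<gamma> - 1) / \<alpha>)"
  proof -
    have "norm (G t \<phi> x - G t \<phi> y) \<le> (2 * (c0 + 1)) * (M * t powr ((\<gamma> - 1) / \<alpha>))"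
      using norm_triangle_ineq4[of "G t \<phi> x" "G t \<phi> y"] I(1)[of x] I(1)[of y] by (simp add: algebra_simps)
    also have "\<dots> \<le> c3 * (M * t powr ((\<gamma> - 1) / \<alpha>))"
      by (intro mult_right_mono mult_nonneg_nonneg M(1)) (use c_nonneg in \<open>auto simp: c3_def\<close>)
    finally show ?thesis by (simp add: mult.assoc)
  qed
  have cM: "0 \<le> c3 * M" using c_nonneg M by simp
  have "norm (G t \<phi> x - G t \<phi> y) \<le> ((c3 * M) * (t powr ((\<gamma> - 2) / \<alpha>) * ?r)) powr \<theta> * ((c3 * M) * t powr ((\<gamma> - 1) / \<alpha>)) powr (1 - \<theta>)"
    by (rule powr_interp[OF norm_ge_zero 1 2 th])
  also have "\<dots> = ((c3 * M) powr \<theta> * (c3 * M) powr (1 - \<theta>)) * ((t powr ((\<gamma> - 2) / \<alpha>)) powr \<theta> * (t powr ((\<gamma> - 1) / \<alpha>)) powr (1 - \<theta>)) * ?r powr \<theta>"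
    using cM by (simp add: powr_mult)
  also have "(t powr ((\<gamma> - 2) / \<alpha>)) powr \<theta> * (t powr ((\<gamma> - 1) / \<alpha>)) powr (1 - \<theta>) = t powr ((\<gamma> - 1 - \<theta>) / \<alpha>)"
  proof -
    have "(\<gamma> - 2) / \<alpha> * \<theta> + (\<gamma> - 1) / \<alpha> * (1 - \<theta>) = (\<gamma> - 1 - \<theta>) / \<alpha>"
      using alpha by (simp add: field_simps)
    then show ?thesis unfolding powr_powr powr_add[symmetric] by simp
  qed
  also have "(c3 * M) powr \<theta> * (c3 * M) powr (1 - \<theta>) = c3 * M" using cM by (simp add: powr_add[symmetric])
  finally show ?thesis .
qed

end

subsection \<open>Mild solutions\<close>

lemma integrable_itv_powr:
  assumes "-1 < a" "0 \<le> t" shows "integrable (itv 0 t) (\<lambda>r. r powr a)"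
proof -
  have "(\<lambda>r. r powr a) integrable_on {0<..t}" by (rule integrable_on_powr_from_0'[OF assms])
  then have "(\<lambda>r. r powr a) absolutely_integrable_on {0<..t}"
    by (rule nonnegative_absolutely_integrable_1) simp
  then have "integrable (completion lborel) (\<lambda>r. indicator {0<..t} r *\<^sub>R r powr a)" by (simp add: set_integrable_def)
  then have "set_integrable lborel {0<..t} (\<lambda>r. r powr a)"
    unfolding set_integrable_def by (subst (asm) integrable_completion) measurable
  then show ?thesis unfolding integrable_itv by (rule set_integrable_subset) auto
qed

lemma itv_reflect:
  fixes g :: "real \<Rightarrow> real"
  assumes "g \<in> borel_measurable (itv 0 t)"
  shows "(\<integral>s. g s \<partial>itv 0 t) = (\<integral>r. g (t - r) \<partial>itv 0 t)"
proof -
  have "(\<lambda>s. indicator {0<..<t} s *\<^sub>R g s) \<in> borel_measurable lborel"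
    by (rule borel_measurable_restrict_space_iff[THEN iffD1, OF _ assms[unfolded itv_def]]) simp
  then have m: "(\<lambda>s. indicator {0<..<t} s *\<^sub>R g s) \<in> borel_measurable borel"
    by (simp only: measurable_lborel2)
  have "(\<integral>s. indicator {0<..<t} s *\<^sub>R g s \<partial>lborel) = (\<integral>s. indicator {0<..<t} (t + (-1) *\<^sub>R s) *\<^sub>R g (t + (-1) *\<^sub>R s) \<partial>lborel)"
    using lborel_integral_affine(1)[OF _ m, of "-1" t] by simp
  also have "\<dots> = (\<integral>r. indicator {0<..<t} r *\<^sub>R g (t - r) \<partial>lborel)"
    by (intro Bochner_Integration.integral_cong) (auto simp: indicator_def)
  finally show ?thesis unfolding integral_itv set_lebesgue_integral_def .
qed

text \<open>Bounded functions count as Holder of exponent 0, so \<open>interpolation\<close> and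
  \<open>G_holder\<close> cover them too. Since 0 powr 0 = 0, the case x = y is separate.\<close>

lemma holder_0: "bc C \<phi> \<Longrightarrow> \<bar>\<phi> x - \<phi> y\<bar> \<le> 2 * C * norm (x - y) powr 0" for \<phi> :: "'a::real_normed_vector \<Rightarrow> real"
  using bcD(2)[of C \<phi> x] bcD(2)[of C \<phi> y] by (cases "x = y") auto

lemma bounded_gradient:
  assumes "Cb 1 f" obtains B where "\<And>x. norm (gradient f x) \<le> B"
proof -
  have "\<forall>i. \<exists>b. \<forall>x. \<bar>partial_deriv i f x\<bar> \<le> b" using assms by (auto simp: bounded_iff)
  then obtain b where b: "\<And>i x. \<bar>partial_deriv i f x\<bar> \<le> b i" by metis
  have "norm (gradient f x) \<le> (\<Sum>i\<in>UNIV. b i)" for x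
    using order_trans[OF norm_le_l1_cart sum_mono] b by (metis (mono_tags, lifting) gradient_def vec_lambda_beta)
  then show ?thesis by (rule that)
qed

lemma Cb1_norm_bounds:
  assumes "Cb 1 f" shows "\<bar>f x\<bar> \<le> Cb1_norm f" "norm (gradient f x) \<le> Cb1_norm f"
proof -
  obtain b where b: "\<And>x. norm (gradient f x) \<le> b" using bounded_gradient[OF assms] by blast
  obtain a where a: "\<And>x. \<bar>f x\<bar> \<le> a" using assms by (auto simp: bounded_iff)
  have 1: "\<bar>f x\<bar> \<le> (SUP x. \<bar>f x\<bar>)" for x by (rule cSUP_upper) (use a in \<open>auto intro!: bdd_aboveI2\<close>)
  have 2: "norm (gradient f x) \<le> (SUP x. norm (gradient f x))" for x by (rule cSUP_upper) (use b in \<open>auto intro!: bdd_aboveI2\<close>)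
  show "\<bar>f x\<bar> \<le> Cb1_norm f" "norm (gradient f x) \<le> Cb1_norm f"
    unfolding Cb1_norm_def using 1[of x] 2[of x] abs_ge_zero[of "f x"] norm_ge_zero[of "gradient f x"] by linarith+
qed

lemma Cb1_gderiv: "Cb 1 f \<Longrightarrow> GDERIV f x :> gradient f x"
  by (rule differentiable_gderiv) simp

lemma Cb1_gradient_cont: "Cb 1 f \<Longrightarrow> continuous_on UNIV (gradient f)"
  unfolding gradient_def[abs_def] by (intro continuous_on_vec_lambda) simp

lemma Cb1_diff:
  assumes f: "Cb 1 f" and g: "Cb 1 g"
  shows "Cb 1 (\<lambda>x. f x - g x)" "gradient (\<lambda>x. f x - g x) x = gradient f x - gradient g x"
proof -
  have G: "GDERIV (\<lambda>x. f x - g x) x :> gradient f x - gradient g x" for x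
    by (intro GDERIV_diff Cb1_gderiv f g)
  then show gr: "gradient (\<lambda>x. f x - g x) x = gradient f x - gradient g x" for x by (rule gderiv_gradient)
  have pd: "partial_deriv i h = (\<lambda>x. gradient h x $ i)" for i and h :: "real^'n \<Rightarrow> real" by (auto simp: gradient_def)
  have d: "(\<lambda>x. f x - g x) differentiable at x" for x using G[of x] by (auto simp: gderiv_def differentiable_def)
  have p: "partial_deriv i (\<lambda>x. f x - g x) = (\<lambda>x. partial_deriv i f x - partial_deriv i g x)" for i
    using gr unfolding pd by simp
  show "Cb 1 (\<lambda>x. f x - g x)" using f g d unfolding One_nat_def Cb.simps p
    by (auto intro!: continuous_on_diff bounded_minus_comp simp: bounded_minus_comp)
qed

context levy_kernel
begin

lemma P_lipschitz_bound:
  assumes t: "0 < t" "t \<le> T" and \<phi>: "bc C \<phi>"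
  shows "\<bar>P t \<phi> x - P t \<phi> y\<bar> \<le> K0 t * C * norm (x - y)"
  by (rule gderiv_bound[OF G_gderiv[OF t \<phi>] G_bound[OF t \<phi>]])

text \<open>All P r \<phi> with r > t/2 share the Lipschitz constant that P (t/2) produces from the
  bound \<open>C\<close>. A small additional time then moves them little, uniformly in
  \<phi>.\<close>

lemma P_time_uniform:
  assumes t: "0 < t" "t \<le> T" and C: "0 \<le> C" and e: "0 < e"
  obtains d where "0 < d" "\<And>t' \<phi> x. 0 < t' \<Longrightarrow> \<bar>t' - t\<bar> < d \<Longrightarrow> bc C \<phi> \<Longrightarrow> \<bar>P t' \<phi> x - P t \<phi> x\<bar> \<le> e"
proof -
  define s where "s = t / 2"
  have s: "0 < s" "s \<le> T" "s < t" using t by (auto simp: s_def)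
  define K where "K = K0 s * C"
  have K: "0 \<le> K" using K0_nonneg C by (simp add: K_def)
  obtain d where d: "0 < d" "\<And>h \<phi> x. 0 < h \<Longrightarrow> h < d \<Longrightarrow> bc C \<phi> \<Longrightarrow> (\<And>x y. \<bar>\<phi> x - \<phi> y\<bar> \<le> K * norm (x - y))
    \<Longrightarrow> \<bar>P h \<phi> x - \<phi> x\<bar> \<le> e" using P_lipschitz_time[OF e K] by blast
  have lip: "\<bar>P r \<phi> x - P r \<phi> y\<bar> \<le> K * norm (x - y)" if r: "s < r" and \<phi>: "bc C \<phi>" for r \<phi> x y
  proof -
    have "P r \<phi> = P (r - s) (P s \<phi>)" using P_semigroup[of "r - s" s C \<phi>] s r \<phi> by auto
    then show ?thesis
      using P_lipschitz[OF _ P_bc[OF s(1) \<phi>] P_lipschitz_bound[OF s(1,2) \<phi>], of "r - s"] r unfolding K_def by simp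
  qed
  have key: "\<bar>P r2 \<phi> x - P r1 \<phi> x\<bar> \<le> e" if r: "s < r1" "r1 < r2" "r2 - r1 < d" and \<phi>: "bc C \<phi>" for r1 r2 \<phi> x
  proof -
    have r1: "0 < r1" using s r by linarith
    have "P r2 \<phi> x = P (r2 - r1) (P r1 \<phi>) x" using P_semigroup[of "r2 - r1" r1 C \<phi> x] r r1 \<phi> by auto
    then show ?thesis using d(2)[OF _ r(3) P_bc[OF r1 \<phi>] lip[OF r(1) \<phi>], of x] r(2) by simp
  qed
  show ?thesis
  proof (rule that[of "min d s"])
    show "0 < min d s" using d s by simp
    fix t' and \<phi> :: "real^'n \<Rightarrow> real" and x assume a: "0 < t'" "\<bar>t' - t\<bar> < min d s" "bc C \<phi>"
    then have "s < t'" using s_def by linarith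
    then show "\<bar>P t' \<phi> x - P t \<phi> x\<bar> \<le> e"
      using key[of t' t \<phi> x] key[of t t' \<phi> x] a s(3) e by (cases t t' rule: linorder_cases) (auto simp: abs_minus_commute)
  qed
qed

lemma P_joint_tendsto:
  assumes t: "0 < t" "t \<le> T" and \<tau>: "\<tau> \<longlonglongrightarrow> t" "\<And>n. 0 < \<tau> n" and \<phi>n: "\<And>n. bc C (\<phi>n n)"
    and lim: "\<And>y. (\<lambda>n. \<phi>n n (X n - y)) \<longlonglongrightarrow> \<phi> (x - y)"
  shows "(\<lambda>n. P (\<tau> n) (\<phi>n n) (X n)) \<longlonglongrightarrow> P t \<phi> x"
proof -
  have 1: "(\<lambda>n. P t (\<phi>n n) (X n)) \<longlonglongrightarrow> P t \<phi> x"
    by (rule P_tendsto[OF t(1) bc_borel[OF \<phi>n] bcD(2)[OF \<phi>n] lim])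
  have "(\<lambda>n. P (\<tau> n) (\<phi>n n) (X n) - P t (\<phi>n n) (X n)) \<longlonglongrightarrow> 0"
    unfolding LIMSEQ_iff
  proof (intro allI impI)
    fix e :: real assume "0 < e"
    then obtain d where d: "0 < d" "\<And>t' \<phi> x. 0 < t' \<Longrightarrow> \<bar>t' - t\<bar> < d \<Longrightarrow> bc C \<phi> \<Longrightarrow> \<bar>P t' \<phi> x - P t \<phi> x\<bar> \<le> e / 2"
      using P_time_uniform[OF t bc_nonneg[OF \<phi>n], of "e / 2"] by (metis half_gt_zero)
    obtain N where "\<And>n. N \<le> n \<Longrightarrow> norm (\<tau> n - t) < d" using \<tau>(1) d(1) unfolding LIMSEQ_iff by blast
    then have "\<bar>P (\<tau> n) (\<phi>n n) (X n) - P t (\<phi>n n) (X n)\<bar> \<le> e / 2" if "N \<le> n" for n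
      using d(2)[OF \<tau>(2) _ \<phi>n] that by simp
    then show "\<exists>N. \<forall>n\<ge>N. norm (P (\<tau> n) (\<phi>n n) (X n) - P t (\<phi>n n) (X n) - 0) < e"
      using \<open>0 < e\<close> by (intro exI[of _ N]) force
  qed
  from tendsto_add[OF this 1] show ?thesis by simp
qed

lemma W_joint_tendsto:
  assumes t: "0 < t" "t \<le> T" and \<tau>: "\<tau> \<longlonglongrightarrow> t" "\<And>n. \<tau> n \<le> T" and \<phi>: "bc C \<phi>" and X: "X \<longlonglongrightarrow> x"
  shows "(\<lambda>n. W (\<tau> n) \<phi> i (X n)) \<longlonglongrightarrow> W t \<phi> i x"
proof -
  define s where "s = t / 2"
  have s: "0 < s" "s \<le> T" "s < t" using t by (auto simp: s_def)
  \<comment> \<open>The maximum keeps every time positive (at least t/4); eventually it equals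
    \<tau> n - s.\<close>
  define \<tau>' where "\<tau>' n = max (\<tau> n) (3 * t / 4) - s" for n
  have p: "0 < \<tau>' n" for n using t by (simp add: \<tau>'_def s_def less_max_iff_disj)
  have l: "\<tau>' \<longlonglongrightarrow> t - s"
  proof -
    have "\<tau>' \<longlonglongrightarrow> max t (3 * t / 4) - s" unfolding \<tau>'_def by (intro tendsto_intros \<tau>)
    then show ?thesis using t by (simp add: max_def)
  qed
  have "(\<lambda>n. W s (P (\<tau>' n) \<phi>) i (X n)) \<longlonglongrightarrow> W s (P (t - s) \<phi>) i x"
  proof (rule W_tendsto[OF s(1,2) P_bc[OF p \<phi>] P_bc[OF _ \<phi>]])
    show "0 < t - s" using s by simp
    show "(\<lambda>n. P (\<tau>' n) \<phi> (X n - y)) \<longlonglongrightarrow> P (t - s) \<phi> (x - y)" for y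
      by (rule P_joint_tendsto[OF _ _ l p \<phi>]) (use s t in \<open>auto intro!: bc_tendsto[OF \<phi>] tendsto_intros X\<close>)
  qed
  moreover have "W s (P (t - s) \<phi>) i x = W t \<phi> i x" using W_P[of "t - s" C \<phi> s i x] s t \<phi> by simp
  moreover have "\<forall>\<^sub>F n in sequentially. W s (P (\<tau>' n) \<phi>) i (X n) = W (\<tau> n) \<phi> i (X n)"
  proof -
    have "\<forall>\<^sub>F n in sequentially. 3 * t / 4 < \<tau> n" using \<tau>(1) by (rule order_tendstoD) (use t in simp)
    then show ?thesis
    proof eventually_elim
      case (elim n)
      then have "\<tau>' n = \<tau> n - s" by (simp add: \<tau>'_def)
      then show ?case using W_P[OF p[of n] \<phi> s(1), of i "X n"] \<tau>(2)[of n] by simp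
    qed
  qed
  ultimately show ?thesis using Lim_transform_eventually by fastforce
qed

end

section \<open>The mild solution and its source term\<close>

locale mild = levy_kernel A \<mu> p T \<alpha> c0
  for A :: "real^'n^'n" and \<mu> :: "(real^'n) measure" and p T \<alpha> c0 +
  fixes \<beta> :: real and H :: "real \<Rightarrow> real^'n \<Rightarrow> real^'n \<Rightarrow> real"
    and u0 :: "real^'n \<Rightarrow> real" and u :: "real \<Rightarrow> real^'n \<Rightarrow> real"
  assumes beta: "0 < \<beta>" "\<beta> \<le> 1"
    and H_cont: "continuous_on ({0..T} \<times> UNIV \<times> UNIV) (\<lambda>(t, x, q). H t x q)"
    and H_zero: "\<exists>H0>0. \<forall>t\<in>{0<..<T}. \<forall>x. \<bar>H t x 0\<bar> \<le> H0"
    and H_lipschitz: "\<forall>R>0. \<exists>L>0. \<forall>t\<in>{0<..<T}. \<forall>x. \<forall>q\<in>ball 0 R. \<forall>r\<in>ball 0 R.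
          \<bar>H t x q - H t x r\<bar> \<le> L * norm (q - r)"
    and H_holder: "\<forall>R>0. \<exists>M>0. \<forall>t\<in>{0..T}. \<forall>q\<in>ball 0 R. \<forall>x y. norm (x - y) < 1 \<longrightarrow>
          \<bar>H t x q - H t y q\<bar> \<le> M * norm (x - y) powr \<beta>"
    and u0_bounded: "bounded (range u0)"
    and u0_lipschitz: "\<exists>C. C-lipschitz_on UNIV u0"
    and u_space: "bounded_cont_into_Cb1 T u"
    and u_mild: "mild_solution p H T u0 u"
begin

definition v :: "real \<Rightarrow> real^'n \<Rightarrow> real^'n" where "v s = gradient (u s)"

text \<open>The nonlinearity frozen along \<open>u\<close>: from here on the equation is linear with
  source \<open>f\<close>.\<close>

definition f :: "real \<Rightarrow> real^'n \<Rightarrow> real" where "f s y = H s y (v s y)"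

lemma u_Cb1: "0 < s \<Longrightarrow> s \<le> T \<Longrightarrow> Cb 1 (u s)"
  using u_space by (auto simp: bounded_cont_into_Cb1_def cont_into_Cb1_def)

lemma u_gderiv: "0 < s \<Longrightarrow> s \<le> T \<Longrightarrow> GDERIV (u s) x :> v s x"
  unfolding v_def by (intro Cb1_gderiv u_Cb1)

lemma u_bounds: "\<exists>B>0. \<forall>s x. 0 < s \<longrightarrow> s \<le> T \<longrightarrow> \<bar>u s x\<bar> \<le> B \<and> norm (v s x) \<le> B"
proof -
  obtain B where B: "\<forall>s\<in>{0<..T}. Cb1_norm (u s) \<le> B" using u_space unfolding bounded_cont_into_Cb1_def by blast
  show ?thesis
  proof (intro exI[of _ "\<bar>B\<bar> + 1"] conjI allI impI)
    fix s x assume s: "0 < s" "s \<le> T"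
    have "Cb1_norm (u s) \<le> B" using B s by simp
    then show "\<bar>u s x\<bar> \<le> \<bar>B\<bar> + 1" "norm (v s x) \<le> \<bar>B\<bar> + 1"
      using Cb1_norm_bounds[OF u_Cb1[OF s], of x] unfolding v_def by linarith+
  qed simp
qed

lemma u_joint:
  assumes s: "0 < s" "s \<le> T" and S: "S \<longlonglongrightarrow> s" "\<And>n. 0 < S n" "\<And>n. S n \<le> T" and X: "X \<longlonglongrightarrow> x"
  shows "(\<lambda>n. u (S n) (X n)) \<longlonglongrightarrow> u s x" "(\<lambda>n. v (S n) (X n)) \<longlonglongrightarrow> v s x" "(\<lambda>n. f (S n) (X n)) \<longlonglongrightarrow> f s x"
proof -
  have "((\<lambda>r. Cb1_norm (\<lambda>x. u r x - u s x)) \<longlongrightarrow> 0) (at s within {0<..T})"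
    using u_space s by (auto simp: bounded_cont_into_Cb1_def cont_into_Cb1_def)
  \<comment> \<open>The limit in the hypothesis excludes the point s, but the sequence
    \<open>S\<close> may hit it; the value at s turns the limit into continuity.\<close>
  moreover have "Cb1_norm (\<lambda>x. u s x - u s x) = 0"
  proof -
    have "gradient (\<lambda>x. u s x - u s x) x = 0" for x using Cb1_diff(2)[OF u_Cb1[OF s] u_Cb1[OF s]] by simp
    then show ?thesis unfolding Cb1_norm_def by simp
  qed
  ultimately have c: "continuous (at s within {0<..T}) (\<lambda>r. Cb1_norm (\<lambda>x. u r x - u s x))"
    unfolding continuous_within by simp
  have "(\<lambda>n. Cb1_norm (\<lambda>x. u (S n) x - u s x)) \<longlonglongrightarrow> Cb1_norm (\<lambda>x. u s x - u s x)"
    using c S unfolding continuous_within_sequentially comp_def by auto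
  then have z: "(\<lambda>n. Cb1_norm (\<lambda>x. u (S n) x - u s x)) \<longlonglongrightarrow> 0"
    using \<open>Cb1_norm (\<lambda>x. u s x - u s x) = 0\<close> by simp
  note b = Cb1_norm_bounds[OF Cb1_diff(1)[OF u_Cb1[OF S(2,3)] u_Cb1[OF s]], unfolded Cb1_diff(2)[OF u_Cb1[OF S(2,3)] u_Cb1[OF s]]]
  have "(\<lambda>n. u (S n) (X n) - u s (X n)) \<longlonglongrightarrow> 0"
    by (rule Lim_null_comparison[OF _ z]) (use b(1) in simp)
  moreover have "(\<lambda>n. u s (X n)) \<longlonglongrightarrow> u s x"
    by (rule isCont_tendsto_compose[OF gderiv_continuous[OF u_gderiv[OF s]] X])
  ultimately show "(\<lambda>n. u (S n) (X n)) \<longlonglongrightarrow> u s x" using tendsto_add by fastforce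
  have "(\<lambda>n. v (S n) (X n) - v s (X n)) \<longlonglongrightarrow> 0"
    by (rule Lim_null_comparison[OF _ z]) (use b(2) in \<open>simp add: v_def\<close>)
  moreover have "(\<lambda>n. v s (X n)) \<longlonglongrightarrow> v s x"
    using continuous_on_tendsto_compose[OF Cb1_gradient_cont[OF u_Cb1[OF s]] X] by (simp add: v_def)
  ultimately show vl: "(\<lambda>n. v (S n) (X n)) \<longlonglongrightarrow> v s x" using tendsto_add by fastforce
  have "(\<lambda>n. (\<lambda>(t, x, q). H t x q) (S n, X n, v (S n) (X n))) \<longlonglongrightarrow> (\<lambda>(t, x, q). H t x q) (s, x, v s x)"
    by (rule continuous_on_tendsto_compose[OF H_cont]) (use S s X vl in \<open>auto intro!: tendsto_Pair always_eventually simp: less_imp_le\<close>)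
  then show "(\<lambda>n. f (S n) (X n)) \<longlonglongrightarrow> f s x" by (simp add: f_def)
qed

lemma f_cont: assumes s: "0 < s" "s \<le> T" shows "continuous_on UNIV (f s)"
  unfolding continuous_on_sequentially comp_def
  using u_joint(3)[OF s, of "\<lambda>_. s"] s by auto

text \<open>Stated below T because the bounds on H are; the Duhamel integrals run over open
  intervals and see only such times.\<close>

lemma f_bound: "\<exists>F>0. \<forall>s. 0 < s \<longrightarrow> s < T \<longrightarrow> bc F (f s)"
proof -
  obtain B where B: "0 < B" "\<forall>s x. 0 < s \<longrightarrow> s \<le> T \<longrightarrow> \<bar>u s x\<bar> \<le> B \<and> norm (v s x) \<le> B" using u_bounds by blast
  obtain H0 where H0: "0 < H0" "\<forall>t\<in>{0<..<T}. \<forall>x. \<bar>H t x 0\<bar> \<le> H0" using H_zero by blast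
  \<comment> \<open>The balls in the hypotheses on H are open, while |v| may attain B.\<close>
  have "0 < B + 1" using B(1) by simp
  with H_lipschitz have "\<exists>L>0. \<forall>t\<in>{0<..<T}. \<forall>x. \<forall>q\<in>ball 0 (B + 1). \<forall>r\<in>ball 0 (B + 1).
          \<bar>H t x q - H t x r\<bar> \<le> L * norm (q - r)" by blast
  then obtain L where L: "0 < L" "\<forall>t\<in>{0<..<T}. \<forall>x. \<forall>q\<in>ball 0 (B + 1). \<forall>r\<in>ball 0 (B + 1).
          \<bar>H t x q - H t x r\<bar> \<le> L * norm (q - r)" by blast
  show ?thesis
  proof (intro exI[of _ "H0 + L * B"] conjI allI impI)
    show "0 < H0 + L * B" using H0 L B by (simp add: add_pos_pos)
    fix s assume s: "0 < s" "s < T"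
    show "bc (H0 + L * B) (f s)" unfolding bc_def
    proof (intro conjI allI f_cont)
      fix x
      have n: "norm (v s x) \<le> B" using B(2) s by simp
      have "\<bar>H s x (v s x) - H s x 0\<bar> \<le> L * norm (v s x - 0)" 
        by (rule L(2)[THEN bspec, THEN spec, THEN bspec, THEN bspec]) (use n \<open>0 < B + 1\<close> s in simp_all)
      moreover have "L * norm (v s x) \<le> L * B" using n L by simp
      moreover have "\<bar>H s x 0\<bar> \<le> H0" using H0(2) s by simp
      ultimately show "\<bar>f s x\<bar> \<le> H0 + L * B" unfolding f_def by simp
    qed (use s in auto)
  qed
qed

lemma u0_bc: "\<exists>C\<ge>0. bc C u0 \<and> (\<forall>x y. \<bar>u0 x - u0 y\<bar> \<le> C * norm (x - y))"
proof -
  obtain a where a: "\<And>x. \<bar>u0 x\<bar> \<le> a" using u0_bounded by (auto simp: bounded_iff)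
  obtain L where L: "L-lipschitz_on UNIV u0" using u0_lipschitz by blast
  have L0: "0 \<le> L" using L by (rule lipschitz_on_nonneg)
  have c: "continuous_on UNIV u0" using L by (rule lipschitz_on_continuous_on)
  have l: "\<bar>u0 x - u0 y\<bar> \<le> (\<bar>a\<bar> + L) * norm (x - y)" for x y
  proof -
    have "\<bar>u0 x - u0 y\<bar> \<le> L * norm (x - y)" using lipschitz_onD[OF L, of x y] by (simp add: dist_norm)
    also have "\<dots> \<le> (\<bar>a\<bar> + L) * norm (x - y)" by (intro mult_right_mono) auto
    finally show ?thesis .
  qed
  have "bc (\<bar>a\<bar> + L) u0" unfolding bc_def
  proof (intro conjI c allI)
    show "\<bar>u0 x\<bar> \<le> \<bar>a\<bar> + L" for x using a[of x] L0 by linarith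
  qed
  then show ?thesis using l L0 by (intro exI[of _ "\<bar>a\<bar> + L"]) simp
qed

lemma Pf_joint:
  assumes t: "t \<le> T" and s: "0 < s" "s < t" and S: "S \<longlonglongrightarrow> s" "\<And>n. 0 < S n" "\<And>n. S n < t" and X: "X \<longlonglongrightarrow> x"
  shows "(\<lambda>n. P (t - S n) (f (S n)) (X n)) \<longlonglongrightarrow> P (t - s) (f s) x"
proof -
  obtain F where F': "\<forall>s. 0 < s \<longrightarrow> s < T \<longrightarrow> bc F (f s)" using f_bound by blast
  have F: "bc F (f s)" if "0 < s" "s < T" for s using F' that by blast
  have ST: "S n < T" "S n \<le> T" for n using S(3)[of n] t by auto
  show ?thesis
  proof (rule P_joint_tendsto[OF _ _ _ _ F[OF S(2) ST(1)]])
    show "(\<lambda>n. t - S n) \<longlonglongrightarrow> t - s" by (intro tendsto_intros S)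
    show "(\<lambda>n. f (S n) (X n - y)) \<longlonglongrightarrow> f s (x - y)" for y
      by (rule u_joint(3)[OF s(1) _ S(1,2) ST(2)]) (use t s in \<open>auto intro!: tendsto_intros X\<close>)
  qed (use s t S(3) in auto)
qed

lemma Pf_measurable:
  assumes t: "t \<le> T" 
  shows "(\<lambda>s. P (t - s) (f s) x) \<in> borel_measurable (itv 0 t)"
proof (rule borel_measurable_itv)
  show "continuous_on {0<..<t} (\<lambda>s. P (t - s) (f s) x)"
    unfolding continuous_on_sequentially comp_def using Pf_joint[OF t, of _ _ "\<lambda>_. x" x] by auto
qed

text \<open>Continuity on the open strip yields the product measurability that Fubini needs in
  \<open>restart\<close>.\<close>

lemma Pf_joint_measurable:
  assumes t: "t \<le> T" and r: "0 < r" "r < t"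
  shows "(\<lambda>(s, y). P (r - s) (f s) y) \<in> borel_measurable (itv 0 r \<Otimes>\<^sub>M borel)"
proof -
  have c: "continuous_on ({0<..<r} \<times> UNIV) (\<lambda>(s, y). P (r - s) (f s) y)"
    unfolding continuous_on_sequentially comp_def
  proof (intro allI ballI impI)
    fix Z and z :: "real \<times> (real^'n)" assume z: "z \<in> {0<..<r} \<times> UNIV" and Z: "(\<forall>n. Z n \<in> {0<..<r} \<times> UNIV) \<and> Z \<longlonglongrightarrow> z"
    have "(\<lambda>n. P (r - fst (Z n)) (f (fst (Z n))) (snd (Z n))) \<longlonglongrightarrow> P (r - fst z) (f (fst z)) (snd z)"
      by (rule Pf_joint) (use z Z t r in \<open>auto simp: mem_Times_iff intro!: tendsto_fst tendsto_snd\<close>)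
    then show "(\<lambda>n. case Z n of (s, y) \<Rightarrow> P (r - s) (f s) y) \<longlonglongrightarrow> (case z of (s, y) \<Rightarrow> P (r - s) (f s) y)"
      by (simp add: case_prod_unfold)
  qed
  have g: "(\<lambda>z. indicator ({0<..<r} \<times> UNIV) z *\<^sub>R (case z of (s, y) \<Rightarrow> P (r - s) (f s) y)) \<in> borel_measurable (borel \<Otimes>\<^sub>M borel)"
    unfolding borel_prod by (rule borel_measurable_continuous_on_indicator[OF _ c]) (intro borel_open open_Times; simp)
  have [measurable]: "(\<lambda>s. s) \<in> borel_measurable (itv 0 r)" unfolding itv_def by (rule measurable_restrict_space1) simp
  have "(\<lambda>z. (fst z, snd z)) \<in> itv 0 r \<Otimes>\<^sub>M borel \<rightarrow>\<^sub>M borel \<Otimes>\<^sub>M (borel :: (real^'n) measure)" by measurable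
  from measurable_compose[OF this g]
  show ?thesis by (rule measurable_cong[THEN iffD1, rotated]) (auto simp: space_pair_measure)
qed

text \<open>The reflected form places the singularity of the kernel at r = 0 for every t, which
  suits differentiation in x.\<close>

lemma mild_formula:
  assumes t: "0 < t" "t \<le> T"
  shows "u t x = P t u0 x + (\<integral>s. P (t - s) (f s) x \<partial>itv 0 t)"
    and "u t x = P t u0 x + (\<integral>r. P r (f (t - r)) x \<partial>itv 0 t)"
    and "integrable (itv 0 t) (\<lambda>s. P (t - s) (f s) x)"
    and "integrable (itv 0 t) (\<lambda>r. P r (f (t - r)) x)"
proof -
  obtain C where C: "bc C u0" using u0_bc by blast
  obtain F where F': "\<forall>s. 0 < s \<longrightarrow> s < T \<longrightarrow> bc F (f s)" using f_bound by blast
  have F: "bc F (f s)" if "0 < s" "s < T" for s using F' that by blast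
  have 1: "u t x = heat_semigroup p t u0 x + (\<integral>s. heat_semigroup p (t - s) (f s) x \<partial>itv 0 t)"
    using u_mild t unfolding mild_solution_def f_def[abs_def] v_def
    by (simp add: interval_integral_itv[symmetric] zero_ereal_def)
  have "(\<integral>s. heat_semigroup p (t - s) (f s) x \<partial>itv 0 t) = (\<integral>s. P (t - s) (f s) x \<partial>itv 0 t)"
    by (intro Bochner_Integration.integral_cong heat_semigroup_eq) (use F[THEN bc_borel] t in auto)
  then show u: "u t x = P t u0 x + (\<integral>s. P (t - s) (f s) x \<partial>itv 0 t)"
    unfolding 1 heat_semigroup_eq[OF t(1) bc_borel[OF C]] by simp
  show "u t x = P t u0 x + (\<integral>r. P r (f (t - r)) x \<partial>itv 0 t)"
    unfolding u using itv_reflect[OF Pf_measurable[OF t(2)]] by simp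
  interpret finite_measure "itv 0 t" by (rule finite_itv)
  show "integrable (itv 0 t) (\<lambda>s. P (t - s) (f s) x)"
    by (rule integrable_const_bound[of _ F]) (use t F[THEN bcD(2)] Pf_measurable[OF t(2)] in \<open>auto intro!: AE_I2 P_bound\<close>)
  have m: "(\<lambda>r. P r (f (t - r)) x) \<in> borel_measurable (itv 0 t)"
  proof (rule borel_measurable_itv)
    have c: "continuous_on {0<..<t} (\<lambda>s. P (t - s) (f s) x)"
      unfolding continuous_on_sequentially comp_def using Pf_joint[OF t(2), of _ _ "\<lambda>_. x" x] by auto
    have "continuous_on {0<..<t} (\<lambda>r. P (t - (t - r)) (f (t - r)) x)"
      by (rule continuous_on_compose2[OF c]) (auto intro!: continuous_intros)
    then show "continuous_on {0<..<t} (\<lambda>r. P r (f (t - r)) x)" by simp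
  qed
  show "integrable (itv 0 t) (\<lambda>r. P r (f (t - r)) x)"
    by (rule integrable_const_bound[of _ F]) (use t F[THEN bcD(2)] m in \<open>auto intro!: AE_I2 P_bound\<close>)
qed

end

subsection \<open>Holder regularity of the gradient\<close>

lemma itv_split:
  fixes g :: "real \<Rightarrow> real"
  assumes "a \<le> s" "s \<le> t" and g: "integrable (itv a t) g"
  shows "integrable (itv a s) g" "integrable (itv s t) g"
    "(\<integral>r. g r \<partial>itv a t) = (\<integral>r. g r \<partial>itv a s) + (\<integral>r. g r \<partial>itv s t)"
proof -
  have i: "set_integrable lborel {a<..<t} g" using g by (simp add: integrable_itv)
  show "integrable (itv a s) g" "integrable (itv s t) g"
    unfolding integrable_itv by (rule set_integrable_subset[OF i]; use assms in auto)+
  have m: "min (ereal a) (min (ereal s) (ereal t)) = ereal a" "max (ereal a) (max (ereal s) (ereal t)) = ereal t"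
    using assms by (simp_all add: min_def max_def)
  have "interval_lebesgue_integrable lborel (min (ereal a) (min (ereal s) (ereal t))) (max (ereal a) (max (ereal s) (ereal t))) g"
    unfolding m interval_lebesgue_integrable_def using i assms by simp
  from interval_integral_sum[OF this]
  show "(\<integral>r. g r \<partial>itv a t) = (\<integral>r. g r \<partial>itv a s) + (\<integral>r. g r \<partial>itv s t)"
    using assms by (simp add: interval_integral_itv)
qed

lemma powr_le_of_le_one:
  fixes N a b :: real assumes "0 \<le> N" "N \<le> 1" "a \<le> b" shows "N powr b \<le> N powr a"
  using assms by (cases "N = 0") (auto intro: powr_mono')

context mild
begin

text \<open>Apply P (t - s) to the formula for u s, exchange integrals, and use the semigroup
  property. This isolates what happens between s and t.\<close>

lemma restart:
  assumes st: "0 < s" "s < t" "t \<le> T"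
  shows "u t x = P (t - s) (u s) x + (\<integral>\<sigma>. P (t - \<sigma>) (f \<sigma>) x \<partial>itv s t)"
    and "integrable (itv s t) (\<lambda>\<sigma>. P (t - \<sigma>) (f \<sigma>) x)"
proof -
  obtain C where C: "bc C u0" using u0_bc by blast
  obtain F where F': "\<forall>s. 0 < s \<longrightarrow> s < T \<longrightarrow> bc F (f s)" using f_bound by blast
  have F: "bc F (f s)" if "0 < s" "s < T" for s using F' that by blast
  have sT: "s \<le> T" "0 < t" "0 < t - s" using st by auto
  interpret prob_space "Q (t - s)" by (rule prob_Q[OF sT(3)])
  have m1: "(\<lambda>(\<sigma>, y). (\<sigma>, x - y)) \<in> itv 0 s \<Otimes>\<^sub>M Q (t - s) \<rightarrow>\<^sub>M itv 0 s \<Otimes>\<^sub>M borel" by measurable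
  have m: "(\<lambda>(\<sigma>, y). P (s - \<sigma>) (f \<sigma>) (x - y)) \<in> borel_measurable (itv 0 s \<Otimes>\<^sub>M Q (t - s))"
    using measurable_compose[OF m1 Pf_joint_measurable[OF st(3,1,2)]] by (simp add: case_prod_unfold)
  have bd: "norm (P (s - \<sigma>) (f \<sigma>) (x - y)) \<le> 1 * F" if "\<sigma> \<in> space (itv 0 s)" for \<sigma> y
    using P_bound[of "s - \<sigma>" "f \<sigma>" F "x - y"] F[THEN bcD(2)] that st by auto
  interpret I: finite_measure "itv 0 s" by (rule finite_itv)
  have i1: "integrable (itv 0 s) (\<lambda>_. 1::real)" "integrable (Q (t - s)) (\<lambda>_. F)" by simp_all
  note fub = fubini_dom[OF sigma_finite_itv sigma_finite_measure_axioms m i1 bd]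
  have "P (t - s) (u s) x = (\<integral>y. P s u0 (x - y) + (\<integral>\<sigma>. P (s - \<sigma>) (f \<sigma>) (x - y) \<partial>itv 0 s) \<partial>Q (t - s))"
    unfolding P_def[of "t - s" "u s"] mild_formula(1)[OF st(1) sT(1)] ..
  also have "\<dots> = (\<integral>y. P s u0 (x - y) \<partial>Q (t - s)) + (\<integral>y. \<integral>\<sigma>. P (s - \<sigma>) (f \<sigma>) (x - y) \<partial>itv 0 s \<partial>Q (t - s))"
  proof (rule Bochner_Integration.integral_add)
    show "integrable (Q (t - s)) (\<lambda>y. P s u0 (x - y))"
      by (rule P_integrable[OF sT(3) bc_borel[OF P_bc[OF st(1) C]] bcD(2)[OF P_bc[OF st(1) C]]])
    show "integrable (Q (t - s)) (\<lambda>y. \<integral>\<sigma>. P (s - \<sigma>) (f \<sigma>) (x - y) \<partial>itv 0 s)" using fub(4) by simp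
  qed
  also have "(\<integral>y. P s u0 (x - y) \<partial>Q (t - s)) = P t u0 x"
    using P_semigroup[OF sT(3) st(1) C, of x] by (simp add: P_def[of "t - s"])
  also have "(\<integral>y. \<integral>\<sigma>. P (s - \<sigma>) (f \<sigma>) (x - y) \<partial>itv 0 s \<partial>Q (t - s)) = (\<integral>\<sigma>. \<integral>y. P (s - \<sigma>) (f \<sigma>) (x - y) \<partial>Q (t - s) \<partial>itv 0 s)"
    using fub(2) by simp
  also have "\<dots> = (\<integral>\<sigma>. P (t - \<sigma>) (f \<sigma>) x \<partial>itv 0 s)"
  proof (rule Bochner_Integration.integral_cong[OF refl])
    fix \<sigma> assume "\<sigma> \<in> space (itv 0 s)"
    then have \<sigma>: "0 < \<sigma>" "\<sigma> < T" "0 < s - \<sigma>" using st by auto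
    show "(\<integral>y. P (s - \<sigma>) (f \<sigma>) (x - y) \<partial>Q (t - s)) = P (t - \<sigma>) (f \<sigma>) x"
      using P_semigroup[OF sT(3) \<sigma>(3) F[OF \<sigma>(1,2)], of x] by (simp add: P_def[of "t - s"])
  qed
  finally have e: "P (t - s) (u s) x = P t u0 x + (\<integral>\<sigma>. P (t - \<sigma>) (f \<sigma>) x \<partial>itv 0 s)" .
  note sp = itv_split[OF less_imp_le[OF st(1)] less_imp_le[OF st(2)] mild_formula(3)[OF sT(2) st(3), of x]]
  show "u t x = P (t - s) (u s) x + (\<integral>\<sigma>. P (t - \<sigma>) (f \<sigma>) x \<partial>itv s t)"
    unfolding e mild_formula(1)[OF sT(2) st(3)] sp(3) by simp
  show "integrable (itv s t) (\<lambda>\<sigma>. P (t - \<sigma>) (f \<sigma>) x)" by (rule sp)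
qed

text \<open>The gradient of the integrand is dominated by a multiple of r^(-1/\<alpha>), integrable
  at 0 because \<alpha> > 1.\<close>

lemma v_formula:
  assumes t: "0 < t" "t \<le> T"
  shows "integrable (itv 0 t) (\<lambda>r. G r (f (t - r)) x)"
    and "v t x = G t u0 x + (\<integral>r. G r (f (t - r)) x \<partial>itv 0 t)"
proof -
  obtain C where C: "bc C u0" using u0_bc by blast
  obtain F where F': "\<forall>s. 0 < s \<longrightarrow> s < T \<longrightarrow> bc F (f s)" using f_bound by blast
  have F: "bc F (f s)" if "0 < s" "s < T" for s using F' that by blast
  have "- 1 < - 1 / \<alpha>" using alpha by (simp add: field_simps)
  then have "integrable (itv 0 t) (\<lambda>r. r powr (- 1 / \<alpha>))" using t by (intro integrable_itv_powr) auto
  then have k: "integrable (itv 0 t) (\<lambda>r. K0 r * F)" unfolding K0_def by simp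
  have d: "GDERIV (P r (f (t - r))) x :> G r (f (t - r)) x" if "r \<in> space (itv 0 t)" for r x
    using that t by (intro G_gderiv[of r F] F) auto
  have b: "norm (G r (f (t - r)) x) \<le> K0 r * F" if "r \<in> space (itv 0 t)" for r x
    using that t by (intro G_bound F) auto
  note g = gderiv_lebesgue_integral[OF mild_formula(4)[OF t] d b k]
  show "integrable (itv 0 t) (\<lambda>r. G r (f (t - r)) x)" by (rule g)
  have "u t = (\<lambda>x. P t u0 x + (\<integral>r. P r (f (t - r)) x \<partial>itv 0 t))" using mild_formula(2)[OF t] by auto
  then have "GDERIV (u t) x :> G t u0 x + (\<integral>r. G r (f (t - r)) x \<partial>itv 0 t)"
    using GDERIV_add[OF G_gderiv[OF t C, of x] g(2)[of x]] by simp
  then show "v t x = G t u0 x + (\<integral>r. G r (f (t - r)) x \<partial>itv 0 t)"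
    using gderiv_unique[OF u_gderiv[OF t]] by blast
qed

text \<open>The constant may blow up as \<epsilon> tends to 0: the datum is only Lipschitz, so the
  bounds for the gradient of P t u0 degenerate there.\<close>

definition v_holder :: "real \<Rightarrow> bool" where
  "v_holder \<theta> \<longleftrightarrow> (\<forall>\<epsilon>>0. \<exists>M\<ge>0. \<forall>s. \<epsilon> \<le> s \<longrightarrow> s \<le> T \<longrightarrow> (\<forall>x y. norm (v s x - v s y) \<le> M * norm (x - y) powr \<theta>))"

definition f_holder :: "real \<Rightarrow> bool" where
  "f_holder \<theta> \<longleftrightarrow> (\<forall>\<epsilon>>0. \<exists>M\<ge>0. \<forall>s. \<epsilon> \<le> s \<longrightarrow> s < T \<longrightarrow> (\<forall>x y. \<bar>f s x - f s y\<bar> \<le> M * norm (x - y) powr \<theta>))"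

lemma v_holder_0: "v_holder 0"
proof -
  obtain B where B: "0 < B" "\<forall>s x. 0 < s \<longrightarrow> s \<le> T \<longrightarrow> \<bar>u s x\<bar> \<le> B \<and> norm (v s x) \<le> B" using u_bounds by blast
  have k: "norm (v s x - v s y) \<le> 2 * B * norm (x - y) powr 0" if "0 < s" "s \<le> T" for s x y
  proof (cases "x = y")
    case False
    have "norm (v s x) \<le> B" "norm (v s y) \<le> B" using B(2) that by blast+
    then show ?thesis using norm_triangle_ineq4[of "v s x" "v s y"] False by simp
  qed simp
  show ?thesis unfolding v_holder_def
  proof (intro allI impI, intro exI[of _ "2 * B"] conjI allI impI)
    show "norm (v s x - v s y) \<le> 2 * B * norm (x - y) powr 0" if "0 < \<epsilon>" "\<epsilon> \<le> s" "s \<le> T" for \<epsilon> s x y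
      by (rule k) (use that in linarith)+
  qed (use B(1) in simp)
qed

text \<open>For |x - y| < 1, vary the second argument of H (exponent \<beta>), then the third
  (exponent \<gamma>); both powers are below the g-th. For larger distances the bound 2 F
  suffices.\<close>

lemma v_holder_imp_f_holder:
  assumes h: "v_holder \<gamma>" and g: "0 \<le> g" "g \<le> \<gamma>" "g \<le> \<beta>"
  shows "f_holder g"
  unfolding f_holder_def
proof (intro allI impI)
  fix \<epsilon> :: real assume e: "0 < \<epsilon>"
  obtain B where B: "0 < B" "\<forall>s x. 0 < s \<longrightarrow> s \<le> T \<longrightarrow> \<bar>u s x\<bar> \<le> B \<and> norm (v s x) \<le> B" using u_bounds by blast
  obtain F where F: "0 < F" "\<forall>s. 0 < s \<longrightarrow> s < T \<longrightarrow> bc F (f s)" using f_bound by blast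
  have B1: "0 < B + 1" using B(1) by simp
  with H_lipschitz have "\<exists>L>0. \<forall>t\<in>{0<..<T}. \<forall>x. \<forall>q\<in>ball 0 (B + 1). \<forall>r\<in>ball 0 (B + 1).
          \<bar>H t x q - H t x r\<bar> \<le> L * norm (q - r)" by blast
  then obtain L where L: "0 < L" "\<forall>t\<in>{0<..<T}. \<forall>x. \<forall>q\<in>ball 0 (B + 1). \<forall>r\<in>ball 0 (B + 1).
          \<bar>H t x q - H t x r\<bar> \<le> L * norm (q - r)" by blast
  from B1 H_holder have "\<exists>M>0. \<forall>t\<in>{0..T}. \<forall>q\<in>ball 0 (B + 1). \<forall>x y. norm (x - y) < 1 \<longrightarrow>
          \<bar>H t x q - H t y q\<bar> \<le> M * norm (x - y) powr \<beta>" by blast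
  then obtain M where M: "0 < M" "\<forall>t\<in>{0..T}. \<forall>q\<in>ball 0 (B + 1). \<forall>x y. norm (x - y) < 1 \<longrightarrow>
          \<bar>H t x q - H t y q\<bar> \<le> M * norm (x - y) powr \<beta>" by blast
  obtain N where N: "0 \<le> N" "\<forall>s. \<epsilon> \<le> s \<longrightarrow> s \<le> T \<longrightarrow> (\<forall>x y. norm (v s x - v s y) \<le> N * norm (x - y) powr \<gamma>)"
    using h e unfolding v_holder_def by blast
  show "\<exists>M\<ge>0. \<forall>s. \<epsilon> \<le> s \<longrightarrow> s < T \<longrightarrow> (\<forall>x y. \<bar>f s x - f s y\<bar> \<le> M * norm (x - y) powr g)"
  proof (intro exI[of _ "M + L * N + 2 * F"] conjI allI impI)
    show "0 \<le> M + L * N + 2 * F" using M(1) L(1) N(1) F(1) by simp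
    fix s and x y :: "real^'n" assume s: "\<epsilon> \<le> s" "s < T"
    let ?r = "norm (x - y)"
    have vb: "v s x \<in> ball 0 (B + 1)" for x
    proof -
      have "norm (v s x) \<le> B" using B(2) s e by simp
      then show ?thesis by simp
    qed
    show "\<bar>f s x - f s y\<bar> \<le> (M + L * N + 2 * F) * ?r powr g"
    proof (cases "?r < 1")
      case True
      have "\<bar>H s x (v s x) - H s y (v s x)\<bar> \<le> M * ?r powr \<beta>" using M(2) s e vb True by auto
      also have "\<dots> \<le> M * ?r powr g" using True g M(1) by (intro mult_left_mono powr_le_of_le_one) auto
      finally have 1: "\<bar>H s x (v s x) - H s y (v s x)\<bar> \<le> M * ?r powr g" .
      have "\<bar>H s y (v s x) - H s y (v s y)\<bar> \<le> L * norm (v s x - v s y)" using L(2) s e vb by auto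
      also have "\<dots> \<le> L * (N * ?r powr \<gamma>)" using N(2) s L(1) by (intro mult_left_mono) auto
      also have "\<dots> \<le> L * (N * ?r powr g)" using True g L(1) N(1) by (intro mult_left_mono powr_le_of_le_one) auto
      finally have 2: "\<bar>H s y (v s x) - H s y (v s y)\<bar> \<le> L * (N * ?r powr g)" .
      have "0 \<le> 2 * F * ?r powr g" using F(1) by simp
      then show ?thesis using 1 2 unfolding f_def by (simp add: algebra_simps)
    next
      case False
      then have "1 \<le> ?r powr g" using g(1) by (simp add: ge_one_powr_ge_zero)
      then have 1: "2 * F * 1 \<le> 2 * F * ?r powr g" using F(1) by (intro mult_left_mono) auto
      have 2: "0 \<le> (M + L * N) * ?r powr g" using M(1) L(1) N(1) by simp
      have "bc F (f s)" using F(2) s e by simp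
      from bcD(2)[OF this, of x] bcD(2)[OF this, of y] show ?thesis using 1 2 by (simp add: distrib_right)
    qed
  qed
qed

text \<open>For \<open>r\<close> close to \<open>t\<close> the function \<open>f (t - r)\<close> is not controlled in Holder norm, but there the kernel \<open>p r\<close> is not singular.\<close>

lemma duhamel_bounds:
  assumes fh: "f_holder g" and g: "0 \<le> g" "g \<le> 1" and \<theta>: "0 \<le> \<theta>" "\<theta> \<le> 1" and e: "0 < \<epsilon>"
  obtains M where "0 \<le> M"
    "\<And>t r x y. \<epsilon> \<le> t \<Longrightarrow> t \<le> T \<Longrightarrow> 0 < r \<Longrightarrow> r < t \<Longrightarrow>
      norm (G r (f (t - r)) x - G r (f (t - r)) y) \<le> (M * r powr ((g - 1 - \<theta>) / \<alpha>) + M) * norm (x - y) powr \<theta>"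
    "\<And>t r x i. \<epsilon> \<le> t \<Longrightarrow> t \<le> T \<Longrightarrow> 0 < r \<Longrightarrow> r < t \<Longrightarrow>
      norm (W r (f (t - r)) i x) \<le> M * r powr ((g - 2) / \<alpha>) + M"
    "\<And>t x y. \<epsilon> \<le> t \<Longrightarrow> t \<le> T \<Longrightarrow> norm (G t u0 x - G t u0 y) \<le> M * norm (x - y) powr \<theta>"
    "\<And>t x i. \<epsilon> \<le> t \<Longrightarrow> t \<le> T \<Longrightarrow> norm (W t u0 i x) \<le> M"
proof -
  obtain C where C: "0 \<le> C" "bc C u0" using u0_bc by blast
  obtain F where F: "0 < F" and F': "\<forall>s. 0 < s \<longrightarrow> s < T \<longrightarrow> bc F (f s)" using f_bound by blast
  have bF: "bc F (f s)" if "0 < s" "s < T" for s using F' that by blast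
  have "0 < \<epsilon> / 2" using e by simp
  then obtain N where N: "0 \<le> N" "\<forall>s. \<epsilon> / 2 \<le> s \<longrightarrow> s < T \<longrightarrow> (\<forall>x y. \<bar>f s x - f s y\<bar> \<le> N * norm (x - y) powr g)"
    using fh unfolding f_holder_def by blast
  define D where "D = N + 2 * F + 2 * C"
  have D: "N \<le> D" "2 * F \<le> D" "2 * C \<le> D" "0 \<le> D" using N(1) F C(1) by (auto simp: D_def)
  \<comment> \<open>As t >= \<epsilon>, either t - r >= \<epsilon>/2, where the g-Holder bound N
    holds, or r >= \<epsilon>/2, where f is treated as merely bounded. The powers for exponent 0
    decrease in r, so their values at \<epsilon>/2 bound them.\<close>
  define p1 where "p1 = (\<epsilon> / 2) powr ((0 - 1 - \<theta>) / \<alpha>)"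
  define p2 where "p2 = (\<epsilon> / 2) powr ((0 - 2) / \<alpha>)"
  define M where "M = (c2 + c3) * D * (1 + p1 + p2)"
  have p: "0 \<le> p1" "0 \<le> p2" unfolding p1_def p2_def by simp_all
  have c: "0 \<le> c2" "0 \<le> c3" by (rule c_nonneg)+
  have M1: "a * b * q \<le> M" if "a \<le> c2 + c3" "0 \<le> a" "0 \<le> b" "b \<le> D" "0 \<le> q" "q \<le> 1 + p1 + p2" for a b q
    unfolding M_def by (intro mult_mono mult_nonneg_nonneg that D) (use c in auto)
  have M0: "0 \<le> M" using M1[of 0 0 0] c D p by simp
  have P1: "r powr ((0 - 1 - \<theta>) / \<alpha>) \<le> p1" if "\<epsilon> / 2 \<le> r" for r
    unfolding p1_def using that e \<theta> alpha by (intro powr_mono2') (auto simp: field_simps)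
  have P2: "r powr ((0 - 2) / \<alpha>) \<le> p2" if "\<epsilon> / 2 \<le> r" for r
    unfolding p2_def using that e alpha by (intro powr_mono2') (auto simp: field_simps)
  have M3: "a * b \<le> M" if "a \<le> c2 + c3" "0 \<le> a" "0 \<le> b" "b \<le> D" for a b
    using M1[OF that, of 1] p by simp
  show ?thesis
  proof (rule that[OF M0])
    fix t r and x y :: "real^'n" assume tr: "\<epsilon> \<le> t" "t \<le> T" "0 < r" "r < t"
    then have r: "0 < r" "r \<le> T" and b: "bc F (f (t - r))" by (auto intro: bF)
    show "norm (G r (f (t - r)) x - G r (f (t - r)) y) \<le> (M * r powr ((g - 1 - \<theta>) / \<alpha>) + M) * norm (x - y) powr \<theta>"
    proof (cases "\<epsilon> / 2 \<le> t - r")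
      case True
      have h: "\<bar>f (t - r) x - f (t - r) y\<bar> \<le> N * norm (x - y) powr g" for x y using N(2) True tr by simp
      have "norm (G r (f (t - r)) x - G r (f (t - r)) y) \<le> c3 * N * r powr ((g - 1 - \<theta>) / \<alpha>) * norm (x - y) powr \<theta>"
        by (rule G_holder[OF r b N(1) h g \<theta>])
      also have "\<dots> \<le> (M * r powr ((g - 1 - \<theta>) / \<alpha>) + M) * norm (x - y) powr \<theta>"
      proof (rule mult_right_mono)
        have "c3 * N * r powr ((g - 1 - \<theta>) / \<alpha>) \<le> M * r powr ((g - 1 - \<theta>) / \<alpha>)"
          by (intro mult_right_mono M3 N D c) (use c in auto)
        then show "c3 * N * r powr ((g - 1 - \<theta>) / \<alpha>) \<le> M * r powr ((g - 1 - \<theta>) / \<alpha>) + M" using M0 by simp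
      qed simp
      finally show ?thesis .
    next
      case False
      then have r2: "\<epsilon> / 2 \<le> r" using tr by simp
      have "norm (G r (f (t - r)) x - G r (f (t - r)) y) \<le> c3 * (2 * F) * r powr ((0 - 1 - \<theta>) / \<alpha>) * norm (x - y) powr \<theta>"
        by (rule G_holder[OF r b _ holder_0[OF b] _ _ \<theta>]) (use F in auto)
      also have "\<dots> \<le> (M * r powr ((g - 1 - \<theta>) / \<alpha>) + M) * norm (x - y) powr \<theta>"
      proof (rule mult_right_mono)
        have "c3 * (2 * F) * r powr ((0 - 1 - \<theta>) / \<alpha>) \<le> M"
          by (rule M1) (use c D F p P1[OF r2] in auto)
        moreover have "0 \<le> M * r powr ((g - 1 - \<theta>) / \<alpha>)" using M0 by simp
        ultimately show "c3 * (2 * F) * r powr ((0 - 1 - \<theta>) / \<alpha>) \<le> M * r powr ((g - 1 - \<theta>) / \<alpha>) + M" by linarith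
      qed simp
      finally show ?thesis .
    qed
  next
    fix t r and x :: "real^'n" and i assume tr: "\<epsilon> \<le> t" "t \<le> T" "0 < r" "r < t"
    then have r: "0 < r" "r \<le> T" and b: "bc F (f (t - r))" by (auto intro: bF)
    show "norm (W r (f (t - r)) i x) \<le> M * r powr ((g - 2) / \<alpha>) + M"
    proof (cases "\<epsilon> / 2 \<le> t - r")
      case True
      have h: "\<bar>f (t - r) x - f (t - r) y\<bar> \<le> N * norm (x - y) powr g" for x y using N(2) True tr by simp
      have "norm (W r (f (t - r)) i x) \<le> c2 * N * r powr ((g - 2) / \<alpha>)"
        by (rule interpolation(2)[OF r b N(1) h g])
      also have "\<dots> \<le> M * r powr ((g - 2) / \<alpha>)"
        by (intro mult_right_mono M3 N D c) (use c in auto)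
      finally show ?thesis using M0 by simp
    next
      case False
      then have r2: "\<epsilon> / 2 \<le> r" using tr by simp
      have "norm (W r (f (t - r)) i x) \<le> c2 * (2 * F) * r powr ((0 - 2) / \<alpha>)"
        by (rule interpolation(2)[OF r b _ holder_0[OF b]]) (use F in auto)
      also have "\<dots> \<le> M" by (rule M1) (use c D F p P2[OF r2] in auto)
      finally have "norm (W r (f (t - r)) i x) \<le> M" .
      moreover have "0 \<le> M * r powr ((g - 2) / \<alpha>)" using M0 by simp
      ultimately show ?thesis by linarith
    qed
  next
    fix t and x y :: "real^'n" assume t: "\<epsilon> \<le> t" "t \<le> T"
    then have t0: "0 < t" "\<epsilon> / 2 \<le> t" using e by auto
    have "norm (G t u0 x - G t u0 y) \<le> c3 * (2 * C) * t powr ((0 - 1 - \<theta>) / \<alpha>) * norm (x - y) powr \<theta>"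
      by (rule G_holder[OF t0(1) t(2) C(2) _ holder_0[OF C(2)] _ _ \<theta>]) (use C in auto)
    also have "\<dots> \<le> M * norm (x - y) powr \<theta>"
      by (rule mult_right_mono, rule M1) (use c D C p P1[OF t0(2)] in auto)
    finally show "norm (G t u0 x - G t u0 y) \<le> M * norm (x - y) powr \<theta>" .
  next
    fix t and x :: "real^'n" and i assume t: "\<epsilon> \<le> t" "t \<le> T"
    then have t0: "0 < t" "\<epsilon> / 2 \<le> t" using e by auto
    have "norm (W t u0 i x) \<le> c2 * (2 * C) * t powr ((0 - 2) / \<alpha>)"
      by (rule interpolation(2)[OF t0(1) t(2) C(2) _ holder_0[OF C(2)]]) (use C in auto)
    also have "\<dots> \<le> M" by (rule M1) (use c D C p P2[OF t0(2)] in auto)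
    finally show "norm (W t u0 i x) \<le> M" .
  qed
qed

lemma integrable_itv_kernel:
  assumes "-1 < a" "0 \<le> t" shows "integrable (itv 0 t) (\<lambda>r. M * r powr a + M)"
proof -
  interpret finite_measure "itv 0 t" by (rule finite_itv)
  show ?thesis using integrable_itv_powr[OF assms] by simp
qed

lemma integral_itv_kernel_mono:
  assumes a: "-1 < a" and t: "0 \<le> t" "t \<le> T" and M: "0 \<le> M"
  shows "(\<integral>r. M * r powr a + M \<partial>itv 0 t) \<le> (\<integral>r. M * r powr a + M \<partial>itv 0 T)"
proof -
  have i: "integrable (itv 0 T) (\<lambda>r. M * r powr a + M)" using a T by (intro integrable_itv_kernel) auto
  have "0 \<le> (\<integral>r. M * r powr a + M \<partial>itv t T)" using M by (intro integral_nonneg_AE) auto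
  then show ?thesis using itv_split(3)[OF t i] by simp
qed

text \<open>The strict inequality says exactly that (g - 1 - \<theta>)/\<alpha> > -1, so the Holder
  seminorms of the Duhamel integrand are integrable at r = 0.\<close>

lemma f_holder_imp_v_holder:
  assumes fh: "f_holder g" and g: "0 \<le> g" "g \<le> 1" and \<theta>: "0 \<le> \<theta>" "\<theta> \<le> 1" "\<theta> < \<alpha> - 1 + g"
  shows "v_holder \<theta>"
  unfolding v_holder_def
proof (intro allI impI)
  fix \<epsilon> :: real assume e: "0 < \<epsilon>"
  obtain M where M: "0 \<le> M"
    "\<And>t r x y. \<epsilon> \<le> t \<Longrightarrow> t \<le> T \<Longrightarrow> 0 < r \<Longrightarrow> r < t \<Longrightarrow>
      norm (G r (f (t - r)) x - G r (f (t - r)) y) \<le> (M * r powr ((g - 1 - \<theta>) / \<alpha>) + M) * norm (x - y) powr \<theta>"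
    "\<And>t x y. \<epsilon> \<le> t \<Longrightarrow> t \<le> T \<Longrightarrow> norm (G t u0 x - G t u0 y) \<le> M * norm (x - y) powr \<theta>"
    using duhamel_bounds[OF fh g \<theta>(1,2) e] by metis
  have a: "- 1 < (g - 1 - \<theta>) / \<alpha>" using \<theta>(3) alpha by (simp add: field_simps)
  define I where "I = (\<integral>r. M * r powr ((g - 1 - \<theta>) / \<alpha>) + M \<partial>itv 0 T)"
  have I: "0 \<le> I" unfolding I_def using M by (intro integral_nonneg_AE) auto
  show "\<exists>M\<ge>0. \<forall>s. \<epsilon> \<le> s \<longrightarrow> s \<le> T \<longrightarrow> (\<forall>x y. norm (v s x - v s y) \<le> M * norm (x - y) powr \<theta>)"
  proof (intro exI[of _ "M + I"] conjI allI impI)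
    show "0 \<le> M + I" using M I by simp
    fix t and x y :: "real^'n" assume t: "\<epsilon> \<le> t" "t \<le> T"
    then have t0: "0 < t" using e by simp
    let ?N = "norm (x - y) powr \<theta>"
    let ?k = "\<lambda>r. M * r powr ((g - 1 - \<theta>) / \<alpha>) + M"
    note vi = v_formula(1)[OF t0 t(2)]
    have "v t x - v t y = (G t u0 x - G t u0 y) + (\<integral>r. G r (f (t - r)) x - G r (f (t - r)) y \<partial>itv 0 t)"
      unfolding v_formula(2)[OF t0 t(2)] using vi by simp
    also have "norm \<dots> \<le> M * ?N + I * ?N"
    proof (intro order_trans[OF norm_triangle_ineq] add_mono M(3) t)
      have "norm (\<integral>r. G r (f (t - r)) x - G r (f (t - r)) y \<partial>itv 0 t) \<le> (\<integral>r. norm (G r (f (t - r)) x - G r (f (t - r)) y) \<partial>itv 0 t)"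
        by (rule integral_norm_bound)
      also have "\<dots> \<le> (\<integral>r. ?k r * ?N \<partial>itv 0 t)"
      proof (rule integral_mono)
        show "integrable (itv 0 t) (\<lambda>r. norm (G r (f (t - r)) x - G r (f (t - r)) y))" using vi by (intro integrable_norm Bochner_Integration.integrable_diff)
        show "integrable (itv 0 t) (\<lambda>r. ?k r * ?N)" using integrable_itv_kernel[OF a] t0 by (intro integrable_mult_left) auto
        show "norm (G r (f (t - r)) x - G r (f (t - r)) y) \<le> ?k r * ?N" if "r \<in> space (itv 0 t)" for r
          using M(2)[OF t] that by auto
      qed
      also have "\<dots> = (\<integral>r. ?k r \<partial>itv 0 t) * ?N" by (rule integral_mult_left_zero)
      also have "\<dots> \<le> I * ?N" unfolding I_def
        using integral_itv_kernel_mono[OF a _ t(2) M(1)] t0 by (intro mult_right_mono) auto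
      finally show "norm (\<integral>r. G r (f (t - r)) x - G r (f (t - r)) y \<partial>itv 0 t) \<le> I * ?N" .
    qed
    finally show "norm (v t x - v t y) \<le> (M + I) * ?N" by (simp add: distrib_right)
  qed
qed

text \<open>Any gain below \<alpha> - 1 is possible in one round; taking half of it keeps the
  required inequality strict.\<close>

lemma v_holder_iter: 
  assumes \<kappa>: "\<kappa> = (\<alpha> - 1) / 2"
  shows "v_holder (min (real n * \<kappa>) \<beta>)"
proof (induction n)
  case 0
  then show ?case using v_holder_0 beta by (simp add: min_def)
next
  case (Suc n)
  define a where "a = real n * \<kappa>"
  have k: "0 < \<kappa>" "\<alpha> - 1 = 2 * \<kappa>" using alpha by (simp_all add: \<kappa>)
  have a: "0 \<le> a" "real (Suc n) * \<kappa> = \<kappa> + a" using k(1) by (simp_all add: a_def distrib_right)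
  let ?g = "min a \<beta>"
  have g: "0 \<le> ?g" "?g \<le> \<beta>" using a beta by auto
  have f: "f_holder ?g" by (rule v_holder_imp_f_holder[OF Suc.IH[folded a_def] g(1) order_refl g(2)])
  show ?case unfolding a(2)
  proof (rule f_holder_imp_v_holder[OF f g(1)])
    show "?g \<le> 1" "0 \<le> min (\<kappa> + a) \<beta>" "min (\<kappa> + a) \<beta> \<le> 1" using g beta a k by linarith+
    show "min (\<kappa> + a) \<beta> < \<alpha> - 1 + ?g" using k by linarith
  qed
qed

lemma f_holder_beta: "f_holder \<beta>"
proof -
  obtain n where n: "\<beta> < real n * ((\<alpha> - 1) / 2)" using ex_less_of_nat_mult[of "(\<alpha> - 1) / 2" \<beta>] alpha by auto
  then have "v_holder \<beta>" using v_holder_iter[OF refl, of n] by (simp add: min_def)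
  then show ?thesis by (rule v_holder_imp_f_holder) (use beta in auto)
qed

end

subsection \<open>Time derivative\<close>

lemma itv_average:
  assumes g: "integrable (itv a b) g" and "a \<le> b" and bd: "\<And>r. a < r \<Longrightarrow> r < b \<Longrightarrow> \<bar>g r - c\<bar> \<le> (e::real)"
  shows "\<bar>(\<integral>r. g r \<partial>itv a b) - (b - a) * c\<bar> \<le> (b - a) * e"
proof -
  interpret finite_measure "itv a b" by (rule finite_itv)
  have "(\<integral>r. g r \<partial>itv a b) - (b - a) * c = (\<integral>r. g r - c \<partial>itv a b)"
    using g measure_itv[OF assms(2)] by simp
  also have "\<bar>\<dots>\<bar> \<le> (\<integral>r. norm (g r - c) \<partial>itv a b)" using integral_norm_bound[of "itv a b" "\<lambda>r. g r - c"] by simp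
  also have "\<dots> \<le> (\<integral>r. e \<partial>itv a b)" using g bd by (intro integral_mono) auto
  also have "\<dots> = (b - a) * e" using integral_itv_const[OF assms(2), of e] by simp
  finally show ?thesis .
qed

context levy_heat
begin

text \<open>An approximate identity uniform over a family. The point t0 may lie outside D: for the
  source term D is the open interval and t0 may be T.\<close>

lemma P_family_tendsto:
  assumes c: "\<And>S X. (\<And>n. S n \<in> D) \<Longrightarrow> S \<longlonglongrightarrow> t0 \<Longrightarrow> X \<longlonglongrightarrow> x \<Longrightarrow> (\<lambda>n. \<phi> (S n) (X n)) \<longlonglongrightarrow> \<phi> t0 x"
    and b: "\<And>s y. s \<in> D \<Longrightarrow> \<bar>\<phi> s y\<bar> \<le> K" and m: "\<And>s. s \<in> D \<Longrightarrow> \<phi> s \<in> borel_measurable borel"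
    and e: "0 < e"
  shows "\<exists>d>0. \<forall>s h. s \<in> D \<longrightarrow> \<bar>s - t0\<bar> < d \<longrightarrow> 0 < h \<longrightarrow> h < d \<longrightarrow> \<bar>P h (\<phi> s) x - \<phi> (t0::real) x\<bar> \<le> e"
proof (cases "D = {}")
  case False
  then have K: "0 \<le> K" using b abs_ge_zero order_trans by blast
  \<comment> \<open>The value at t0 enters separately because the bound K is known on D
    only.\<close>
  define B where "B = K + \<bar>\<phi> t0 x\<bar>"
  have B: "0 \<le> B" using K by (simp add: B_def)
  have "continuous (at (t0, x) within D \<times> UNIV) (\<lambda>z. \<phi> (fst z) (snd z))"
    unfolding continuous_within_sequentially comp_def
  proof (intro allI impI)
    fix Z :: "nat \<Rightarrow> real \<times> (real^'n)" assume Z: "(\<forall>n. Z n \<in> D \<times> UNIV) \<and> Z \<longlonglongrightarrow> (t0, x)"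
    have "(\<lambda>n. \<phi> (fst (Z n)) (snd (Z n))) \<longlonglongrightarrow> \<phi> t0 x"
      by (rule c) (use Z tendsto_fst[of Z "(t0, x)"] tendsto_snd[of Z "(t0, x)"] in \<open>auto simp: mem_Times_iff\<close>)
    then show "(\<lambda>n. \<phi> (fst (Z n)) (snd (Z n))) \<longlonglongrightarrow> \<phi> (fst (t0, x)) (snd (t0, x))" by simp
  qed
  then obtain d1 where d1: "0 < d1" "\<forall>z\<in>D \<times> UNIV. dist z (t0, x) < d1 \<longrightarrow> dist (\<phi> (fst z) (snd z)) (\<phi> t0 x) < e / 2"
    unfolding continuous_within_eps_delta using e by (metis fst_conv half_gt_zero snd_conv)
  have near: "\<bar>\<phi> s y - \<phi> t0 x\<bar> \<le> e / 2" if "s \<in> D" "\<bar>s - t0\<bar> < d1 / 2" "norm (y - x) < d1 / 2" for s y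
  proof -
    have "dist (s, y) (t0, x) \<le> \<bar>s - t0\<bar> + norm (y - x)"
      unfolding dist_Pair_Pair using sqrt_sum_squares_le_sum_abs[of "dist s t0" "dist y x"] by (simp add: dist_norm)
    then have "dist (s, y) (t0, x) < d1" using that by simp
    then show ?thesis using d1(2) that(1) by (auto simp: dist_real_def intro: less_imp_le)
  qed
  obtain d2 where d2: "0 < d2" "\<And>h \<eta> x c. 0 < h \<Longrightarrow> h < d2 \<Longrightarrow> \<eta> \<in> borel_measurable borel \<Longrightarrow> (\<And>y. \<bar>\<eta> y - c\<bar> \<le> B)
    \<Longrightarrow> (\<And>y. norm (y - x) < d1 / 2 \<Longrightarrow> \<bar>\<eta> y - c\<bar> \<le> e / 2) \<Longrightarrow> \<bar>P h \<eta> x - c\<bar> \<le> 2 * (e / 2)"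
    using P_approx[of "e / 2" "d1 / 2" B] e d1(1) B by (metis half_gt_zero)
  show ?thesis
  proof (intro exI[of _ "min (d1 / 2) d2"] conjI allI impI)
    show "0 < min (d1 / 2) d2" using d1(1) d2(1) by simp
    fix s h assume a: "s \<in> D" "\<bar>s - t0\<bar> < min (d1 / 2) d2" "0 < h" "h < min (d1 / 2) d2"
    have "\<bar>P h (\<phi> s) x - \<phi> t0 x\<bar> \<le> 2 * (e / 2)"
    proof (rule d2(2)[OF a(3) _ m[OF a(1)]])
      show "h < d2" using a by simp
      show "\<bar>\<phi> s y - \<phi> t0 x\<bar> \<le> B" for y using b[OF a(1), of y] unfolding B_def by linarith
      show "\<bar>\<phi> s y - \<phi> t0 x\<bar> \<le> e / 2" if "norm (y - x) < d1 / 2" for y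
        by (rule near[OF a(1) _ that]) (use a in simp)
    qed
    then show "\<bar>P h (\<phi> s) x - \<phi> t0 x\<bar> \<le> e" by simp
  qed
qed (auto intro: exI[of _ 1])

end

context mild
begin

text \<open>Rows of the Hessian of u t if \<alpha> + \<beta> > 2; in the other case a placeholder
  for the last argument of \<open>levy_reg\<close>.\<close>

definition Wu :: "real \<Rightarrow> 'n \<Rightarrow> real^'n \<Rightarrow> real^'n" where
  "Wu t i x = W t u0 i x + (\<integral>r. W r (f (t - r)) i x \<partial>itv 0 t)"

context
  assumes ab: "\<alpha> + \<beta> > 2"
begin

text \<open>The first alternative of the theorem is exactly integrability of the singularity of
  second derivatives for a \<beta>-Holder source.\<close>

lemma exponent_gt: "- 1 < (\<beta> - 2) / \<alpha>" using ab alpha by (simp add: field_simps)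

lemma W_bounds:
  assumes "0 < \<epsilon>"
  shows "\<exists>M\<ge>0. (\<forall>t r x i. \<epsilon> \<le> t \<longrightarrow> t \<le> T \<longrightarrow> 0 < r \<longrightarrow> r < t \<longrightarrow>
      norm (W r (f (t - r)) i x) \<le> M * r powr ((\<beta> - 2) / \<alpha>) + M) \<and>
    (\<forall>t x i. \<epsilon> \<le> t \<longrightarrow> t \<le> T \<longrightarrow> norm (W t u0 i x) \<le> M)"
  using duhamel_bounds[OF f_holder_beta less_imp_le[OF beta(1)] beta(2) order_refl zero_le_one assms] by metis

lemma Wu_integrable_gderiv:
  assumes t: "0 < t" "t \<le> T"
  shows "integrable (itv 0 t) (\<lambda>r. W r (f (t - r)) i x)" and "GDERIV (\<lambda>x. v t x $ i) x :> Wu t i x"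
proof -
  obtain C where C: "bc C u0" using u0_bc by blast
  obtain F where F': "\<forall>s. 0 < s \<longrightarrow> s < T \<longrightarrow> bc F (f s)" using f_bound by blast
  have F: "bc F (f s)" if "0 < s" "s < T" for s using F' that by blast
  obtain M where M: "\<forall>t' r x i. t \<le> t' \<longrightarrow> t' \<le> T \<longrightarrow> 0 < r \<longrightarrow> r < t' \<longrightarrow>
      norm (W r (f (t' - r)) i x) \<le> M * r powr ((\<beta> - 2) / \<alpha>) + M" using W_bounds[OF t(1)] by blast
  have k: "integrable (itv 0 t) (\<lambda>r. M * r powr ((\<beta> - 2) / \<alpha>) + M)" using t by (intro integrable_itv_kernel exponent_gt) simp
  have int: "integrable (itv 0 t) (\<lambda>r. G r (f (t - r)) x $ i)" for x
    using integrable_bounded_linear[OF bounded_linear_vec_nth v_formula(1)[OF t]] .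
  have d: "GDERIV (\<lambda>x. G r (f (t - r)) x $ i) x :> W r (f (t - r)) i x" if "r \<in> space (itv 0 t)" for r x
    using that t by (intro W_gderiv[of r F] F) auto
  have b: "norm (W r (f (t - r)) i x) \<le> M * r powr ((\<beta> - 2) / \<alpha>) + M" if "r \<in> space (itv 0 t)" for r x
    using that t M by auto
  note g = gderiv_lebesgue_integral[OF int d b k]
  show "integrable (itv 0 t) (\<lambda>r. W r (f (t - r)) i x)" by (rule g)
  have "(\<lambda>x. v t x $ i) = (\<lambda>x. G t u0 x $ i + (\<integral>r. G r (f (t - r)) x $ i \<partial>itv 0 t))"
    unfolding v_formula(2)[OF t] vector_add_component integral_vec_nth[OF v_formula(1)[OF t]] ..
  then show "GDERIV (\<lambda>x. v t x $ i) x :> Wu t i x"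
    unfolding Wu_def using GDERIV_add[OF W_gderiv[OF t C] g(2)] by simp
qed

lemma Wu_bound:
  assumes e: "0 < \<epsilon>" shows "\<exists>M\<ge>0. \<forall>t i x. \<epsilon> \<le> t \<longrightarrow> t \<le> T \<longrightarrow> norm (Wu t i x) \<le> M"
proof -
  obtain M where M: "0 \<le> M" "\<forall>t r x i. \<epsilon> \<le> t \<longrightarrow> t \<le> T \<longrightarrow> 0 < r \<longrightarrow> r < t \<longrightarrow>
      norm (W r (f (t - r)) i x) \<le> M * r powr ((\<beta> - 2) / \<alpha>) + M"
    "\<forall>t x i. \<epsilon> \<le> t \<longrightarrow> t \<le> T \<longrightarrow> norm (W t u0 i x) \<le> M" using W_bounds[OF e] by blast
  define I where "I = (\<integral>r. M * r powr ((\<beta> - 2) / \<alpha>) + M \<partial>itv 0 T)"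
  have I: "0 \<le> I" unfolding I_def using M by (intro integral_nonneg_AE) auto
  show ?thesis
  proof (intro exI[of _ "M + I"] conjI allI impI)
    show "0 \<le> M + I" using M I by simp
    fix t i and x :: "real^'n" assume t: "\<epsilon> \<le> t" "t \<le> T"
    then have t0: "0 < t" using e by simp
    have k: "integrable (itv 0 t) (\<lambda>r. M * r powr ((\<beta> - 2) / \<alpha>) + M)" using t0 by (intro integrable_itv_kernel exponent_gt) simp
    have "norm (\<integral>r. W r (f (t - r)) i x \<partial>itv 0 t) \<le> (\<integral>r. norm (W r (f (t - r)) i x) \<partial>itv 0 t)" by (rule integral_norm_bound)
    also have "\<dots> \<le> (\<integral>r. M * r powr ((\<beta> - 2) / \<alpha>) + M \<partial>itv 0 t)"
      by (rule integral_mono[OF integrable_norm[OF Wu_integrable_gderiv(1)[OF t0 t(2)]] k]) (use M(2) t in auto)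
    also have "\<dots> \<le> I" unfolding I_def using t0 by (intro integral_itv_kernel_mono exponent_gt t M) simp
    finally have 1: "norm (\<integral>r. W r (f (t - r)) i x \<partial>itv 0 t) \<le> I" .
    have 2: "norm (W t u0 i x) \<le> M" using M(3) t by blast
    show "norm (Wu t i x) \<le> M + I" unfolding Wu_def
      using norm_triangle_ineq[of "W t u0 i x" "\<integral>r. W r (f (t - r)) i x \<partial>itv 0 t"] 1 2 by linarith
  qed
qed

text \<open>Indicators put the integrals over (0, S n) on the fixed interval (0, T). Since S n >=
  s/2, one kernel bound dominates them all.\<close>

lemma Wu_joint_aux:
  assumes s: "0 < s" "s \<le> T" and S: "S \<longlonglongrightarrow> s" "\<And>n. s / 2 \<le> S n" "\<And>n. S n \<le> T" and X: "X \<longlonglongrightarrow> x"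
  shows "(\<lambda>n. Wu (S n) i (X n)) \<longlonglongrightarrow> Wu s i x"
  unfolding Wu_def
proof (rule tendsto_add)
  obtain C where C: "bc C u0" using u0_bc by blast
  show "(\<lambda>n. W (S n) u0 i (X n)) \<longlonglongrightarrow> W s u0 i x" by (rule W_joint_tendsto[OF s S(1,3) C X])
  obtain F where F': "\<forall>s. 0 < s \<longrightarrow> s < T \<longrightarrow> bc F (f s)" using f_bound by blast
  have F: "bc F (f s)" if "0 < s" "s < T" for s using F' that by blast
  obtain M where M: "0 \<le> M" "\<forall>t r x i. s / 2 \<le> t \<longrightarrow> t \<le> T \<longrightarrow> 0 < r \<longrightarrow> r < t \<longrightarrow>
      norm (W r (f (t - r)) i x) \<le> M * r powr ((\<beta> - 2) / \<alpha>) + M" using W_bounds[of "s / 2"] s by (metis half_gt_zero)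
  let ?k = "\<lambda>r. M * r powr ((\<beta> - 2) / \<alpha>) + M"
  have S0: "0 < S n" for n using S(2)[of n] s by simp
  have "(\<lambda>n. \<integral>r. indicator {0<..<S n} r *\<^sub>R W r (f (S n - r)) i (X n) \<partial>lborel) \<longlonglongrightarrow> (\<integral>r. indicator {0<..<s} r *\<^sub>R W r (f (s - r)) i x \<partial>lborel)"
  proof (rule integral_dominated_convergence[where w = "\<lambda>r. indicator {0<..<T} r *\<^sub>R ?k r"])
    show "(\<lambda>r. indicator {0<..<s} r *\<^sub>R W r (f (s - r)) i x) \<in> borel_measurable lborel"
      using Wu_integrable_gderiv(1)[OF s] unfolding integrable_itv set_integrable_def by (rule borel_measurable_integrable)
    show "(\<lambda>r. indicator {0<..<S n} r *\<^sub>R W r (f (S n - r)) i (X n)) \<in> borel_measurable lborel" for n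
      using Wu_integrable_gderiv(1)[OF S0 S(3)] unfolding integrable_itv set_integrable_def by (rule borel_measurable_integrable)
    show "integrable lborel (\<lambda>r. indicator {0<..<T} r *\<^sub>R ?k r)"
      using integrable_itv_kernel[OF exponent_gt, of T M] T unfolding integrable_itv set_integrable_def by simp
    show "AE r in lborel. norm (indicator {0<..<S n} r *\<^sub>R W r (f (S n - r)) i (X n)) \<le> indicator {0<..<T} r *\<^sub>R ?k r" for n
    proof (rule AE_I2)
      fix r :: real
      show "norm (indicator {0<..<S n} r *\<^sub>R W r (f (S n - r)) i (X n)) \<le> indicator {0<..<T} r *\<^sub>R ?k r"
      proof (cases "r \<in> {0<..<S n}")
        case True
        then have "norm (W r (f (S n - r)) i (X n)) \<le> ?k r" using M(2) S(2,3) by simp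
        then show ?thesis using True S(3)[of n] by (simp add: indicator_def)
      next
        case False
        then have "indicator {0<..<S n} r = (0::real)" by simp
        then show ?thesis using M(1) by simp
      qed
    qed
    \<comment> \<open>At r = s the indicators of (0, S n) need not converge.\<close>
    have "AE r in lborel. r \<noteq> s" by (rule AE_lborel_singleton)
    then show "AE r in lborel. (\<lambda>n. indicator {0<..<S n} r *\<^sub>R W r (f (S n - r)) i (X n)) \<longlonglongrightarrow> indicator {0<..<s} r *\<^sub>R W r (f (s - r)) i x"
    proof eventually_elim
      case (elim r)
      consider "r \<le> 0" | "0 < r" "r < s" | "s < r" using elim by linarith
      then show ?case
      proof cases
        case 2
        \<comment> \<open>Keeps all times positive so that the bounds on f apply; eventually it
          equals S n - r.\<close>
        define S' where "S' n = max (S n - r) ((s - r) / 2)" for n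
        have l: "S' \<longlonglongrightarrow> s - r"
        proof -
          have "S' \<longlonglongrightarrow> max (s - r) ((s - r) / 2)" unfolding S'_def by (intro tendsto_intros S)
          then show ?thesis using 2 by (simp add: max_def)
        qed
        have p: "0 < S' n" "S' n < T" "S' n \<le> T" for n using 2 s S(3)[of n] by (auto simp: S'_def less_max_iff_disj)
        have sr: "0 < s - r" "s - r \<le> T" "s - r < T" "r \<le> T" using 2 s by auto
        have "(\<lambda>n. W r (f (S' n)) i (X n)) \<longlonglongrightarrow> W r (f (s - r)) i x"
          by (rule W_tendsto[OF 2(1) sr(4) F[OF p(1,2)] F[OF sr(1,3)]])
            (rule u_joint(3)[OF sr(1,2) l p(1,3)], intro tendsto_intros X)
        moreover have "\<forall>\<^sub>F n in sequentially. W r (f (S' n)) i (X n) = indicator {0<..<S n} r *\<^sub>R W r (f (S n - r)) i (X n)"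
        proof -
          have "\<forall>\<^sub>F n in sequentially. (s + r) / 2 < S n" using S(1) by (rule order_tendstoD) (use 2 in simp)
          then show ?thesis
          proof eventually_elim
            case (elim n)
            then have "S' n = S n - r" "r < S n" using 2 by (auto simp: S'_def field_simps)
            then show ?case using 2 by simp
          qed
        qed
        ultimately have "(\<lambda>n. indicator {0<..<S n} r *\<^sub>R W r (f (S n - r)) i (X n)) \<longlonglongrightarrow> W r (f (s - r)) i x"
          by (rule Lim_transform_eventually)
        then show ?thesis using 2 by simp
      next
        case 3
        have "\<forall>\<^sub>F n in sequentially. S n < r" using S(1) 3 by (rule order_tendstoD)
        then have "\<forall>\<^sub>F n in sequentially. 0 = indicator {0<..<S n} r *\<^sub>R W r (f (S n - r)) i (X n)"
          by eventually_elim simp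
        from Lim_transform_eventually[OF tendsto_const this] show ?thesis using 3 by simp
      qed simp
    qed
  qed
  then show "(\<lambda>n. \<integral>r. W r (f (S n - r)) i (X n) \<partial>itv 0 (S n)) \<longlonglongrightarrow> (\<integral>r. W r (f (s - r)) i x \<partial>itv 0 s)"
    unfolding integral_itv set_lebesgue_integral_def .
qed

end

lemma Wu_joint:
  assumes ab: "\<alpha> + \<beta> > 2" and s: "0 < s" "s \<le> T" and S: "S \<longlonglongrightarrow> s" "\<And>n. 0 < S n" "\<And>n. S n \<le> T" and X: "X \<longlonglongrightarrow> x"
  shows "(\<lambda>n. Wu (S n) i (X n)) \<longlonglongrightarrow> Wu s i x"
proof -
  have "\<forall>\<^sub>F n in sequentially. s / 2 < S n" using S(1) by (rule order_tendstoD) (use s in simp)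
  then obtain N where N: "\<And>n. N \<le> n \<Longrightarrow> s / 2 < S n" unfolding eventually_sequentially by blast
  have "(\<lambda>n. Wu (S (n + N)) i (X (n + N))) \<longlonglongrightarrow> Wu s i x"
    by (rule Wu_joint_aux[OF ab s LIMSEQ_ignore_initial_segment[OF S(1)] _ S(3) LIMSEQ_ignore_initial_segment[OF X]])
      (use N in \<open>simp add: less_imp_le\<close>)
  then show ?thesis by (rule LIMSEQ_offset)
qed

lemma u_levy_reg_C2:
  assumes ab: "\<alpha> + \<beta> > 2" and e: "0 < \<epsilon>"
  shows "\<exists>C. \<forall>t. \<epsilon> \<le> t \<longrightarrow> t \<le> T \<longrightarrow> levy_reg 1 C (u t) (v t) (Wu t)"
proof -
  obtain B where B: "0 < B" "\<forall>s x. 0 < s \<longrightarrow> s \<le> T \<longrightarrow> \<bar>u s x\<bar> \<le> B \<and> norm (v s x) \<le> B" using u_bounds by blast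
  obtain M where M: "0 \<le> M" "\<forall>t i x. \<epsilon> \<le> t \<longrightarrow> t \<le> T \<longrightarrow> norm (Wu t i x) \<le> M" using Wu_bound[OF ab e] by blast
  define D where "D = real CARD('n) * M"
  have D: "0 \<le> D" unfolding D_def using M by simp
  show ?thesis
  proof (intro exI[of _ "B + M + D"] allI impI)
    fix t assume t: "\<epsilon> \<le> t" "t \<le> T"
    then have t0: "0 < t" using e by simp
    have b: "\<bar>u t x\<bar> \<le> B" "norm (v t x) \<le> B" "norm (Wu t i x) \<le> M" for x i using B(2) M(2) t t0 by blast+
    note g = Wu_integrable_gderiv(2)[OF ab t0 t(2)]
    have lip: "norm (v t x - v t y) \<le> D * norm (x - y) powr 1" for x y
      unfolding D_def using vector_lipschitz[of "v t" "Wu t" M x y, OF g b(3)] by simp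
    show "levy_reg 1 (B + M + D) (u t) (v t) (Wu t)"
      unfolding levy_reg_def
    proof (intro conjI allI impI disjI2)
      show "0 \<le> B + M + D" using B M D by simp
      show "GDERIV (u t) x :> v t x" for x by (rule u_gderiv[OF t0 t(2)])
      show "\<bar>u t x\<bar> \<le> B + M + D" "norm (v t x) \<le> B + M + D" "norm (Wu t i x) \<le> B + M + D" for x i
        using b(1)[where x = x] b(2)[where x = x] b(3)[where i = i and x = x] B(1) M(1) D by linarith+
      show "GDERIV (\<lambda>y. v t y $ i) x :> Wu t i x" for i x by (rule g)
      fix x z :: "real^'n"
      have "\<bar>u t (x + z) - u t x - v t x \<bullet> z\<bar> \<le> D * norm z powr (1 + 1)"
        by (rule gderiv_taylor_holder[OF u_gderiv[OF t0 t(2)] lip _ D]) simp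
      also have "\<dots> \<le> (B + M + D) * norm z powr (1 + 1)" using B M by (intro mult_right_mono) auto
      finally show "\<bar>u t (x + z) - u t x - v t x \<bullet> z\<bar> \<le> (B + M + D) * norm z powr (1 + 1)" .
    qed
  qed
qed

lemma u_levy_reg_holder:
  assumes A: "A = 0" and th: "0 \<le> \<theta>" "\<theta> \<le> 1" "\<theta> < \<alpha> - 1 + \<beta>" and e: "0 < \<epsilon>"
  shows "\<exists>C. \<forall>t. \<epsilon> \<le> t \<longrightarrow> t \<le> T \<longrightarrow> levy_reg \<theta> C (u t) (v t) (Wu t)"
proof -
  obtain B where B: "0 < B" "\<forall>s x. 0 < s \<longrightarrow> s \<le> T \<longrightarrow> \<bar>u s x\<bar> \<le> B \<and> norm (v s x) \<le> B" using u_bounds by blast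
  have "v_holder \<theta>" by (rule f_holder_imp_v_holder[OF f_holder_beta less_imp_le[OF beta(1)] beta(2) th])
  then obtain D where D: "0 \<le> D" "\<forall>s. \<epsilon> \<le> s \<longrightarrow> s \<le> T \<longrightarrow> (\<forall>x y. norm (v s x - v s y) \<le> D * norm (x - y) powr \<theta>)"
    using e unfolding v_holder_def by blast
  show ?thesis
  proof (intro exI[of _ "B + D"] allI impI)
    fix t assume t: "\<epsilon> \<le> t" "t \<le> T"
    then have t0: "0 < t" using e by simp
    have b: "\<bar>u t x\<bar> \<le> B" "norm (v t x) \<le> B" for x using B(2) t t0 by blast+
    have lip: "norm (v t x - v t y) \<le> D * norm (x - y) powr \<theta>" for x y using D(2) t by blast
    show "levy_reg \<theta> (B + D) (u t) (v t) (Wu t)"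
      unfolding levy_reg_def
    proof (intro conjI allI impI disjI1 A)
      show "0 \<le> B + D" using B D by simp
      show "GDERIV (u t) x :> v t x" for x by (rule u_gderiv[OF t0 t(2)])
      show "\<bar>u t x\<bar> \<le> B + D" "norm (v t x) \<le> B + D" for x using b[of x] B(1) D(1) by linarith+
      fix x z :: "real^'n"
      have "\<bar>u t (x + z) - u t x - v t x \<bullet> z\<bar> \<le> D * norm z powr (1 + \<theta>)"
        by (rule gderiv_taylor_holder[OF u_gderiv[OF t0 t(2)] lip th(1) D(1)])
      also have "\<dots> \<le> (B + D) * norm z powr (1 + \<theta>)" using B by (intro mult_right_mono) auto
      finally show "\<bar>u t (x + z) - u t x - v t x \<bullet> z\<bar> \<le> (B + D) * norm z powr (1 + \<theta>)" .
    qed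
  qed
qed

section \<open>Time differentiability, for both alternatives at once\<close>

context
  fixes \<theta> :: real
  assumes th: "0 < \<theta>" "\<theta> \<le> 1" and mu: "integrable \<mu> (\<lambda>z. min 1 (norm z powr (1 + \<theta>)))"
    and reg: "\<And>\<epsilon>. 0 < \<epsilon> \<Longrightarrow> \<exists>C. \<forall>t. \<epsilon> \<le> t \<longrightarrow> t \<le> T \<longrightarrow> levy_reg \<theta> C (u t) (v t) (Wu t)"
    and ab: "A \<noteq> 0 \<Longrightarrow> \<alpha> + \<beta> > 2"
begin

lemma Lu_joint:
  assumes s: "0 < s" "s \<le> T" and S: "S \<longlonglongrightarrow> s" "\<And>n. 0 < S n" "\<And>n. S n \<le> T" and X: "X \<longlonglongrightarrow> x"
  shows "(\<lambda>n. levy_operator A \<mu> (u (S n)) (X n)) \<longlonglongrightarrow> levy_operator A \<mu> (u s) x"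
proof -
  have "\<forall>\<^sub>F n in sequentially. s / 2 < S n" using S(1) by (rule order_tendstoD) (use s in simp)
  then obtain N where N: "\<And>n. N \<le> n \<Longrightarrow> s / 2 < S n" unfolding eventually_sequentially by blast
  obtain C where C: "\<forall>t. s / 2 \<le> t \<longrightarrow> t \<le> T \<longrightarrow> levy_reg \<theta> C (u t) (v t) (Wu t)" using reg[of "s / 2"] s by auto
  let ?S = "\<lambda>n. S (n + N)" and ?X = "\<lambda>n. X (n + N)"
  have l: "?S \<longlonglongrightarrow> s" "?X \<longlonglongrightarrow> x" using S(1) X by (simp_all add: LIMSEQ_ignore_initial_segment)
  have rn: "levy_reg \<theta> C (u (?S n)) (v (?S n)) (Wu (?S n))" for n
    using C N[of "n + N"] S(3)[of "n + N"] by simp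
  have r: "levy_reg \<theta> C (u s) (v s) (Wu s)" using C s by simp
  have "(\<lambda>n. levy_operator A \<mu> (u (?S n)) (?X n)) \<longlonglongrightarrow> levy_operator A \<mu> (u s) x"
  proof (rule levy_operator_tendsto[OF rn r th(1) mu])
    show "(\<lambda>n. u (?S n) (?X n + z)) \<longlonglongrightarrow> u s (x + z)" for z
      by (rule u_joint(1)[OF s l(1) S(2,3)]) (intro tendsto_intros l)
    show "(\<lambda>n. v (?S n) (?X n)) \<longlonglongrightarrow> v s x" by (rule u_joint(2)[OF s l(1) S(2,3) l(2)])
    show "(\<lambda>n. Wu (?S n) i (?X n)) \<longlonglongrightarrow> Wu s i x" if "A \<noteq> 0" for i
      by (rule Wu_joint[OF ab[OF that] s l(1) S(2,3) l(2)])
  qed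
  then show ?thesis by (rule LIMSEQ_offset)
qed

lemma u_dynkin:
  assumes s: "0 < s" "s \<le> T" and h: "0 < h"
  shows "levy_operator A \<mu> (u s) \<in> borel_measurable borel"
    and "integrable (itv 0 h) (\<lambda>r. P r (levy_operator A \<mu> (u s)) x)"
    and "P h (u s) x - u s x = (\<integral>r. P r (levy_operator A \<mu> (u s)) x \<partial>itv 0 h)"
proof -
  obtain C where "\<forall>t. s \<le> t \<longrightarrow> t \<le> T \<longrightarrow> levy_reg \<theta> C (u t) (v t) (Wu t)" using reg[of s] s by auto
  then have r: "levy_reg \<theta> C (u s) (v s) (Wu s)" using s by simp
  have cV: "continuous_on UNIV (v s)" unfolding v_def by (rule Cb1_gradient_cont[OF u_Cb1[OF s]])
  have cW: "continuous_on UNIV (Wu s i)" if "A \<noteq> 0" for i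
    unfolding continuous_on_sequentially comp_def
    using Wu_joint[OF ab[OF that] s, of "\<lambda>_. s"] s by auto
  note d = dynkin[OF r th mu cV cW h]
  show "levy_operator A \<mu> (u s) \<in> borel_measurable borel"
    "integrable (itv 0 h) (\<lambda>r. P r (levy_operator A \<mu> (u s)) x)"
    "P h (u s) x - u s x = (\<integral>r. P r (levy_operator A \<mu> (u s)) x \<partial>itv 0 h)"
    by (rule d; assumption)+
qed

text \<open>Both times vary near t0, so that one estimate serves the left and the right derivative.
  The Dynkin formula is based at the earlier time s, which makes continuity of L u in time
  enter.\<close>

lemma u_increment:
  assumes t0: "0 < t0" "t0 \<le> T" and e: "0 < e"
  shows "\<exists>d>0. \<forall>s t. 0 < s \<longrightarrow> s < t \<longrightarrow> t \<le> T \<longrightarrow> \<bar>s - t0\<bar> < d \<longrightarrow> \<bar>t - t0\<bar> < d \<longrightarrow>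
    \<bar>u t x - u s x - (t - s) * (levy_operator A \<mu> (u t0) x + f t0 x)\<bar> \<le> e * (t - s)"
proof -
  let ?L = "\<lambda>s. levy_operator A \<mu> (u s)"
  obtain C where C: "\<forall>t. t0 / 2 \<le> t \<longrightarrow> t \<le> T \<longrightarrow> levy_reg \<theta> C (u t) (v t) (Wu t)" using reg[of "t0 / 2"] t0 by auto
  have e2: "0 < e / 2" using e by simp
  have "\<exists>d>0. \<forall>s h. s \<in> {t0 / 2..T} \<longrightarrow> \<bar>s - t0\<bar> < d \<longrightarrow> 0 < h \<longrightarrow> h < d \<longrightarrow> \<bar>P h (?L s) x - ?L t0 x\<bar> \<le> e / 2"
  proof (rule P_family_tendsto[OF _ _ _ e2])
    show "(\<lambda>n. ?L (S n) (X n)) \<longlonglongrightarrow> ?L t0 x" if "\<And>n. S n \<in> {t0 / 2..T}" "S \<longlonglongrightarrow> t0" "X \<longlonglongrightarrow> x" for S X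
    proof (rule Lu_joint[OF t0 that(2) _ _ that(3)])
      show "0 < S n" "S n \<le> T" for n using that(1)[of n] t0 by auto
    qed
    show "\<bar>?L s y\<bar> \<le> C * ((\<Sum>i\<in>UNIV. \<Sum>j\<in>UNIV. \<bar>A $ i $ j\<bar>) + 2 * mu_moment \<theta>)" if "s \<in> {t0 / 2..T}" for s y
      using C that by (intro levy_operator_bound[OF _ th(1) mu]) auto
    show "?L s \<in> borel_measurable borel" if "s \<in> {t0 / 2..T}" for s
      using u_dynkin(1)[of s 1] that t0 by auto
  qed
  then obtain d1 where d1: "0 < d1" "\<forall>s h. s \<in> {t0 / 2..T} \<longrightarrow> \<bar>s - t0\<bar> < d1 \<longrightarrow> 0 < h \<longrightarrow> h < d1 \<longrightarrow> \<bar>P h (?L s) x - ?L t0 x\<bar> \<le> e / 2"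
    by blast
  obtain F where F': "\<forall>s. 0 < s \<longrightarrow> s < T \<longrightarrow> bc F (f s)" using f_bound by blast
  have F: "bc F (f s)" if "s \<in> {0<..<T}" for s using F' that by simp
  \<comment> \<open>The open interval is where f is bounded; t0 = T is still reached as a
    limit.\<close>
  have "\<exists>d>0. \<forall>s h. s \<in> {0<..<T} \<longrightarrow> \<bar>s - t0\<bar> < d \<longrightarrow> 0 < h \<longrightarrow> h < d \<longrightarrow> \<bar>P h (f s) x - f t0 x\<bar> \<le> e / 2"
  proof (rule P_family_tendsto[OF _ _ _ e2])
    show "(\<lambda>n. f (S n) (X n)) \<longlonglongrightarrow> f t0 x" if "\<And>n. S n \<in> {0<..<T}" "S \<longlonglongrightarrow> t0" "X \<longlonglongrightarrow> x" for S X
    proof (rule u_joint(3)[OF t0 that(2) _ _ that(3)])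
      show "0 < S n" "S n \<le> T" for n using that(1)[of n] t0 by auto
    qed
    show "\<bar>f s y\<bar> \<le> F" if "s \<in> {0<..<T}" for s y by (rule bcD(2)[OF F[OF that]])
    show "f s \<in> borel_measurable borel" if "s \<in> {0<..<T}" for s by (rule bc_borel[OF F[OF that]])
  qed
  then obtain d2 where d2: "0 < d2" "\<forall>s h. s \<in> {0<..<T} \<longrightarrow> \<bar>s - t0\<bar> < d2 \<longrightarrow> 0 < h \<longrightarrow> h < d2 \<longrightarrow> \<bar>P h (f s) x - f t0 x\<bar> \<le> e / 2"
    by blast
  \<comment> \<open>d <= t0/2 keeps s above t0/2, where L u is bounded; the halves of d1 and d2
    allow for t - s < 2 d.\<close>
  define d where "d = min (t0 / 2) (min d1 d2 / 2)"
  show ?thesis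
  proof (intro exI[of _ d] conjI allI impI)
    show "0 < d" using d1(1) d2(1) t0 by (simp add: d_def)
    fix s t assume a: "0 < s" "s < t" "t \<le> T" "\<bar>s - t0\<bar> < d" "\<bar>t - t0\<bar> < d"
    have d': "d \<le> t0 / 2" "2 * d \<le> d1" "2 * d \<le> d2" "0 < d" using d1(1) d2(1) t0 by (auto simp: d_def)
    have st: "s \<le> T" "0 < t - s" "0 \<le> t - s" "s \<le> t" using a by auto
    have s2: "s \<in> {t0 / 2..T}" "\<bar>s - t0\<bar> < d1" using a st d' by auto
    let ?I = "\<integral>r. P r (?L s) x \<partial>itv 0 (t - s)" and ?J = "\<integral>\<sigma>. P (t - \<sigma>) (f \<sigma>) x \<partial>itv s t"
    have I: "\<bar>?I - (t - s - 0) * ?L t0 x\<bar> \<le> (t - s - 0) * (e / 2)"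
    proof (rule itv_average[OF u_dynkin(2)[OF a(1) st(1,2)] st(3)])
      fix r assume r: "0 < r" "r < t - s"
      then have "r < d1" using a d' by linarith
      then show "\<bar>P r (?L s) x - ?L t0 x\<bar> \<le> e / 2" using d1(2) s2 r(1) by blast
    qed
    have J: "\<bar>?J - (t - s) * f t0 x\<bar> \<le> (t - s) * (e / 2)"
    proof (rule itv_average[OF restart(2)[OF a(1-3)] st(4)])
      fix \<sigma> assume r: "s < \<sigma>" "\<sigma> < t"
      then have "\<sigma> \<in> {0<..<T}" "\<bar>\<sigma> - t0\<bar> < d2" "0 < t - \<sigma>" "t - \<sigma> < d2" using a d' by auto
      then show "\<bar>P (t - \<sigma>) (f \<sigma>) x - f t0 x\<bar> \<le> e / 2" using d2(2) by blast
    qed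
    have "u t x - u s x = ?I + ?J"
      using restart(1)[OF a(1-3), of x] u_dynkin(3)[OF a(1) st(1,2), of x] by simp
    then have "u t x - u s x - (t - s) * (?L t0 x + f t0 x) = (?I - (t - s - 0) * ?L t0 x) + (?J - (t - s) * f t0 x)"
      by (simp add: distrib_left)
    then show "\<bar>u t x - u s x - (t - s) * (?L t0 x + f t0 x)\<bar> \<le> e * (t - s)"
      using abs_triangle_ineq[of "?I - (t - s - 0) * ?L t0 x" "?J - (t - s) * f t0 x"] I J by (simp add: mult.commute)
  qed
qed

lemma u_time_derivative:
  assumes t0: "0 < t0" "t0 \<le> T"
  shows "((\<lambda>s. u s x) has_real_derivative levy_operator A \<mu> (u t0) x + f t0 x) (at t0 within {0<..T})"
  unfolding has_field_derivative_def has_derivative_within_alt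
proof (intro conjI allI impI)
  let ?c = "levy_operator A \<mu> (u t0) x + f t0 x"
  show "bounded_linear (\<lambda>h. ?c * h)" by (rule bounded_linear_mult_right)
  fix e :: real assume "0 < e"
  then obtain d where d: "0 < d" "\<forall>s t. 0 < s \<longrightarrow> s < t \<longrightarrow> t \<le> T \<longrightarrow> \<bar>s - t0\<bar> < d \<longrightarrow> \<bar>t - t0\<bar> < d \<longrightarrow>
    \<bar>u t x - u s x - (t - s) * ?c\<bar> \<le> e * (t - s)" using u_increment[OF t0] by blast
  show "\<exists>d>0. \<forall>y\<in>{0<..T}. norm (y - t0) < d \<longrightarrow> norm (u y x - u t0 x - ?c * (y - t0)) \<le> e * norm (y - t0)"
  proof (intro exI[of _ d] conjI d(1) ballI impI)
    fix y assume y: "y \<in> {0<..T}" "norm (y - t0) < d"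
    consider "y = t0" | "y < t0" | "t0 < y" by linarith
    then show "norm (u y x - u t0 x - ?c * (y - t0)) \<le> e * norm (y - t0)"
    proof cases
      case 2
      then have "\<bar>u t0 x - u y x - (t0 - y) * ?c\<bar> \<le> e * (t0 - y)" using d y t0 by auto
      moreover have "u y x - u t0 x - ?c * (y - t0) = - (u t0 x - u y x - (t0 - y) * ?c)" by (simp add: algebra_simps)
      ultimately show ?thesis using 2 by (simp only: real_norm_def abs_minus) simp
    next
      case 3
      then have "\<bar>u y x - u t0 x - (y - t0) * ?c\<bar> \<le> e * (y - t0)" using d y t0 by auto
      then show ?thesis using 3 by (simp add: mult.commute)
    qed simp
  qed
qed

end

text \<open>P t u0 tends to u0 because u0 is Lipschitz, and the Duhamel integral is at most t
  F.\<close>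

lemma u_initial: "((\<lambda>t. u t x) \<longlongrightarrow> u0 x) (at_right 0)"
proof (rule tendstoI)
  fix e :: real assume e: "0 < e"
  obtain C where C: "0 \<le> C" "bc C u0" "\<forall>x y. \<bar>u0 x - u0 y\<bar> \<le> C * norm (x - y)" using u0_bc by blast
  obtain F where F: "0 < F" "\<forall>s. 0 < s \<longrightarrow> s < T \<longrightarrow> bc F (f s)" using f_bound by blast
  obtain d where d: "0 < d" "\<And>h \<phi> x. 0 < h \<Longrightarrow> h < d \<Longrightarrow> bc C \<phi> \<Longrightarrow> (\<And>x y. \<bar>\<phi> x - \<phi> y\<bar> \<le> C * norm (x - y))
    \<Longrightarrow> \<bar>P h \<phi> x - \<phi> x\<bar> \<le> e / 2" using P_lipschitz_time[of "e / 2" C C] e C(1) by (metis half_gt_zero)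
  define d' where "d' = min (min d T) (e / 2 / F)"
  have d': "0 < d'" using d(1) T e F(1) by (simp add: d'_def)
  have "dist (u t x) (u0 x) < e" if t: "0 < t" "t < d'" for t
  proof -
    have tT: "t \<le> T" "t < d" "t < e / 2 / F" using t by (auto simp: d'_def)
    have 1: "\<bar>P t u0 x - u0 x\<bar> \<le> e / 2" by (rule d(2)[OF t(1) tT(2) C(2)]) (use C(3) in blast)
    have 2: "\<bar>(\<integral>s. P (t - s) (f s) x \<partial>itv 0 t) - (t - 0) * 0\<bar> \<le> (t - 0) * F"
    proof (rule itv_average[OF mild_formula(3)[OF t(1) tT(1)]])
      fix r assume r: "0 < r" "r < t"
      then have "bc F (f r)" using F(2) tT by simp
      then show "\<bar>P (t - r) (f r) x - 0\<bar> \<le> F" using P_bound[OF _ bcD(2), of "t - r"] r by simp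
    qed (use t in simp)
    have "t * F < e / 2" using tT(3) F(1) by (simp only: pos_less_divide_eq)
    moreover have "\<bar>\<integral>s. P (t - s) (f s) x \<partial>itv 0 t\<bar> \<le> t * F" using 2 by simp
    ultimately show ?thesis using 1 unfolding dist_real_def mild_formula(1)[OF t(1) tT(1), of x] by linarith
  qed
  then show "\<forall>\<^sub>F t in at_right 0. dist (u t x) (u0 x) < e"
    unfolding eventually_at_right_field using d' by blast
qed

lemma classical_if_levy_reg:
  assumes "0 < \<theta>" "\<theta> \<le> 1" "integrable \<mu> (\<lambda>z. min 1 (norm z powr (1 + \<theta>)))"
    and "\<And>\<epsilon>. 0 < \<epsilon> \<Longrightarrow> \<exists>C. \<forall>t. \<epsilon> \<le> t \<longrightarrow> t \<le> T \<longrightarrow> levy_reg \<theta> C (u t) (v t) (Wu t)"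
    and "A \<noteq> 0 \<Longrightarrow> \<alpha> + \<beta> > 2"
  shows "classical_solution A \<mu> H T u0 u"
  unfolding classical_solution_def
proof (intro conjI ballI allI)
  fix t x assume "t \<in> {0<..T}"
  then have t: "0 < t" "t \<le> T" by auto
  obtain C where "\<forall>s. t \<le> s \<longrightarrow> s \<le> T \<longrightarrow> levy_reg \<theta> C (u s) (v s) (Wu s)" using assms(4)[OF t(1)] by blast
  then have "levy_reg \<theta> C (u t) (v t) (Wu t)" using t by simp
  then show "levy_operator_defined A \<mu> (u t) x" by (rule levy_operator_defined_reg[OF _ assms(1,3)])
  show "\<exists>u'. ((\<lambda>s. u s x) has_real_derivative u') (at t within {0<..T}) \<and>
    u' - levy_operator A \<mu> (u t) x - H t x (gradient (u t) x) = 0"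
    using u_time_derivative[OF assms t, of x] by (auto simp: f_def v_def)
qed (rule u_initial)

text \<open>If \<alpha> + \<beta> > 2, take \<theta> = 1, for which the moment condition is that of
  a Levy measure. Otherwise \<theta> = \<sigma> - 1: it is positive as \<sigma> > \<alpha> > 1, at
  most 1 as \<sigma> < \<alpha> + \<beta> <= 2, and below \<alpha> - 1 + \<beta>.\<close>

lemma classical_if_dichotomy:
  assumes dich: "\<alpha> + \<beta> > 2 \<or> A = 0 \<and> (\<exists>\<sigma>. \<alpha> < \<sigma> \<and> \<sigma> < \<alpha> + \<beta> \<and> (\<integral>\<^sup>+z. ennreal (min 1 (norm z powr \<sigma>)) \<partial>\<mu>) < \<infinity>)"
  shows "classical_solution A \<mu> H T u0 u"
proof (cases "\<alpha> + \<beta> > 2")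
  case True
  have p: "norm z powr (1 + 1) = (norm z)\<^sup>2" for z :: "real^'n" by (cases "z = 0") simp_all
  show ?thesis
  proof (rule classical_if_levy_reg[of 1])
    show "integrable \<mu> (\<lambda>z. min 1 (norm z powr (1 + 1)))" unfolding p by (rule mu_min_integrable)
  qed (use True u_levy_reg_C2[OF True] in auto)
next
  case False
  then obtain \<sigma> where \<sigma>: "A = 0" "\<alpha> < \<sigma>" "\<sigma> < \<alpha> + \<beta>" "(\<integral>\<^sup>+z. ennreal (min 1 (norm z powr \<sigma>)) \<partial>\<mu>) < \<infinity>" using dich by blast
  show ?thesis
  proof (rule classical_if_levy_reg[of "\<sigma> - 1"])
    show "0 < \<sigma> - 1" "\<sigma> - 1 \<le> 1" using \<sigma> alpha False by auto
    show "integrable \<mu> (\<lambda>z. min 1 (norm z powr (1 + (\<sigma> - 1))))"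
      using \<sigma>(4) by (intro integrableI_nonneg) auto
    show "\<exists>C. \<forall>t. \<epsilon> \<le> t \<longrightarrow> t \<le> T \<longrightarrow> levy_reg (\<sigma> - 1) C (u t) (v t) (Wu t)" if "0 < \<epsilon>" for \<epsilon>
      by (rule u_levy_reg_holder[OF \<sigma>(1) _ _ _ that]) (use \<sigma> alpha False in auto)
  qed (use \<sigma>(1) in simp)
qed

end

theorem theorem5p3:
  fixes A :: "real^'n^'n" and \<mu> :: "(real^'n) measure"
    and p :: "real \<Rightarrow> real^'n \<Rightarrow> real"
    and H :: "real \<Rightarrow> real^'n \<Rightarrow> real^'n \<Rightarrow> real"
    and u0 :: "real^'n \<Rightarrow> real" and u :: "real \<Rightarrow> real^'n \<Rightarrow> real"
    and T \<alpha> \<beta> c0 :: real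
  assumes T: "0 < T"
    and beta: "0 < \<beta>" "\<beta> \<le> 1"
    and triplet: "levy_triplet A \<mu>"
    and kernel: "heat_kernel A \<mu> p"
    and p_smooth: "\<forall>t\<in>{0<..T}. Cb_infinity (p t)"
    and alpha: "1 < \<alpha>" "\<alpha> \<le> 2"
    and c0: "0 < c0"
    and p_gradient: "\<forall>t\<in>{0<..T}.
          (\<integral>\<^sup>+y. ennreal (norm (gradient (p t) y)) \<partial>lborel) \<le> ennreal (c0 * t powr (- 1 / \<alpha>))"
    and alpha_beta: "\<alpha> + \<beta> \<notin> \<nat>"
    and H_cont: "continuous_on ({0..T} \<times> UNIV \<times> UNIV) (\<lambda>(t, x, q). H t x q)"
    and H_zero: "\<exists>H0>0. \<forall>t\<in>{0<..<T}. \<forall>x. \<bar>H t x 0\<bar> \<le> H0"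
    and H_lipschitz: "\<forall>R>0. \<exists>L>0. \<forall>t\<in>{0<..<T}. \<forall>x. \<forall>q\<in>ball 0 R. \<forall>r\<in>ball 0 R.
          \<bar>H t x q - H t x r\<bar> \<le> L * norm (q - r)"
    and H_holder: "\<forall>R>0. \<exists>M>0. \<forall>t\<in>{0..T}. \<forall>q\<in>ball 0 R. \<forall>x y. norm (x - y) < 1 \<longrightarrow>
          \<bar>H t x q - H t y q\<bar> \<le> M * norm (x - y) powr \<beta>"
    and u0_bounded: "bounded (range u0)"
    and u0_lipschitz: "\<exists>C. C-lipschitz_on UNIV u0"
    and dichotomy: "\<alpha> + \<beta> > 2 \<or>
          A = 0 \<and> (\<exists>\<sigma>. \<alpha> < \<sigma> \<and> \<sigma> < \<alpha> + \<beta> \<and>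
                     (\<integral>\<^sup>+z. ennreal (min 1 (norm z powr \<sigma>)) \<partial>\<mu>) < \<infinity>)"
    and u_space: "bounded_cont_into_Cb1 T u"
    and u_mild: "mild_solution p H T u0 u"
  shows "classical_solution A \<mu> H T u0 u"
proof -
  interpret mild A \<mu> p T \<alpha> c0 \<beta> H u0 u
    by unfold_locales (fact triplet kernel T p_smooth alpha c0 p_gradient beta H_cont H_zero H_lipschitz H_holder
      u0_bounded u0_lipschitz u_space u_mild)+
  show ?thesis by (rule classical_if_dichotomy[OF dichotomy])
qed

end
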